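(* Let $(G,E)$ be a connected simple graph with countably infinite vertex set and bounded degree, $\mu$ a conductance on $E$ with $\mu_{xy}\asymp1$ for $(x,y)\in E$, and $K$ a minimal and connected partition of $(G,E)$ parametrized by a bi-infinite tree $(T,\pi,\phi)$. Let $d$ be a metric on $G$ with $\mathrm{diam}(G,d)=\infty$ that fits to $(G,E)$ and satisfies the basic framework w.r.t. $K$ (with constant $r$); replace $T$ by the refined tree $T_r$. Suppose that for some $\beta>\alpha\ge1$: $d(x,y)\asymp1$ for $(x,y)\in E$; $h_{2n}(x,x)\asymp 1/V_d(x,n^{1/\beta})$ for all $x\in G$, $n\ge1$; there are $\lambda,C>0$ with $R(B_d(x,\lambda s),B_d(x,s)^c)V_d(x,s)\ge Cs^\beta$ for all $x$ and $s>r_x$; there is $C'>0$ with $R(x,B_d(x,s)^c)V_d(x,s)\le C's^\beta$ for all $x$ and $s>r_x$; and there is $C''>0$ with $V_d(x,s)\le C''(s/t)^\alpha V_d(x,t)$ for all $x\in G$, $s>t>0$. Then for any $N\ge1$, $N_1\ge0$ and sufficiently large $N_2=N_2(N_1)$, $$\underline{d}_S(G,\mu)=2\frac{\log\underline{\mathcal{N}}}{\log\underline{\mathcal{N}}-\log\underline{\mathcal{R}}_2(N_1,N_2,N)},\qquad \overline{d}_S(G,\mu)=2\frac{\log\overline{\mathcal{N}}}{\log\underline{\mathcal{N}}-\log\underline{\mathcal{R}}_2(N_1,N_2,N)}.$$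
   Context: Weighted graph: $\mu:E\to(0,\infty)$ symmetric; $\mu_x=\sum_{y\sim x}\mu_{xy}$, $\mu(A)=\sum_{x\in A}\mu_x$; $V_d(x,s)=\mu(B_d(x,s))$; $r_x=\inf_{y\ne x}d(x,y)$. Transition probabilities $p(x,y)=\mu_{xy}/\mu_x$, $p_0(x,y)=\delta_{xy}$, $p_n(x,y)=\sum_z p_{n-1}(x,z)p(z,y)$, heat kernel $h_n(x,y)=p_n(x,y)/\mu_y$. Energy $\mathcal{E}(f)=\frac12\sum_{(x,y)\in E}(f(x)-f(y))^2\mu_{xy}$; effective resistance $R(A,B)=(\inf\{\mathcal{E}(f):f|_A=1,f|_B=0\})^{-1}$, $R(x,A)=R(\{x\},A)$. Spectral dimensions (independent of $x$): $\overline{d}_S=2\limsup_n\frac{-\log p_{2n}(x,x)}{\log n}$, $\underline{d}_S=2\liminf_n\frac{-\log p_{2n}(x,x)}{\log n}$. Fitting: (F1) there is $C>0$ with $d(x,y)\le Cd(x,z)$ whenever $x\sim y$, $x\ne z$; (F2) for every $\epsilon>0$ there exist $s>0$, $n\ge1$, $x_0,\dots,x_n$ with $x_i\in B_d(x_0,s)$ for $i<n$, $x_n\notin B_d(x_0,s)$, $x_i\sim x_{i-1}$ and $d(x_i,x_{i-1})\le\epsilon s$. Bi-infinite tree $(T,\pi)$: $T$ countable, (T1) any $w,v$ have $n,m\ge0$ with $\pi^n(w)=\pi^m(v)$, (T2) $\pi^n(w)\ne w$ for $n\ge1$; height $[w]=n-m$ where $\pi^n(w)=\pi^m(\phi)$;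 $(T)_n$, $S(w)=\pi^{-1}(w)$, $S^k(A)=\{v:\pi^k(v)\in A\}$, $T_w=\{v:\pi^n(v)=w,n\ge0\}$, $\Sigma^*$ = sequences $(\omega_n)_{n\in\mathbb{Z}}$, $\omega_n\in(T)_n$, $\pi(\omega_{n+1})=\omega_n$. Partition: $K_w\subseteq G$ finite with (PG1) $\bigcup_{v\in S(w)}K_v=K_w$; (PG2) each $\omega\in\Sigma^*$ has $n_0$ and an edge $x\sim y$ with $K_{\omega_n}=\{x,y\}$ for $n\ge n_0$; (PG3) each edge equals some $K_w$. $\Lambda_e=\{w:\#K_w=2,\#K_{\pi(w)}>2\}$, $T_e=\{w:\#K_{\pi(w)}>2\}$; minimal: $K_w\ne K_v$ for distinct $w,v\in\Lambda_e$; connected: the subgraph induced on $K_w$ is connected for every $w\in T_e$. Scales and basic framework: $g_d(w)=\max_{x,y\in K_w}d(x,y)$ ($w\in T_e$); $\Lambda_s=\{w\in T_e:g_d(w)\le s<g_d(\pi(w))\}$; $E_s$ = distinct pairs in $\Lambda_s$ with intersecting $K$'s; $\Lambda_{s,M}(w)=\{v\in\Lambda_s:l_{E_s}(w,v)\le M\}$; $\Lambda_{s,M}(x)=\bigcup_{w\in\Lambda_s,x\in K_w}\Lambda_{s,M}(w)$; $U_M(x,s)=\{x\}$ if $\Lambda_{s,M}(x)=\emptyset$, else $\bigcup_{w\in\Lambda_{s,M}(x)}K_w$. Uniformly finite: $\sup\{\#\Lambda_{s,1}(w)\}<\infty$; thick: there is $\alpha>0$ such that each $w\in T_e$ has $x\in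 K_w$ with $\Lambda_{\alpha g_d(\pi(w)),1}(x)\subseteq T_w$; adapted: for some $M$ and $\alpha_1,\alpha_2>0$, $B_d(x,\alpha_1s)\subseteq U_M(x,s)\subseteq B_d(x,\alpha_2s)$ for all $x$, $s>0$. Basic framework: $\sup_{w\in T_e\setminus\Lambda_e}\#S(w)<\infty$, uniformly finite, thick, adapted, and $g_d(w)\asymp r^{[w]}$ on $T_e$ for some $r\in(0,1)$. Refined tree $T_r$: for $w\in\Lambda_e$, $K_w=\{w^+,w^-\}$; $n(m)\in\mathbb{N}$ with $2^{-n(m)}\le r^m<2^{1-n(m)}$; $T_r=T_e\sqcup\{u_{w,m,k}:w\in\Lambda_e,m\ge1,0\le k<2^{n(m)}\}$, $\pi_r=\pi$ on $T_e$, $\pi_r(u_{w,1,k})=w$, $\pi_r(u_{w,m,k})=u_{w,m-1,l}$ with $[k2^{-n(m)},(k+1)2^{-n(m)}]\subseteq[l2^{-n(m-1)},(l+1)2^{-n(m-1)}]$, $[u_{w,m,k}]=[w]+m$. In the cable system (each edge a copy of $[0,1]$ glued at vertices), $\mathcal{K}_v$ for $v\in T_e$ is the union of the cables of edges $K_u$, $u\in\Lambda_e\cap T_v$, and $\mathcal{K}_{u_{w,m,k}}$ is the part of the cable of $\{w^+,w^-\}$ with parameter (from $w^+$) in $[k2^{-n(m)},(k+1)2^{-n(m)}]$. $J^h_m=\{(u,v)\in(T_r)_m^2:u\ne v,\mathcal{K}_u\cap\mathcal{K}_v\ne\emptyset\}$, $J^h_{N,m}=\{(u,v)\in(T_r)_m^2:0<l_{J^h_m}(u,v)\le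 N\}$, $\Gamma_n(w)=\{v\in(T_r)_{[w]}:l_{J^h_{[w]}}(w,v)\le n\}$. $\mathcal{E}_{p,k,w}(N_1,N_2,N)=\inf\{\frac12\sum_{(x,y)\in J^h_{N,[w]+k}}|f(x)-f(y)|^p: f:(T_r)_{[w]+k}\to\mathbb{R}, f=1$ on $S^k(\Gamma_{N_1}(w))$, $f=0$ off $S^k(\Gamma_{N_2}(w))\}$. Then $\overline{\mathcal{N}}=\sup_{w\in T_r}\limsup_k\#(S^k(\pi^k(w)))^{1/k}$, $\underline{\mathcal{N}}=\sup_{w\in T_r}\liminf_k\#(S^k(\pi^k(w)))^{1/k}$, $\underline{\mathcal{R}}_p(N_1,N_2,N)=\sup_{w\in T_r}\liminf_k\mathcal{E}_{p,k,\pi^k(w)}(N_1,N_2,N)^{1/k}$. *)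

theory Defs
  imports "HOL-Analysis.Analysis"
begin

text \<open>Vertices are the elements of a type 'a (vertex set = UNIV); adjacency is a
 relation adj; conductances are mu x y (relevant only for adj x y).\<close>

definition simple_graph :: "('a \<Rightarrow> 'a \<Rightarrow> bool) \<Rightarrow> bool" where
  "simple_graph adj \<longleftrightarrow> (\<forall>x y. adj x y \<longrightarrow> adj y x) \<and> (\<forall>x. \<not> adj x x)"

definition graph_connected :: "('a \<Rightarrow> 'a \<Rightarrow> bool) \<Rightarrow> bool" where
  "graph_connected adj \<longleftrightarrow> (\<forall>x y. adj\<^sup>*\<^sup>* x y)"

definition bounded_degree :: "('a \<Rightarrow> 'a \<Rightarrow> bool) \<Rightarrow> bool" where
  "bounded_degree adj \<longleftrightarrow> (\<exists>D::nat. \<forall>x. finite {y. adj x y} \<and> card {y. adj x y} \<le> D)"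

definition conductance :: "('a \<Rightarrow> 'a \<Rightarrow> bool) \<Rightarrow> ('a \<Rightarrow> 'a \<Rightarrow> real) \<Rightarrow> bool" where
  "conductance adj mu \<longleftrightarrow> (\<forall>x y. adj x y \<longrightarrow> mu x y > 0 \<and> mu x y = mu y x)"

definition mux :: "('a \<Rightarrow> 'a \<Rightarrow> bool) \<Rightarrow> ('a \<Rightarrow> 'a \<Rightarrow> real) \<Rightarrow> 'a \<Rightarrow> real" where
  "mux adj mu x = (\<Sum>y\<in>{y. adj x y}. mu x y)"

definition muset :: "('a \<Rightarrow> 'a \<Rightarrow> bool) \<Rightarrow> ('a \<Rightarrow> 'a \<Rightarrow> real) \<Rightarrow> 'a set \<Rightarrow> ennreal" where
  "muset adj mu A = infsum (\<lambda>y. ennreal (mux adj mu y)) A"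

definition dball :: "('a \<Rightarrow> 'a \<Rightarrow> real) \<Rightarrow> 'a \<Rightarrow> real \<Rightarrow> 'a set" where
  "dball d x s = {y. d x y < s}"

definition Vd :: "('a \<Rightarrow> 'a \<Rightarrow> bool) \<Rightarrow> ('a \<Rightarrow> 'a \<Rightarrow> real) \<Rightarrow> ('a \<Rightarrow> 'a \<Rightarrow> real) \<Rightarrow> 'a \<Rightarrow> real \<Rightarrow> ennreal" where
  "Vd adj mu d x s = muset adj mu (dball d x s)"

definition rx :: "('a \<Rightarrow> 'a \<Rightarrow> real) \<Rightarrow> 'a \<Rightarrow> real" where
  "rx d x = Inf {d x y | y. y \<noteq> x}"

definition P1 :: "('a \<Rightarrow> 'a \<Rightarrow> bool) \<Rightarrow> ('a \<Rightarrow> 'a \<Rightarrow> real) \<Rightarrow> 'a \<Rightarrow> 'a \<Rightarrow> real" where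
  "P1 adj mu x y = (if adj x y then mu x y / mux adj mu x else 0)"

primrec pn :: "('a \<Rightarrow> 'a \<Rightarrow> bool) \<Rightarrow> ('a \<Rightarrow> 'a \<Rightarrow> real) \<Rightarrow> nat \<Rightarrow> 'a \<Rightarrow> 'a \<Rightarrow> real" where
  "pn adj mu 0 x y = (if x = y then 1 else 0)"
| "pn adj mu (Suc n) x y = (\<Sum>z\<in>{z. adj z y}. pn adj mu n x z * P1 adj mu z y)"

definition hk :: "('a \<Rightarrow> 'a \<Rightarrow> bool) \<Rightarrow> ('a \<Rightarrow> 'a \<Rightarrow> real) \<Rightarrow> nat \<Rightarrow> 'a \<Rightarrow> 'a \<Rightarrow> real" where
  "hk adj mu n x y = pn adj mu n x y / mux adj mu y"

definition energy :: "('a \<Rightarrow> 'a \<Rightarrow> bool) \<Rightarrow> ('a \<Rightarrow> 'a \<Rightarrow> real) \<Rightarrow> ('a \<Rightarrow> real) \<Rightarrow> ennreal" where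
  "energy adj mu f =
     infsum (\<lambda>(x,y). ennreal ((f x - f y)^2 * mu x y)) {(x,y). adj x y} / 2"

definition Reff :: "('a \<Rightarrow> 'a \<Rightarrow> bool) \<Rightarrow> ('a \<Rightarrow> 'a \<Rightarrow> real) \<Rightarrow> 'a set \<Rightarrow> 'a set \<Rightarrow> ennreal" where
  "Reff adj mu A B = inverse (INF f \<in> {f. (\<forall>x\<in>A. f x = 1) \<and> (\<forall>x\<in>B. f x = 0)}. energy adj mu f)"

definition dS_low :: "('a \<Rightarrow> 'a \<Rightarrow> bool) \<Rightarrow> ('a \<Rightarrow> 'a \<Rightarrow> real) \<Rightarrow> 'a \<Rightarrow> ereal" where
  "dS_low adj mu x = 2 * liminf (\<lambda>n. ereal (- ln (pn adj mu (2*n) x x) / ln (real n)))"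

definition dS_up :: "('a \<Rightarrow> 'a \<Rightarrow> bool) \<Rightarrow> ('a \<Rightarrow> 'a \<Rightarrow> real) \<Rightarrow> 'a \<Rightarrow> ereal" where
  "dS_up adj mu x = 2 * limsup (\<lambda>n. ereal (- ln (pn adj mu (2*n) x x) / ln (real n)))"

definition is_metric :: "('a \<Rightarrow> 'a \<Rightarrow> real) \<Rightarrow> bool" where
  "is_metric d \<longleftrightarrow> (\<forall>x y. d x y \<ge> 0 \<and> (d x y = 0 \<longleftrightarrow> x = y) \<and> d x y = d y x)
     \<and> (\<forall>x y z. d x z \<le> d x y + d y z)"

definition infinite_diam :: "('a \<Rightarrow> 'a \<Rightarrow> real) \<Rightarrow> bool" where
  "infinite_diam d \<longleftrightarrow> (\<forall>B. \<exists>x y. d x y > B)"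

definition fits :: "('a \<Rightarrow> 'a \<Rightarrow> bool) \<Rightarrow> ('a \<Rightarrow> 'a \<Rightarrow> real) \<Rightarrow> bool" where
  "fits adj d \<longleftrightarrow>
    (\<exists>C>0. \<forall>x y z. adj x y \<and> x \<noteq> z \<longrightarrow> d x y \<le> C * d x z) \<and>
    (\<forall>\<epsilon>>0. \<exists>s>0. \<exists>n\<ge>1. \<exists>xs::nat \<Rightarrow> 'a.
        (\<forall>i<n. xs i \<in> dball d (xs 0) s) \<and> xs n \<notin> dball d (xs 0) s \<and>
        (\<forall>i\<in>{1..n}. adj (xs i) (xs (i - 1)) \<and> d (xs i) (xs (i - 1)) \<le> \<epsilon> * s))"

definition bi_infinite_tree :: "('t \<Rightarrow> 't) \<Rightarrow> bool" where
  "bi_infinite_tree \<pi> \<longleftrightarrow> countable (UNIV :: 't set) \<and>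
     (\<forall>w v. \<exists>n m. (\<pi> ^^ n) w = (\<pi> ^^ m) v) \<and> (\<forall>w. \<forall>n\<ge>1. (\<pi> ^^ n) w \<noteq> w)"

definition height :: "('t \<Rightarrow> 't) \<Rightarrow> 't \<Rightarrow> 't \<Rightarrow> int" where
  "height \<pi> \<phi> w = (THE h. \<exists>n m. (\<pi> ^^ n) w = (\<pi> ^^ m) \<phi> \<and> h = int n - int m)"

definition Sigma_star :: "('t \<Rightarrow> 't) \<Rightarrow> 't \<Rightarrow> (int \<Rightarrow> 't) set" where
  "Sigma_star \<pi> \<phi> = {\<omega>. (\<forall>n. height \<pi> \<phi> (\<omega> n) = n \<and> \<pi> (\<omega> (n + 1)) = \<omega> n)}"

definition subtree :: "('t \<Rightarrow> 't) \<Rightarrow> 't \<Rightarrow> 't set" where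
  "subtree \<pi> w = {v. \<exists>n. (\<pi> ^^ n) v = w}"

definition is_partition :: "('a \<Rightarrow> 'a \<Rightarrow> bool) \<Rightarrow> ('t \<Rightarrow> 'a set) \<Rightarrow> ('t \<Rightarrow> 't) \<Rightarrow> 't \<Rightarrow> bool" where
  "is_partition adj K \<pi> \<phi> \<longleftrightarrow>
     (\<forall>w. finite (K w)) \<and>
     (\<forall>w. (\<Union>v\<in>{v. \<pi> v = w}. K v) = K w) \<and>
     (\<forall>\<omega>\<in>Sigma_star \<pi> \<phi>. \<exists>n0 x y. adj x y \<and> (\<forall>n\<ge>n0. K (\<omega> n) = {x, y})) \<and>
     (\<forall>x y. adj x y \<longrightarrow> (\<exists>w. K w = {x, y}))"

definition Lam_e :: "('t \<Rightarrow> 'a set) \<Rightarrow> ('t \<Rightarrow> 't) \<Rightarrow> 't set" where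
  "Lam_e K \<pi> = {w. card (K w) = 2 \<and> card (K (\<pi> w)) > 2}"

definition T_e :: "('t \<Rightarrow> 'a set) \<Rightarrow> ('t \<Rightarrow> 't) \<Rightarrow> 't set" where
  "T_e K \<pi> = {w. card (K (\<pi> w)) > 2}"

definition minimal_partition :: "('t \<Rightarrow> 'a set) \<Rightarrow> ('t \<Rightarrow> 't) \<Rightarrow> bool" where
  "minimal_partition K \<pi> \<longleftrightarrow> (\<forall>w\<in>Lam_e K \<pi>. \<forall>v\<in>Lam_e K \<pi>. w \<noteq> v \<longrightarrow> K w \<noteq> K v)"

definition connected_partition :: "('a \<Rightarrow> 'a \<Rightarrow> bool) \<Rightarrow> ('t \<Rightarrow> 'a set) \<Rightarrow> ('t \<Rightarrow> 't) \<Rightarrow> bool" where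
  "connected_partition adj K \<pi> \<longleftrightarrow>
     (\<forall>w\<in>T_e K \<pi>. \<forall>x\<in>K w. \<forall>y\<in>K w.
        (\<lambda>u v. adj u v \<and> u \<in> K w \<and> v \<in> K w)\<^sup>*\<^sup>* x y)"

definition gd :: "('a \<Rightarrow> 'a \<Rightarrow> real) \<Rightarrow> ('t \<Rightarrow> 'a set) \<Rightarrow> 't \<Rightarrow> real" where
  "gd d K w = Max {d x y | x y. x \<in> K w \<and> y \<in> K w}"

definition Lam_s :: "('a \<Rightarrow> 'a \<Rightarrow> real) \<Rightarrow> ('t \<Rightarrow> 'a set) \<Rightarrow> ('t \<Rightarrow> 't) \<Rightarrow> real \<Rightarrow> 't set" where
  "Lam_s d K \<pi> s = {w \<in> T_e K \<pi>. gd d K w \<le> s \<and> s < gd d K (\<pi> w)}"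

definition E_s :: "('a \<Rightarrow> 'a \<Rightarrow> real) \<Rightarrow> ('t \<Rightarrow> 'a set) \<Rightarrow> ('t \<Rightarrow> 't) \<Rightarrow> real \<Rightarrow> ('t \<times> 't) set" where
  "E_s d K \<pi> s = {(w, v). w \<in> Lam_s d K \<pi> s \<and> v \<in> Lam_s d K \<pi> s \<and> w \<noteq> v \<and> K w \<inter> K v \<noteq> {}}"

definition Lam_sM :: "('a \<Rightarrow> 'a \<Rightarrow> real) \<Rightarrow> ('t \<Rightarrow> 'a set) \<Rightarrow> ('t \<Rightarrow> 't) \<Rightarrow> real \<Rightarrow> nat \<Rightarrow> 't \<Rightarrow> 't set" where
  "Lam_sM d K \<pi> s M w = {v \<in> Lam_s d K \<pi> s. \<exists>n\<le>M. (w, v) \<in> (E_s d K \<pi> s) ^^ n}"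

definition Lam_sM_pt :: "('a \<Rightarrow> 'a \<Rightarrow> real) \<Rightarrow> ('t \<Rightarrow> 'a set) \<Rightarrow> ('t \<Rightarrow> 't) \<Rightarrow> real \<Rightarrow> nat \<Rightarrow> 'a \<Rightarrow> 't set" where
  "Lam_sM_pt d K \<pi> s M x = (\<Union>w\<in>{w \<in> Lam_s d K \<pi> s. x \<in> K w}. Lam_sM d K \<pi> s M w)"

definition U_M :: "('a \<Rightarrow> 'a \<Rightarrow> real) \<Rightarrow> ('t \<Rightarrow> 'a set) \<Rightarrow> ('t \<Rightarrow> 't) \<Rightarrow> nat \<Rightarrow> 'a \<Rightarrow> real \<Rightarrow> 'a set" where
  "U_M d K \<pi> M x s = (if Lam_sM_pt d K \<pi> s M x = {} then {x}
                       else (\<Union>w\<in>Lam_sM_pt d K \<pi> s M x. K w))"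

definition basic_framework ::
  "('a \<Rightarrow> 'a \<Rightarrow> real) \<Rightarrow> ('t \<Rightarrow> 'a set) \<Rightarrow> ('t \<Rightarrow> 't) \<Rightarrow> 't \<Rightarrow> real \<Rightarrow> bool" where
  "basic_framework d K \<pi> \<phi> r \<longleftrightarrow>
     \<comment> \<open>bounded number of children\<close>
     (\<exists>B::nat. \<forall>w \<in> T_e K \<pi> - Lam_e K \<pi>. finite {v. \<pi> v = w} \<and> card {v. \<pi> v = w} \<le> B) \<and>
     \<comment> \<open>uniformly finite\<close>
     (\<exists>B::nat. \<forall>s>0. \<forall>w. finite (Lam_sM d K \<pi> s 1 w) \<and> card (Lam_sM d K \<pi> s 1 w) \<le> B) \<and>
     \<comment> \<open>thick\<close>
     (\<exists>\<alpha>>0. \<forall>w\<in>T_e K \<pi>. \<exists>x\<in>K w.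
          Lam_sM_pt d K \<pi> (\<alpha> * gd d K (\<pi> w)) 1 x \<subseteq> subtree \<pi> w) \<and>
     \<comment> \<open>adapted\<close>
     (\<exists>M::nat. \<exists>\<alpha>1>0. \<exists>\<alpha>2>0. \<forall>x. \<forall>s>0.
          dball d x (\<alpha>1 * s) \<subseteq> U_M d K \<pi> M x s \<and> U_M d K \<pi> M x s \<subseteq> dball d x (\<alpha>2 * s)) \<and>
     \<comment> \<open>g_d(w) comparable to r^[w] on T_e\<close>
     0 < r \<and> r < 1 \<and>
     (\<exists>c>0. \<forall>w\<in>T_e K \<pi>. c * r powr (real_of_int (height \<pi> \<phi> w)) \<le> gd d K w \<and>
                         gd d K w \<le> r powr (real_of_int (height \<pi> \<phi> w)) / c)"

datatype 't rnode = Orig 't | Sub 't nat nat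

definition nr :: "real \<Rightarrow> nat \<Rightarrow> nat" where
  "nr r m = (THE n::nat. 2 powr (- real n) \<le> r ^ m \<and> r ^ m < 2 powr (1 - real n))"

definition T_r :: "('t \<Rightarrow> 'a set) \<Rightarrow> ('t \<Rightarrow> 't) \<Rightarrow> real \<Rightarrow> 't rnode set" where
  "T_r K \<pi> r = Orig ` T_e K \<pi> \<union>
     {Sub w m k | w m k. w \<in> Lam_e K \<pi> \<and> 1 \<le> m \<and> k < 2 ^ nr r m}"

fun pi_r :: "('t \<Rightarrow> 't) \<Rightarrow> real \<Rightarrow> 't rnode \<Rightarrow> 't rnode" where
  "pi_r \<pi> r (Orig w) = Orig (\<pi> w)"
| "pi_r \<pi> r (Sub w m k) = (if m \<le> 1 then Orig w else
     Sub w (m - 1) (THE l. l < 2 ^ nr r (m - 1) \<and>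
        real l / 2 ^ nr r (m - 1) \<le> real k / 2 ^ nr r m \<and>
        real (k + 1) / 2 ^ nr r m \<le> real (l + 1) / 2 ^ nr r (m - 1)))"

fun height_r :: "('t \<Rightarrow> 't) \<Rightarrow> 't \<Rightarrow> 't rnode \<Rightarrow> int" where
  "height_r \<pi> \<phi> (Orig w) = height \<pi> \<phi> w"
| "height_r \<pi> \<phi> (Sub w m k) = height \<pi> \<phi> w + int m"

text \<open>Points of the cable system: vertices, and interior points of edges.  An interior
 point of the cable of the edge {x,y} at parameter t from x is represented both as
 CE x y t and as CE y x (1-t); all cable sets below contain both representatives.\<close>
datatype 'a cpt = CV 'a | CE 'a 'a real

definition cable_seg :: "'a \<Rightarrow> 'a \<Rightarrow> real \<Rightarrow> real \<Rightarrow> 'a cpt set" where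
  "cable_seg x y a b =
     (if a \<le> 0 \<and> 0 \<le> b then {CV x} else {}) \<union> (if a \<le> 1 \<and> 1 \<le> b then {CV y} else {}) \<union>
     {CE x y t | t. a \<le> t \<and> t \<le> b \<and> 0 < t \<and> t < 1} \<union>
     {CE y x (1 - t) | t. a \<le> t \<and> t \<le> b \<and> 0 < t \<and> t < 1}"

text \<open>pm w = (w^+, w^-) is the chosen orientation of the edge K_w, w in Lambda_e.\<close>
fun cable :: "('t \<Rightarrow> 'a set) \<Rightarrow> ('t \<Rightarrow> 't) \<Rightarrow> real \<Rightarrow> ('t \<Rightarrow> 'a \<times> 'a) \<Rightarrow> 't rnode \<Rightarrow> 'a cpt set" where
  "cable K \<pi> r pm (Orig v) =
     (\<Union>u\<in>Lam_e K \<pi> \<inter> subtree \<pi> v. cable_seg (fst (pm u)) (snd (pm u)) 0 1)"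
| "cable K \<pi> r pm (Sub w m k) =
     cable_seg (fst (pm w)) (snd (pm w)) (real k / 2 ^ nr r m) (real (k + 1) / 2 ^ nr r m)"

definition level_r :: "('t \<Rightarrow> 'a set) \<Rightarrow> ('t \<Rightarrow> 't) \<Rightarrow> 't \<Rightarrow> real \<Rightarrow> int \<Rightarrow> 't rnode set" where
  "level_r K \<pi> \<phi> r m = {u \<in> T_r K \<pi> r. height_r \<pi> \<phi> u = m}"

definition Jh :: "('t \<Rightarrow> 'a set) \<Rightarrow> ('t \<Rightarrow> 't) \<Rightarrow> 't \<Rightarrow> real \<Rightarrow> ('t \<Rightarrow> 'a \<times> 'a) \<Rightarrow> int \<Rightarrow> ('t rnode \<times> 't rnode) set" where
  "Jh K \<pi> \<phi> r pm m = {(u, v). u \<in> level_r K \<pi> \<phi> r m \<and> v \<in> level_r K \<pi> \<phi> r m \<and> u \<noteq> v \<and>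
                               cable K \<pi> r pm u \<inter> cable K \<pi> r pm v \<noteq> {}}"

definition JhN :: "('t \<Rightarrow> 'a set) \<Rightarrow> ('t \<Rightarrow> 't) \<Rightarrow> 't \<Rightarrow> real \<Rightarrow> ('t \<Rightarrow> 'a \<times> 'a) \<Rightarrow> nat \<Rightarrow> int \<Rightarrow> ('t rnode \<times> 't rnode) set" where
  "JhN K \<pi> \<phi> r pm N m = {(u, v). u \<in> level_r K \<pi> \<phi> r m \<and> v \<in> level_r K \<pi> \<phi> r m \<and> u \<noteq> v \<and>
                               (\<exists>j\<le>N. (u, v) \<in> (Jh K \<pi> \<phi> r pm m) ^^ j)}"

definition Gamma :: "('t \<Rightarrow> 'a set) \<Rightarrow> ('t \<Rightarrow> 't) \<Rightarrow> 't \<Rightarrow> real \<Rightarrow> ('t \<Rightarrow> 'a \<times> 'a) \<Rightarrow> nat \<Rightarrow> 't rnode \<Rightarrow> 't rnode set" where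
  "Gamma K \<pi> \<phi> r pm n w = {v \<in> level_r K \<pi> \<phi> r (height_r \<pi> \<phi> w).
       \<exists>j\<le>n. (w, v) \<in> (Jh K \<pi> \<phi> r pm (height_r \<pi> \<phi> w)) ^^ j}"

definition Sk :: "('t \<Rightarrow> 'a set) \<Rightarrow> ('t \<Rightarrow> 't) \<Rightarrow> real \<Rightarrow> nat \<Rightarrow> 't rnode set \<Rightarrow> 't rnode set" where
  "Sk K \<pi> r k A = {v \<in> T_r K \<pi> r. (pi_r \<pi> r ^^ k) v \<in> A}"

definition Ep :: "('t \<Rightarrow> 'a set) \<Rightarrow> ('t \<Rightarrow> 't) \<Rightarrow> 't \<Rightarrow> real \<Rightarrow> ('t \<Rightarrow> 'a \<times> 'a) \<Rightarrow>
                  real \<Rightarrow> nat \<Rightarrow> 't rnode \<Rightarrow> nat \<Rightarrow> nat \<Rightarrow> nat \<Rightarrow> real" where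
  "Ep K \<pi> \<phi> r pm p k w N1 N2 N =
     (let L = level_r K \<pi> \<phi> r (height_r \<pi> \<phi> w + int k) in
      enn2real (INF f \<in> {f :: 't rnode \<Rightarrow> real.
                  (\<forall>x\<in>L. x \<in> Sk K \<pi> r k (Gamma K \<pi> \<phi> r pm N1 w) \<longrightarrow> f x = 1) \<and>
                  (\<forall>x\<in>L. x \<notin> Sk K \<pi> r k (Gamma K \<pi> \<phi> r pm N2 w) \<longrightarrow> f x = 0)}.
         infsum (\<lambda>(x, y). ennreal (\<bar>f x - f y\<bar> powr p))
                (JhN K \<pi> \<phi> r pm N (height_r \<pi> \<phi> w + int k)) / 2))"

definition N_up :: "('t \<Rightarrow> 'a set) \<Rightarrow> ('t \<Rightarrow> 't) \<Rightarrow> real \<Rightarrow> ereal" where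
  "N_up K \<pi> r = (SUP w \<in> T_r K \<pi> r. limsup (\<lambda>k.
       ereal (real (card (Sk K \<pi> r k {(pi_r \<pi> r ^^ k) w})) powr (1 / real k))))"

definition N_low :: "('t \<Rightarrow> 'a set) \<Rightarrow> ('t \<Rightarrow> 't) \<Rightarrow> real \<Rightarrow> ereal" where
  "N_low K \<pi> r = (SUP w \<in> T_r K \<pi> r. liminf (\<lambda>k.
       ereal (real (card (Sk K \<pi> r k {(pi_r \<pi> r ^^ k) w})) powr (1 / real k))))"

definition R_low :: "('t \<Rightarrow> 'a set) \<Rightarrow> ('t \<Rightarrow> 't) \<Rightarrow> 't \<Rightarrow> real \<Rightarrow> ('t \<Rightarrow> 'a \<times> 'a) \<Rightarrow>
                     real \<Rightarrow> nat \<Rightarrow> nat \<Rightarrow> nat \<Rightarrow> ereal" where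
  "R_low K \<pi> \<phi> r pm p N1 N2 N = (SUP w \<in> T_r K \<pi> r. liminf (\<lambda>k.
       ereal (Ep K \<pi> \<phi> r pm p k ((pi_r \<pi> r ^^ k) w) N1 N2 N powr (1 / real k))))"

end

theory Submission
  imports Defs
begin

text \<open>
  Write \<open>b(x, s)\<close> for the number of vertices in a ball. All quantities in the theorem are governed by
  the growth of \<open>b(x, r\<^sup>-\<^sup>k)\<close> in \<open>k\<close>. Thickness and adaptedness put a ball of radius comparable to
  \<open>r\<^sup>m\<close> inside every large cell of height \<open>m\<close>, so by volume doubling the number of descendants of
  \<open>\<pi>\<^sup>k(w)\<close> at the level of \<open>w\<close> is comparable to \<open>b(x, r\<^sup>-\<^sup>k)\<close>, and only boundedly many cells of height
  \<open>m\<close> meet a ball of radius comparable to \<open>r\<^sup>m\<close>. Hence balls are sandwiched between the neighbourhoods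
  \<open>\<Gamma>\<^sub>n\<close>, and since the level of \<open>w\<close> is fixed, the discrete energies at that level are comparable to the
  Dirichlet energy of the graph. The two resistance estimates then show that the energies at
  \<open>\<pi>\<^sup>k(w)\<close> are comparable to \<open>b(x, r\<^sup>-\<^sup>k) r\<^bsup>\<beta>k\<^esup>\<close>, which yields
  \<open>log N - log R = - \<beta> log r\<close>, while the heat kernel estimate expresses the return probabilities
  through \<open>b(x, n\<^bsup>1/\<beta>\<^esup>)\<close>. The lower bounds are needed for a single \<open>w\<close> only, which is chosen so high
  up in the tree that its level contains no subdivided edges.
\<close>

section \<open>Heights and partitions\<close>

text \<open>The node \<open>(\<pi> ^^ k) w\<close> has height \<open>[w] - k\<close>, so its
  descendants of order \<open>k\<close>, and the functions in its energy, live on the fixed level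
  \<open>[w]\<close>; only the size of the neighbourhoods grows with \<open>k\<close>. Constants may
  therefore depend on \<open>w\<close>, because \<open>k\<close>-th roots remove them. The threshold
  for \<open>N2\<close> may not: it comes from a bound, uniform over all coarse levels, on the
  number of horizontal steps between cells of one level at distance comparable to their size.

  Two obstacles shape the geometry. Thickness controls chains of length one, whereas adaptedness
  involves chains of length \<open>Ma\<close>, so thickness has to be iterated. Metric balls need
  not be connected in the graph, so chains of cells are found inside the sets \<open>U_M\<close>,
  which are connected and comparable to balls.

  Edge lengths are comparable to 1, hence edge nodes have bounded height. On all levels below that
  bound the refined tree consists of original cells, every edge lies in one of them, and functions
  can be carried back and forth between vertices and nodes.\<close>

context
  fixes \<pi> :: "'t \<Rightarrow> 't" and \<phi> :: 't
  assumes tree: "bi_infinite_tree \<pi>"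
begin

text \<open>\<open>height\<close> is a definite description, so the difference of exponents must be
  unique: two meeting pairs with different differences would make an iterate of
  \<open>\<phi>\<close> periodic, against (T2).\<close>

lemma height_eqI:
  assumes "(\<pi> ^^ n) w = (\<pi> ^^ m) \<phi>"
  shows "height \<pi> \<phi> w = int n - int m"
proof -
  have aper: "(\<pi> ^^ k) x \<noteq> x" if "k \<ge> 1" for k x
    using tree that by (auto simp: bi_infinite_tree_def)
  have le: "\<not> n' + m < n + m'" if e: "(\<pi> ^^ n') w = (\<pi> ^^ m') \<phi>" "(\<pi> ^^ n) w = (\<pi> ^^ m) \<phi>"
    for n m n' m'
  proof
    assume l: "n' + m < n + m'"
    have "(\<pi> ^^ (n + m')) \<phi> = (\<pi> ^^ (n + n')) w"
      by (simp add: funpow_add e(1))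
    also have "\<dots> = (\<pi> ^^ (n' + m)) \<phi>"
      unfolding add.commute[of n n'] by (simp add: funpow_add e(2))
    finally have "(\<pi> ^^ (n + m')) \<phi> = (\<pi> ^^ (n' + m)) \<phi>" .
    moreover have "n + m' = (n + m' - (n' + m)) + (n' + m)" using l by simp
    ultimately have "(\<pi> ^^ (n + m' - (n' + m))) ((\<pi> ^^ (n' + m)) \<phi>) = (\<pi> ^^ (n' + m)) \<phi>"
      by (metis comp_apply funpow_add)
    with aper[of "n + m' - (n' + m)"] l show False by simp
  qed
  have "h = int n - int m" if "(\<pi> ^^ n') w = (\<pi> ^^ m') \<phi>" "h = int n' - int m'" for h n' m'
    using le[OF that(1) assms] le[OF assms that(1)] that(2) by linarith
  then show ?thesis unfolding height_def
    using assms by (intro the_equality) blast+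
qed

lemma height_pi: "height \<pi> \<phi> (\<pi> w) = height \<pi> \<phi> w - 1"
proof -
  obtain n m where nm: "(\<pi> ^^ n) w = (\<pi> ^^ m) \<phi>"
    using tree unfolding bi_infinite_tree_def by blast
  have "(\<pi> ^^ n) (\<pi> w) = (\<pi> ^^ (Suc m)) \<phi>"
    unfolding funpow_swap1[symmetric] using nm by simp
  from height_eqI[OF this] height_eqI[OF nm] show ?thesis by simp
qed

lemma height_funpow: "height \<pi> \<phi> ((\<pi> ^^ n) w) = height \<pi> \<phi> w - int n"
  by (induction n) (simp_all add: height_pi)

end

lemma subtree_trans: "v \<in> subtree \<pi> u \<Longrightarrow> u \<in> subtree \<pi> w \<Longrightarrow> v \<in> subtree \<pi> w"
proof -
  assume "v \<in> subtree \<pi> u" "u \<in> subtree \<pi> w"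
  then obtain n m where "(\<pi> ^^ n) v = u" "(\<pi> ^^ m) u = w" by (auto simp: subtree_def)
  then have "(\<pi> ^^ (m + n)) v = w" by (simp add: funpow_add)
  then show ?thesis unfolding subtree_def by blast
qed

lemma subtree_funpow: "w \<in> subtree \<pi> ((\<pi> ^^ n) w)"
  unfolding subtree_def by blast

text \<open>(PG1) lets a childless node carry an empty cell, hence the separate assumption
  \<open>cell_nonempty\<close>. Thickness supplies it later, as it provides a point in every cell of
  \<open>T_e\<close>.\<close>

locale graph_partition =
  fixes adj :: "'a \<Rightarrow> 'a \<Rightarrow> bool" and K :: "'t \<Rightarrow> 'a set" and \<pi> :: "'t \<Rightarrow> 't" and \<phi> :: 't
    and deg_bound :: nat
  assumes infinite_vertices: "infinite (UNIV :: 'a set)"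
    and adj_sym: "adj x y \<Longrightarrow> adj y x"
    and adj_irrefl: "\<not> adj x x"
    and connected_graph: "adj\<^sup>*\<^sup>* x y"
    and finite_neighbours: "finite {y. adj x y}"
    and card_neighbours: "card {y. adj x y} \<le> deg_bound"
    and tree: "bi_infinite_tree \<pi>"
    and partition: "is_partition adj K \<pi> \<phi>"
    and minimal: "minimal_partition K \<pi>"
    and cell_nonempty: "w \<in> T_e K \<pi> \<Longrightarrow> K w \<noteq> {}"
begin

abbreviation h :: "'t \<Rightarrow> int" where "h w \<equiv> height \<pi> \<phi> w"
abbreviation Te :: "'t set" where "Te \<equiv> T_e K \<pi>"
abbreviation Le :: "'t set" where "Le \<equiv> Lam_e K \<pi>"

lemmas h_funpow = height_funpow[OF tree, of \<phi>]
lemmas h_pi = height_pi[OF tree, of \<phi>]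

lemmas partitionD = partition[unfolded is_partition_def]

lemma finite_K: "finite (K w)"
  by (rule spec[OF conjunct1[OF partitionD]])

lemma K_children: "(\<Union>v\<in>{v. \<pi> v = w}. K v) = K w"
  by (rule spec[OF conjunct1[OF conjunct2[OF partitionD]]])

lemma edge_eventually:
  "\<omega> \<in> Sigma_star \<pi> \<phi> \<Longrightarrow> \<exists>n0 x y. adj x y \<and> (\<forall>n\<ge>n0. K (\<omega> n) = {x, y})"
  by (rule bspec[OF conjunct1[OF conjunct2[OF conjunct2[OF partitionD]]]])

lemma edge_cell: "adj x y \<Longrightarrow> \<exists>w. K w = {x, y}"
  by (rule mp[OF spec[OF spec[OF conjunct2[OF conjunct2[OF conjunct2[OF partitionD]]]]]])

lemma neighbour_exists: "\<exists>y. adj x y"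
proof -
  obtain z where "z \<noteq> x" using ex_new_if_finite[OF infinite_vertices, of "{x}"] by auto
  with connected_graph[of x z] show ?thesis by (cases rule: converse_rtranclpE) blast+
qed

lemma K_mono_pi: "K v \<subseteq> K (\<pi> v)"
  using K_children[of "\<pi> v"] by blast

lemma K_mono_funpow: "K v \<subseteq> K ((\<pi> ^^ n) v)"
proof (induction n)
  case (Suc n)
  then show ?case using K_mono_pi[of "(\<pi> ^^ n) v"] by simp
qed simp

lemma K_mono: "v \<in> subtree \<pi> w \<Longrightarrow> K v \<subseteq> K w"
  using K_mono_funpow[of v] unfolding subtree_def by blast

lemma Te_pi: "w \<in> Te \<Longrightarrow> \<pi> w \<in> Te"
  unfolding T_e_def using card_mono[OF finite_K K_mono_pi, of "\<pi> w"] by simp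

lemma Te_funpow: "w \<in> Te \<Longrightarrow> (\<pi> ^^ n) w \<in> Te"
  by (induction n) (simp_all add: Te_pi)

lemma Le_subset_Te: "Le \<subseteq> Te"
  by (auto simp: Lam_e_def T_e_def)

text \<open>Follow a vertex down the tree and extend the resulting ray upwards by iterating the parent
  map: this is an element of the boundary, so it ends in an edge.\<close>

lemma edge_below:
  assumes "x \<in> K w"
  shows "\<exists>l a b. l \<in> subtree \<pi> w \<and> K l = {a, b} \<and> adj a b \<and> x \<in> K l"
proof -
  have step: "\<exists>v'. \<pi> v' = v \<and> x \<in> K v'" if "x \<in> K v" for v
    using K_children[of v] that by blast
  define nx where "nx v = (SOME v'. \<pi> v' = v \<and> x \<in> K v')" for v
  have nx: "\<pi> (nx v) = v \<and> x \<in> K (nx v)" if "x \<in> K v" for v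
    unfolding nx_def using someI_ex[OF step[OF that]] .
  have xin: "x \<in> K ((nx ^^ n) w)" for n
    by (induction n) (use assms nx in auto)
  have down: "\<pi> ((nx ^^ Suc n) w) = (nx ^^ n) w" for n
    using nx[OF xin[of n]] by simp
  have ret: "(\<pi> ^^ n) ((nx ^^ n) w) = w" for n
  proof (induction n)
    case (Suc n)
    then show ?case using down[of n] by (metis comp_apply funpow_Suc_right)
  qed simp
  have hdown: "h ((nx ^^ n) w) = h w + int n" for n
    using h_funpow[of n "(nx ^^ n) w"] ret[of n] by simp
  define \<omega> where "\<omega> n = (if n \<ge> h w then (nx ^^ nat (n - h w)) w else (\<pi> ^^ nat (h w - n)) w)" for n
  have "\<omega> \<in> Sigma_star \<pi> \<phi>"
    unfolding Sigma_star_def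
  proof (intro CollectI allI conjI)
    fix n
    show "h (\<omega> n) = n" by (simp add: \<omega>_def hdown h_funpow)
    show "\<pi> (\<omega> (n + 1)) = \<omega> n"
    proof (cases "n \<ge> h w")
      case True
      then have "nat (n + 1 - h w) = Suc (nat (n - h w))" by simp
      with True show ?thesis unfolding \<omega>_def using down[of "nat (n - h w)"] by simp
    next
      case False
      then consider "n + 1 = h w" | "n + 1 < h w" by linarith
      then show ?thesis
      proof cases
        case 1
        then have "nat (h w - n) = 1" by simp
        with False 1 show ?thesis by (simp add: \<omega>_def)
      next
        case 2
        then have "nat (h w - n) = Suc (nat (h w - (n + 1)))" by simp
        with 2 show ?thesis by (simp add: \<omega>_def)
      qed
    qed
  qed
  then obtain n0 a b where ab: "adj a b" "\<forall>n\<ge>n0. K (\<omega> n) = {a, b}"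
    using edge_eventually by blast
  define n where "n = max n0 (h w)"
  have n: "n \<ge> n0" "n \<ge> h w" by (auto simp: n_def)
  have "\<omega> n \<in> subtree \<pi> w"
    using n ret unfolding \<omega>_def subtree_def by auto
  moreover have "x \<in> K (\<omega> n)" using n xin by (simp add: \<omega>_def)
  ultimately show ?thesis using ab n by (intro exI[of _ "\<omega> n"] exI[of _ a] exI[of _ b]) auto
qed

text \<open>Cells only grow towards ancestors. The last one before the size first exceeds two
  contains the edge and has at most two elements, hence equals it.\<close>

lemma Le_between:
  assumes "K l = {a, b}" "adj a b" "card (K ((\<pi> ^^ n) l)) > 2"
  shows "\<exists>i<n. (\<pi> ^^ i) l \<in> Le \<and> K ((\<pi> ^^ i) l) = {a, b}"
proof -
  have ab: "a \<noteq> b" using assms(2) adj_irrefl by auto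
  define P where "P i \<longleftrightarrow> card (K ((\<pi> ^^ i) l)) > 2" for i
  have P0: "\<not> P 0" using ab assms(1) by (simp add: P_def)
  define i where "i = (LEAST i. P i)"
  have Pn: "P n" using assms(3) by (simp add: P_def)
  have Pi: "P i" "i \<le> n" unfolding i_def using Pn by (auto intro: LeastI Least_le)
  obtain j where j: "i = Suc j" using P0 Pi(1) by (cases i) auto
  have "\<not> P j" using j unfolding i_def by (metis lessI not_less_Least)
  then have c: "card (K ((\<pi> ^^ j) l)) \<le> 2" by (simp add: P_def)
  have "K ((\<pi> ^^ j) l) = {a, b}"
    using card_seteq[OF finite_K, of "{a, b}" "(\<pi> ^^ j) l"] K_mono_funpow[of l j] c ab assms(1)
    by auto
  moreover then have "(\<pi> ^^ j) l \<in> Le" using Pi(1) ab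
    by (auto simp: Lam_e_def P_def j)
  ultimately show ?thesis using j Pi(2) by (intro exI[of _ j]) auto
qed

lemma Le_below:
  assumes "w \<in> Te" "x \<in> K w"
  shows "\<exists>l\<in>Le. l \<in> subtree \<pi> w \<and> x \<in> K l"
proof -
  obtain l a b where l: "l \<in> subtree \<pi> w" "K l = {a, b}" "adj a b" "x \<in> K l"
    using edge_below[OF assms(2)] by blast
  obtain n where n: "(\<pi> ^^ n) l = w" using l(1) by (auto simp: subtree_def)
  have "card (K ((\<pi> ^^ Suc n) l)) > 2" using assms(1) n by (simp add: T_e_def)
  from Le_between[OF l(2,3) this] obtain i where
    i: "i < Suc n" "(\<pi> ^^ i) l \<in> Le" "K ((\<pi> ^^ i) l) = {a, b}" by blast
  have "(\<pi> ^^ (n - i)) ((\<pi> ^^ i) l) = w"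
    using i(1) n by (metis comp_apply funpow_add le_add_diff_inverse2 less_Suc_eq_le)
  then show ?thesis using i l by (auto simp: subtree_def)
qed

text \<open>\<open>Lam_e\<close> prescribes only the size two. A descending ray ends in an edge
  inside the cell, and counting elements makes it the whole cell.\<close>

lemma Le_edge:
  assumes "l \<in> Le"
  shows "\<exists>a b. K l = {a, b} \<and> adj a b"
proof -
  have c: "card (K l) = 2" using assms by (simp add: Lam_e_def)
  then have "K l \<noteq> {}" by auto
  then obtain x where "x \<in> K l" by blast
  then obtain l' a b where l: "l' \<in> subtree \<pi> l" "K l' = {a, b}" "adj a b"
    using edge_below by blast
  have "a \<noteq> b" using l adj_irrefl by auto
  then have "{a, b} = K l"
    using card_seteq[OF finite_K, of "{a, b}" l] c l K_mono[OF l(1)] by auto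
  then show ?thesis using l by blast
qed

text \<open>(PG3) gives some node with this cell. Its common ancestor with a node whose cell
  contains a third vertex has more than two elements, so an edge node lies in between.\<close>

lemma edge_Le:
  assumes "adj x y"
  shows "\<exists>l\<in>Le. K l = {x, y}"
proof -
  obtain w where w: "K w = {x, y}" using edge_cell assms by blast
  obtain z where z: "z \<notin> {x, y}" using ex_new_if_finite[OF infinite_vertices, of "{x, y}"] by auto
  obtain z' where "adj z z'" using neighbour_exists by blast
  then obtain w' where w': "K w' = {z, z'}" using edge_cell by blast
  obtain n m where nm: "(\<pi> ^^ n) w = (\<pi> ^^ m) w'"
    using tree unfolding bi_infinite_tree_def by blast
  have "{x, y, z} \<subseteq> K ((\<pi> ^^ n) w)"
    using K_mono_funpow[of w n] K_mono_funpow[of w' m] w w' nm by auto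
  moreover have "card {x, y, z} = 3" using z assms adj_irrefl[of x] by (cases "x = y") auto
  ultimately have "card (K ((\<pi> ^^ n) w)) > 2"
    using card_mono[OF finite_K, of "{x, y, z}" "(\<pi> ^^ n) w"] by simp
  from Le_between[OF w assms this] show ?thesis by blast
qed

lemma Le_inj: "l \<in> Le \<Longrightarrow> l' \<in> Le \<Longrightarrow> K l = K l' \<Longrightarrow> l = l'"
  using minimal by (auto simp: minimal_partition_def)

lemma Te_cell_has_Le: "w \<in> Te \<Longrightarrow> \<exists>l\<in>Le. l \<in> subtree \<pi> w"
  using cell_nonempty Le_below by (meson all_not_in_conv)

definition Le_in :: "'a set \<Rightarrow> 't set" where
  "Le_in A = {l \<in> Le. K l \<subseteq> A}"

text \<open>Minimality makes \<open>K\<close> injective on edge nodes, so they are counted by edges,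
  of which at most \<open>deg_bound\<close> start at each vertex of \<open>A\<close>.\<close>

lemma card_Le_in:
  assumes "finite A"
  shows "finite (Le_in A)" "card (Le_in A) \<le> deg_bound * card A"
proof -
  define S where "S = Sigma A (\<lambda>x. {y. adj x y})"
  have fS: "finite S" unfolding S_def using assms finite_neighbours by auto
  have sub: "K ` Le_in A \<subseteq> (\<lambda>(x, y). {x, y}) ` S"
  proof (rule subsetI, elim imageE)
    fix X l assume "X = K l" "l \<in> Le_in A"
    moreover from this obtain a b where "K l = {a, b}" "adj a b" using Le_edge unfolding Le_in_def by blast
    ultimately show "X \<in> (\<lambda>(x, y). {x, y}) ` S" by (auto simp: Le_in_def S_def intro!: image_eqI[of _ _ "(a, b)"])
  qed
  have inj: "inj_on K (Le_in A)" using Le_inj by (auto simp: inj_on_def Le_in_def)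
  show "finite (Le_in A)" using finite_subset[OF sub] fS inj finite_imageD by blast
  have "card (Le_in A) = card (K ` Le_in A)" using inj by (simp add: card_image)
  also have "\<dots> \<le> card S" using surj_card_le[OF fS sub] .
  also have "\<dots> = (\<Sum>x\<in>A. card {y. adj x y})"
    unfolding S_def using assms finite_neighbours by (subst card_SigmaI) auto
  also have "\<dots> \<le> (\<Sum>x\<in>A. deg_bound)" by (intro sum_mono card_neighbours)
  finally show "card (Le_in A) \<le> deg_bound * card A" by (simp add: mult.commute)
qed

definition cells :: "int \<Rightarrow> 't set" where
  "cells m = {v \<in> Te. h v = m}"

text \<open>\<open>nat\<close> truncates at zero, so \<open>anc m w\<close> is \<open>w\<close>
  itself when \<open>m\<close> exceeds \<open>h w\<close>; this keeps \<open>K_anc\<close> free of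
  side conditions.\<close>

definition anc :: "int \<Rightarrow> 't \<Rightarrow> 't" where
  "anc m w = (\<pi> ^^ nat (h w - m)) w"

lemma anc_cells: "w \<in> Te \<Longrightarrow> m \<le> h w \<Longrightarrow> anc m w \<in> cells m"
  by (simp add: anc_def cells_def Te_funpow h_funpow)

lemma K_anc: "K w \<subseteq> K (anc m w)"
  unfolding anc_def by (rule K_mono_funpow)

lemma anc_eq: "w \<in> subtree \<pi> v \<Longrightarrow> anc (h v) w = v"
  using h_funpow by (auto simp: subtree_def anc_def)

lemma anc_subtree: "w \<in> subtree \<pi> v \<Longrightarrow> h v \<le> m \<Longrightarrow> m \<le> h w \<Longrightarrow> anc m w \<in> subtree \<pi> v"
proof -
  assume a: "w \<in> subtree \<pi> v" "h v \<le> m" "m \<le> h w"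
  then obtain n where n: "(\<pi> ^^ n) w = v" by (auto simp: subtree_def)
  then have "h v = h w - int n" using h_funpow by auto
  then have le: "nat (h w - m) \<le> n" using a by linarith
  have "(\<pi> ^^ (n - nat (h w - m))) (anc m w) = v"
    unfolding anc_def using n le by (metis comp_apply funpow_add le_add_diff_inverse2)
  then show ?thesis by (auto simp: subtree_def)
qed

text \<open>Distinct cells of one level have disjoint sets of edge nodes below them, so the total size
  of the cells inside a set is at most linear in the size of that set, even if they overlap.\<close>

lemma cells_in_count:
  fixes m
  assumes "finite A"
  defines "V \<equiv> {v \<in> cells m. K v \<subseteq> A}"
  shows "finite V" "(\<Sum>v\<in>V. card (K v)) \<le> 2 * deg_bound * card A"
proof -
  have sub: "V \<subseteq> anc m ` Le_in A"
  proof
    fix v assume v: "v \<in> V"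
    then obtain l where l: "l \<in> Le" "l \<in> subtree \<pi> v"
      using Te_cell_has_Le by (auto simp: V_def cells_def)
    then have "anc m l = v" using anc_eq v by (auto simp: V_def cells_def)
    moreover have "l \<in> Le_in A" using l K_mono v by (auto simp: V_def Le_in_def)
    ultimately show "v \<in> anc m ` Le_in A" by blast
  qed
  show fV: "finite V" using finite_subset[OF sub] card_Le_in(1)[OF assms(1)] by auto
  define L where "L v = Le \<inter> subtree \<pi> v" for v
  have LA: "L v \<subseteq> Le_in A" if "v \<in> V" for v
    using that K_mono by (auto simp: V_def L_def Le_in_def)
  have fL: "finite (L v)" if "v \<in> V" for v
    using LA[OF that] card_Le_in(1)[OF assms(1)] finite_subset by blast
  \<comment> \<open>Every vertex of the cell lies on an edge node below it, and an edge node carries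
    two vertices.\<close>
  have "card (K v) \<le> 2 * card (L v)" if v: "v \<in> V" for v
  proof -
    have "K v \<subseteq> (\<Union>l\<in>L v. K l)" using Le_below[of v] v unfolding V_def cells_def L_def by blast
    then have "card (K v) \<le> card (\<Union>l\<in>L v. K l)" using finite_K fL[OF v] by (intro card_mono) auto
    also have "\<dots> \<le> (\<Sum>l\<in>L v. card (K l))" by (rule card_UN_le[OF fL[OF v]])
    also have "\<dots> = (\<Sum>l\<in>L v. 2)" by (intro sum.cong) (auto simp: L_def Lam_e_def)
    finally show ?thesis by (simp add: mult.commute)
  qed
  then have "(\<Sum>v\<in>V. card (K v)) \<le> (\<Sum>v\<in>V. 2 * card (L v))" by (rule sum_mono)
  also have "\<dots> = 2 * card (\<Union>v\<in>V. L v)"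
  proof -
    have "card (\<Union>v\<in>V. L v) = (\<Sum>v\<in>V. card (L v))"
    proof (rule card_UN_disjoint[OF fV])
      show "\<forall>i\<in>V. finite (L i)" using fL by auto
      show "\<forall>i\<in>V. \<forall>j\<in>V. i \<noteq> j \<longrightarrow> L i \<inter> L j = {}"
      proof (intro ballI impI equals0I)
        fix i j l assume "i \<in> V" "j \<in> V" "i \<noteq> j" "l \<in> L i \<inter> L j"
        then show False using anc_eq[of l i] anc_eq[of l j] by (auto simp: V_def cells_def L_def)
      qed
    qed
    then show ?thesis by (simp add: sum_distrib_left)
  qed
  also have "\<dots> \<le> 2 * card (Le_in A)"
    using LA card_Le_in(1)[OF assms(1)] by (intro mult_left_mono card_mono) auto
  also have "\<dots> \<le> 2 * deg_bound * card A" using card_Le_in(2)[OF assms(1)] by simp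
  finally show "(\<Sum>v\<in>V. card (K v)) \<le> 2 * deg_bound * card A" .
qed

end

section \<open>Geometry of the cells\<close>

lemma relpow_subset_mono: "(R :: ('b \<times> 'b) set) \<subseteq> S \<Longrightarrow> R ^^ n \<subseteq> S ^^ n"
  by (induction n) (auto intro: relcompI)

text \<open>Volume is measured by cardinality, to which the weighted measure is comparable because
  vertex weights are bounded above and below. \<open>separated\<close> will come from (F1) and the
  lower bound \<open>e0\<close> on edge lengths.\<close>

locale framed_partition = graph_partition adj K \<pi> \<phi> deg_bound
  for adj :: "'a \<Rightarrow> 'a \<Rightarrow> bool" and K :: "'t \<Rightarrow> 'a set" and \<pi> :: "'t \<Rightarrow> 't" and \<phi> :: 't
    and deg_bound :: nat +
  fixes d :: "'a \<Rightarrow> 'a \<Rightarrow> real" and r e0 \<delta> cg tk a1 a2 Cv \<alpha> :: real and Ma :: nat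
  assumes d_nonneg: "d x y \<ge> 0"
    and d_zero: "d x x = 0"
    and d_sym: "d x y = d y x"
    and d_tri: "d x z \<le> d x y + d y z"
    and conn_cells: "connected_partition adj K \<pi>"
    and e0: "e0 > 0"
    and edge_lower: "adj x y \<Longrightarrow> e0 \<le> d x y"
    and edge_upper: "adj x y \<Longrightarrow> d x y \<le> 1 / e0"
    and \<delta>: "\<delta> > 0"
    and separated: "x \<noteq> y \<Longrightarrow> \<delta> \<le> d x y"
    and finite_ball: "finite (dball d x s)"
    and Cv: "Cv > 0"
    and \<alpha>: "\<alpha> \<ge> 0"
    and doubling: "0 < t \<Longrightarrow> t < s \<Longrightarrow>
        real (card (dball d x s)) \<le> Cv * (s / t) powr \<alpha> * real (card (dball d x t))"
    and r: "0 < r" "r < 1"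
    and cg: "cg > 0"
    and gd_lower: "w \<in> T_e K \<pi> \<Longrightarrow> cg * r powr (real_of_int (height \<pi> \<phi> w)) \<le> gd d K w"
    and gd_upper: "w \<in> T_e K \<pi> \<Longrightarrow> gd d K w \<le> r powr (real_of_int (height \<pi> \<phi> w)) / cg"
    and tk: "tk > 0"
    and thick: "w \<in> T_e K \<pi> \<Longrightarrow>
        \<exists>x\<in>K w. Lam_sM_pt d K \<pi> (tk * gd d K (\<pi> w)) 1 x \<subseteq> subtree \<pi> w"
    and a1: "a1 > 0"
    and a2: "a2 > 0"
    and adapted_inner: "s > 0 \<Longrightarrow> dball d x (a1 * s) \<subseteq> U_M d K \<pi> Ma x s"
    and adapted_outer: "s > 0 \<Longrightarrow> U_M d K \<pi> Ma x s \<subseteq> dball d x (a2 * s)"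
begin

definition sc :: "int \<Rightarrow> real" where "sc m = r powr (real_of_int m)"

text \<open>The summand 1 covers ratios \<open>q\<close> up to 1, for which \<open>doubling\<close>
  says nothing, and keeps the factor at least 1.\<close>

definition dbl :: "real \<Rightarrow> real" where "dbl q = 1 + Cv * q powr \<alpha>"

abbreviation ball :: "'a \<Rightarrow> real \<Rightarrow> 'a set" where "ball x s \<equiv> dball d x s"
abbreviation g :: "'t \<Rightarrow> real" where "g w \<equiv> gd d K w"
abbreviation Ls :: "real \<Rightarrow> 't set" where "Ls s \<equiv> Lam_s d K \<pi> s"
abbreviation Es :: "real \<Rightarrow> ('t \<times> 't) set" where "Es s \<equiv> E_s d K \<pi> s"
abbreviation Lpt :: "real \<Rightarrow> nat \<Rightarrow> 'a \<Rightarrow> 't set" where "Lpt s M x \<equiv> Lam_sM_pt d K \<pi> s M x"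

lemma sc_pos [simp]: "sc m > 0"
  using r by (simp add: sc_def)

lemma sc_add: "sc (m + n) = sc m * sc n"
  by (simp add: sc_def powr_add)

lemma sc_pred: "sc (m - 1) = sc m / r"
  using r by (simp add: sc_def powr_diff)

lemma sc_antimono: "m \<le> n \<Longrightarrow> sc n \<le> sc m"
  unfolding sc_def using r by (intro powr_mono') auto

text \<open>Since \<open>r < 1\<close>, low heights are large scales. Bounds of the form
  \<open>- int J\<close> on levels in later statements say that the cells are large enough for the
  argument.\<close>

lemma sc_large: "\<exists>J::nat. \<forall>m\<le>- int J. B \<le> sc m"
proof -
  have "1 / r > 1" using r by simp
  then obtain n where n: "B < (1 / r) ^ n" using real_arch_pow by blast
  have "sc (- int n) = (1 / r) ^ n"
    using r by (simp add: sc_def powr_minus powr_realpow power_one_over divide_simps)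
  then show ?thesis using n sc_antimono by (intro exI[of _ n]) (metis less_imp_le order_trans)
qed

lemma ball_self: "s > 0 \<Longrightarrow> x \<in> ball x s"
  by (simp add: dball_def d_zero)

lemma card_ball_pos: "s > 0 \<Longrightarrow> card (ball x s) > 0"
  using ball_self finite_ball card_gt_0_iff by (metis empty_iff)

lemma ball_subset: "s + d x y \<le> t \<Longrightarrow> ball x s \<subseteq> ball y t"
proof
  fix z assume a: "s + d x y \<le> t" "z \<in> ball x s"
  have "d y z \<le> d y x + d x z" by (rule d_tri)
  with a show "z \<in> ball y t" using d_sym[of y x] by (simp add: dball_def)
qed

lemma dbl_ge1: "dbl q \<ge> 1"
  using Cv by (simp add: dbl_def)

text \<open>A change of centre is paid for by enlarging the radius by \<open>d x y\<close>, after
  which doubling applies with ratio \<open>q\<close>. All volume comparisons go through this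
  form.\<close>

lemma ball_compare:
  assumes "t > 0" "s + d x y \<le> q * t" "q > 0"
  shows "real (card (ball x s)) \<le> dbl q * real (card (ball y t))"
proof -
  have "card (ball x s) \<le> card (ball y (q * t))"
    by (intro card_mono finite_ball ball_subset assms)
  also have "real \<dots> \<le> dbl q * real (card (ball y t))"
  proof (cases "q \<le> 1")
    case True
    then have "q * t \<le> t" using assms by (simp add: mult_left_le_one_le)
    then have "ball y (q * t) \<subseteq> ball y t" by (intro ball_subset) (simp add: d_zero)
    then have "real (card (ball y (q * t))) \<le> 1 * real (card (ball y t))"
      using finite_ball by (simp add: card_mono)
    also have "\<dots> \<le> dbl q * real (card (ball y t))" by (intro mult_right_mono dbl_ge1) auto
    finally show ?thesis .
  next
    case False
    then have "real (card (ball y (q * t))) \<le> Cv * (q * t / t) powr \<alpha> * real (card (ball y t))"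
      using assms by (intro doubling) auto
    also have "\<dots> \<le> dbl q * real (card (ball y t))"
      using assms by (intro mult_right_mono) (auto simp: dbl_def)
    finally show ?thesis .
  qed
  finally show ?thesis by simp
qed

text \<open>By separation a ball of radius \<open>\<delta>\<close> is a single vertex, so doubling
  down to that radius gives a bound independent of the centre.\<close>

lemma ball_uniform: "\<exists>B::nat. \<forall>x. card (ball x s) \<le> B"
proof -
  define q where "q = max 1 (s / \<delta>)"
  have q: "q > 0" "s \<le> q * \<delta>" using \<delta> by (auto simp: q_def max_def field_simps)
  have "real (card (ball x s)) \<le> dbl q" for x
  proof -
    have "ball x \<delta> = {x}"
      using separated[of x] \<delta> d_zero by (force simp: dball_def)
    then show ?thesis using ball_compare[of \<delta> s x x q] q \<delta> by (simp add: d_zero)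
  qed
  then have "card (ball x s) \<le> nat \<lceil>dbl q\<rceil>" for x
    by (metis le_nat_iff nat_le_iff of_int_ceiling_cancel ceiling_mono ceiling_of_nat of_nat_le_iff of_nat_0_le_iff nat_mono nat_int)
  then show ?thesis by blast
qed

lemma finite_dists: "finite {d x y | x y. x \<in> K w \<and> y \<in> K w}"
proof -
  have "{d x y | x y. x \<in> K w \<and> y \<in> K w} = (\<lambda>(x, y). d x y) ` (K w \<times> K w)" by auto
  then show ?thesis using finite_K by simp
qed

lemma d_le_g: "x \<in> K w \<Longrightarrow> y \<in> K w \<Longrightarrow> d x y \<le> g w"
  unfolding gd_def by (intro Max_ge finite_dists) auto

lemma d_le_sc: "w \<in> Te \<Longrightarrow> x \<in> K w \<Longrightarrow> y \<in> K w \<Longrightarrow> d x y \<le> sc (h w) / cg"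
  using d_le_g gd_upper unfolding sc_def by (meson order_trans)

lemma g_edge_le:
  assumes ab: "K l = {a, b}" "adj a b"
  shows "g l \<le> 1 / e0"
proof -
  have "g l \<in> {d x y | x y. x \<in> K l \<and> y \<in> K l}"
    unfolding gd_def by (rule Max_in[OF finite_dists]) (use ab in auto)
  then obtain x y where "x \<in> {a, b}" "y \<in> {a, b}" "g l = d x y" using ab(1) by auto
  then show ?thesis
    using edge_upper[OF ab(2)] edge_upper[OF adj_sym[OF ab(2)]] e0 d_zero[of a] d_zero[of b] by auto
qed

text \<open>The cell of an edge node is an edge, of length between \<open>e0\<close> and
  \<open>1 / e0\<close>, while its diameter is comparable to \<open>r\<close> to the power of the
  height.\<close>

lemma Le_height_bounded: "\<exists>H::nat. \<forall>l\<in>Le. \<bar>h l\<bar> \<le> int H"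
proof -
  obtain J where J: "\<forall>m\<le>- int J. 1 / (e0 * cg) + 1 \<le> sc m" using sc_large by blast
  have "\<bar>h l\<bar> \<le> int J" if l: "l \<in> Le" for l
  proof -
    obtain a b where ab: "K l = {a, b}" "adj a b" using Le_edge l by blast
    have lT: "l \<in> Te" using l Le_subset_Te by blast
    have "e0 \<le> g l" using edge_lower[OF ab(2)] d_le_g[of a l b] ab by auto
    also have "\<dots> \<le> sc (h l) / cg" unfolding sc_def by (rule gd_upper[OF lT])
    finally have lo: "e0 * cg \<le> sc (h l)" using cg by (simp add: field_simps)
    have "cg * sc (h l) \<le> g l" unfolding sc_def by (rule gd_lower[OF lT])
    also have "g l \<le> 1 / e0" by (rule g_edge_le[OF ab])
    finally have up: "sc (h l) \<le> 1 / (e0 * cg)" using cg e0 by (simp add: field_simps)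
    have "\<not> h l \<le> - int J" using J up by force
    moreover have "\<not> h l \<ge> int J"
    proof
      assume "h l \<ge> int J"
      then have "sc (- h l) \<ge> 1 / (e0 * cg) + 1" using J by simp
      moreover have "sc (- h l) * sc (h l) = 1" using sc_add[of "- h l" "h l"] r by (simp add: sc_def)
      moreover have "(1 / (e0 * cg) + 1) * (e0 * cg) \<le> sc (- h l) * sc (h l)"
        using calculation(1) lo e0 cg by (intro mult_mono) (auto intro: less_imp_le)
      ultimately have "(1 / (e0 * cg) + 1) * (e0 * cg) \<le> 1" by simp
      then show False using e0 cg mult_pos_pos[OF e0 cg] by (simp add: distrib_right)
    qed
    ultimately show ?thesis by linarith
  qed
  then show ?thesis by blast
qed

text \<open>At levels up to \<open>- int H\<close> every edge node has an ancestor (possibly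
  itself), so each edge lies in a cell of the level; and subdivided edges, being strictly higher
  than their edge nodes, do not occur there.\<close>

definition H :: nat where "H = (SOME H. \<forall>l\<in>Le. \<bar>h l\<bar> \<le> int H)"

lemma H: "l \<in> Le \<Longrightarrow> \<bar>h l\<bar> \<le> int H"
  using someI_ex[OF Le_height_bounded] unfolding H_def by blast

lemma edge_in_cell:
  assumes "adj x y" "m \<le> - int H"
  shows "\<exists>v\<in>cells m. x \<in> K v \<and> y \<in> K v"
proof -
  obtain l where l: "l \<in> Le" "K l = {x, y}" using edge_Le assms by blast
  have "anc m l \<in> cells m" using l H[of l] assms Le_subset_Te by (intro anc_cells) auto
  then show ?thesis using K_anc[of l m] l by auto
qed

lemma vertex_in_cell:
  assumes "m \<le> - int H"
  shows "\<exists>v\<in>cells m. x \<in> K v"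
  using neighbour_exists edge_in_cell assms by blast

subsection \<open>Thickness for longer chains of cells\<close>

text \<open>Climb until the diameter first exceeds \<open>s\<close>, which happens because the scale
  grows without bound along the ancestors; the node just before belongs to
  \<open>Lam_s\<close>.\<close>

lemma Ls_above:
  assumes "u \<in> Te" "g u \<le> s"
  shows "\<exists>w\<in>Ls s. u \<in> subtree \<pi> w"
proof -
  define P where "P n \<longleftrightarrow> g ((\<pi> ^^ n) u) > s" for n
  have "\<exists>n. P n"
  proof -
    obtain J where J: "\<forall>m\<le>- int J. (s + 1) / cg \<le> sc m" using sc_large by blast
    define n where "n = nat (h u + int J)"
    have "h ((\<pi> ^^ n) u) \<le> - int J" unfolding h_funpow n_def by simp
    then have "(s + 1) / cg \<le> sc (h ((\<pi> ^^ n) u))" using J by blast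
    then have "s + 1 \<le> cg * sc (h ((\<pi> ^^ n) u))" using cg by (simp add: field_simps)
    also have "\<dots> \<le> g ((\<pi> ^^ n) u)" unfolding sc_def by (rule gd_lower[OF Te_funpow[OF assms(1)]])
    finally show ?thesis unfolding P_def by (intro exI[of _ n]) simp
  qed
  then have PL: "P (LEAST n. P n)" by (rule LeastI_ex)
  moreover have "\<not> P 0" using assms by (simp add: P_def)
  ultimately obtain j where j: "(LEAST n. P n) = Suc j" by (cases "LEAST n. P n") auto
  have "\<not> P j" using not_less_Least[of j P] j by simp
  then have "(\<pi> ^^ j) u \<in> Ls s"
    using PL j Te_funpow[OF assms(1), of j] unfolding Lam_s_def P_def by simp
  then show ?thesis using subtree_funpow[of u \<pi> j] by blast
qed

text \<open>From scale \<open>1 / e0\<close> on, the edge node of an edge at \<open>x\<close> is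
  small enough to climb from it to a node of \<open>Lam_s\<close>.\<close>

lemma Ls_cover:
  assumes "1 / e0 \<le> s"
  shows "\<exists>w\<in>Ls s. x \<in> K w"
proof -
  obtain y where y: "adj x y" using neighbour_exists by blast
  then obtain l where l: "l \<in> Le" "K l = {x, y}" using edge_Le by blast
  have "g l \<le> s" using g_edge_le[OF l(2) y] assms by simp
  then obtain w where "w \<in> Ls s" "l \<in> subtree \<pi> w" using Ls_above l Le_subset_Te by blast
  then show ?thesis using K_mono[of l w] l by auto
qed

text \<open>Replace each cell of the chain by an ancestor at scale \<open>s\<close>: consecutive
  ancestors still meet or coincide, so the chain does not get longer.\<close>

lemma Es_chain_coarsen:
  assumes "(u0, u) \<in> Es s' ^^ n" "s' \<le> s" "u0 \<in> subtree \<pi> w0" "w0 \<in> Ls s"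
  shows "\<exists>w\<in>Ls s. u \<in> subtree \<pi> w \<and> (\<exists>k\<le>n. (w0, w) \<in> Es s ^^ k)"
  using assms(1)
proof (induction n arbitrary: u)
  case 0
  then show ?case using assms(3,4) by auto
next
  case (Suc n)
  then obtain v where v: "(u0, v) \<in> Es s' ^^ n" "(v, u) \<in> Es s'" by auto
  obtain w k where w: "w \<in> Ls s" "v \<in> subtree \<pi> w" "k \<le> n" "(w0, w) \<in> Es s ^^ k"
    using Suc.IH[OF v(1)] by blast
  have u: "u \<in> Te" "g u \<le> s" "K v \<inter> K u \<noteq> {}"
    using v(2) assms(2) by (auto simp: E_s_def Lam_s_def)
  obtain w' where w': "w' \<in> Ls s" "u \<in> subtree \<pi> w'" using Ls_above u by blast
  have meet: "K w \<inter> K w' \<noteq> {}" using K_mono[OF w(2)] K_mono[OF w'(2)] u(3) by blast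
  show ?case
  proof (cases "w = w'")
    case True
    then show ?thesis using w w' by (intro bexI[of _ w']) (auto intro!: exI[of _ k])
  next
    case False
    then have "(w, w') \<in> Es s" using meet w w' by (simp add: E_s_def)
    then have "(w0, w') \<in> Es s ^^ Suc k" using w(4) by auto
    then show ?thesis using w w' by (intro bexI[of _ w']) (auto intro!: exI[of _ "Suc k"])
  qed
qed

lemma Lpt_iff:
  "u \<in> Lpt s M x \<longleftrightarrow> u \<in> Ls s \<and> (\<exists>u0\<in>Ls s. x \<in> K u0 \<and> (\<exists>n\<le>M. (u0, u) \<in> Es s ^^ n))"
  unfolding Lam_sM_pt_def Lam_sM_def by auto

lemma Lpt_coarsen:
  assumes "u \<in> Lpt s' M x" "s' \<le> s"
  shows "\<exists>w\<in>Lpt s M x. u \<in> subtree \<pi> w"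
proof -
  obtain u0 n where u0: "u0 \<in> Ls s'" "x \<in> K u0" "n \<le> M" "(u0, u) \<in> Es s' ^^ n"
    using assms(1) unfolding Lpt_iff by blast
  have "u0 \<in> Te" "g u0 \<le> s" using u0(1) assms(2) by (auto simp: Lam_s_def)
  then obtain w0 where w0: "w0 \<in> Ls s" "u0 \<in> subtree \<pi> w0" using Ls_above by blast
  obtain w k where "w \<in> Ls s" "u \<in> subtree \<pi> w" "k \<le> n" "(w0, w) \<in> Es s ^^ k"
    using Es_chain_coarsen[OF u0(4) assms(2) w0(2,1)] by blast
  moreover have "x \<in> K w0" using K_mono[OF w0(2)] u0(2) by blast
  moreover have "k \<le> M" using \<open>k \<le> n\<close> u0(3) by simp
  ultimately have "w \<in> Lpt s M x" unfolding Lpt_iff using w0(1) by blast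
  then show ?thesis using \<open>u \<in> subtree \<pi> w\<close> by blast
qed

text \<open>Cells reached at a finer scale lie below cells reached at the coarser one, so a
  containment obtained from thickness survives any decrease of the scale.\<close>

lemma Lpt_subset_subtree:
  assumes "Lpt s M x \<subseteq> subtree \<pi> v" "s' \<le> s"
  shows "Lpt s' M x \<subseteq> subtree \<pi> v"
proof
  fix u assume "u \<in> Lpt s' M x"
  then obtain w where "w \<in> Lpt s M x" "u \<in> subtree \<pi> w" using Lpt_coarsen[OF _ assms(2)] by blast
  then show "u \<in> subtree \<pi> v" using assms(1) subtree_trans[of u \<pi> w v] by blast
qed

lemma thick_one:
  assumes "v \<in> Te"
  shows "\<exists>x\<in>K v. Lpt (tk * cg * sc (h v)) 1 x \<subseteq> subtree \<pi> v"
proof -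
  obtain x where x: "x \<in> K v" "Lpt (tk * g (\<pi> v)) 1 x \<subseteq> subtree \<pi> v"
    using thick[OF assms] by blast
  have "cg * sc (h v) \<le> cg * sc (h (\<pi> v))"
    unfolding h_pi using cg by (intro mult_left_mono sc_antimono) auto
  also have "\<dots> \<le> g (\<pi> v)" unfolding sc_def by (rule gd_lower[OF Te_pi[OF assms]])
  finally have "tk * (cg * sc (h v)) \<le> tk * g (\<pi> v)" by (rule mult_left_mono) (use tk in simp)
  then show ?thesis using Lpt_subset_subtree[OF x(2)] x(1) by (intro bexI[of _ x]) (auto simp: mult.assoc)
qed

text \<open>Induction on the chain length: apply thickness for chains of length one in the given cell,
  and the induction hypothesis in the subcell around the point this provides.\<close>

lemma thick_chain:
  "\<exists>a>0. \<exists>J::nat. \<forall>v\<in>Te. h v \<le> - int J \<longrightarrow> (\<exists>x\<in>K v. Lpt (a * sc (h v)) (Suc M) x \<subseteq> subtree \<pi> v)"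
proof (induction M)
  case 0
  have "tk * cg > 0" using tk cg by simp
  then show ?case using thick_one by (intro exI[of _ "tk * cg"]) auto
next
  case (Suc M)
  then obtain a' J' where a': "a' > 0"
    and IH: "\<And>v. v \<in> Te \<Longrightarrow> h v \<le> - int J' \<Longrightarrow>
               \<exists>x\<in>K v. Lpt (a' * sc (h v)) (Suc M) x \<subseteq> subtree \<pi> v"
    by blast
  define b where "b = tk * cg"
  have b: "b > 0" using tk cg by (simp add: b_def)
  \<comment> \<open>A cell \<open>w\<close> of scale \<open>b * sc (h v)\<close> has a parent of
    larger diameter, which forces \<open>\<kappa> * sc (h v) < sc (h w)\<close>; the factor
    \<open>r\<close> is the step from the parent to \<open>w\<close>.\<close>
  define \<kappa> where "\<kappa> = r * cg * b"
  have \<kappa>: "\<kappa> > 0" using r cg b by (simp add: \<kappa>_def)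
  \<comment> \<open>The first entry makes the new scale no coarser than the one of the induction
    hypothesis in the subcell \<open>w\<close>; the second keeps it below the scale at which
    one-step thickness holds in \<open>v\<close>.\<close>
  define a where "a = min (a' * \<kappa>) b"
  have a: "a > 0" using a' \<kappa> b by (simp add: a_def)
  \<comment> \<open>The first entry lets \<open>Ls_cover\<close> produce the subcell
    \<open>w\<close>; the second forces its height below \<open>- int J'\<close>, so that the
    induction hypothesis applies to it.\<close>
  obtain J where J: "\<forall>m\<le>- int J. max (1 / (e0 * b)) (sc (- int J') / \<kappa>) \<le> sc m"
    using sc_large by blast
  have "\<exists>x\<in>K v. Lpt (a * sc (h v)) (Suc (Suc M)) x \<subseteq> subtree \<pi> v"
    if v: "v \<in> Te" "h v \<le> - int J" for v
  proof -
    define s where "s = b * sc (h v)"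
    have "1 / (e0 * b) \<le> sc (h v)" "sc (- int J') / \<kappa> \<le> sc (h v)" using J v by auto
    then have big: "1 / e0 \<le> s" "sc (- int J') \<le> \<kappa> * sc (h v)"
      using b e0 \<kappa> by (auto simp: s_def field_simps)
    obtain x where x: "x \<in> K v" "Lpt s 1 x \<subseteq> subtree \<pi> v"
      using thick_one[OF v(1)] unfolding s_def b_def by blast
    obtain w where w: "w \<in> Ls s" "x \<in> K w" using Ls_cover[OF big(1)] by blast
    have "w \<in> Lpt s 1 x" unfolding Lpt_iff using w by (auto intro!: bexI[of _ w] exI[of _ 0])
    then have wv: "w \<in> subtree \<pi> v" using x by blast
    have wT: "w \<in> Te" and sw: "s < g (\<pi> w)" using w by (auto simp: Lam_s_def)
    have "s < sc (h (\<pi> w)) / cg" using sw gd_upper[OF Te_pi[OF wT]] unfolding sc_def by linarith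
    then have scw: "\<kappa> * sc (h v) < sc (h w)"
      unfolding h_pi sc_pred s_def \<kappa>_def using r cg by (simp add: field_simps)
    have "h w \<le> - int J'"
    proof (rule ccontr)
      assume "\<not> h w \<le> - int J'"
      then have "sc (h w) \<le> sc (- int J')" by (intro sc_antimono) auto
      with scw big(2) show False by linarith
    qed
    then obtain y where y: "y \<in> K w" "Lpt (a' * sc (h w)) (Suc M) y \<subseteq> subtree \<pi> w"
      using IH[OF wT] by blast
    have "a * sc (h v) \<le> a' * \<kappa> * sc (h v)" by (intro mult_right_mono) (auto simp: a_def intro: less_imp_le)
    also have "\<dots> \<le> a' * sc (h w)" using scw a' by (simp add: mult.assoc)
    finally have le1: "a * sc (h v) \<le> a' * sc (h w)" .
    have le2: "a * sc (h v) \<le> s" unfolding s_def by (intro mult_right_mono) (auto simp: a_def intro: less_imp_le)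
    let ?s = "a * sc (h v)"
    have sub: "Lpt ?s (Suc M) y \<subseteq> subtree \<pi> w" by (rule Lpt_subset_subtree[OF y(2) le1])
    have "u \<in> subtree \<pi> v" if uin: "u \<in> Lpt ?s (Suc (Suc M)) y" for u
    proof -
      obtain u0 n where u0: "u \<in> Ls ?s" "u0 \<in> Ls ?s" "y \<in> K u0" "n \<le> Suc (Suc M)" "(u0, u) \<in> Es ?s ^^ n"
        using uin unfolding Lpt_iff by blast
      show ?thesis
      proof (cases "n \<le> Suc M")
        case True
        then have "u \<in> Lpt ?s (Suc M) y" unfolding Lpt_iff using u0 by blast
        then show ?thesis using sub wv subtree_trans[of u \<pi> w v] by blast
      next
        case False
        then have "n = Suc (Suc M)" using u0(4) by simp
        then obtain u' where u': "(u0, u') \<in> Es ?s ^^ Suc M" "(u', u) \<in> Es ?s"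
          using u0(5) by auto
        have "u' \<in> Ls ?s" "K u' \<inter> K u \<noteq> {}" using u'(2) by (auto simp: E_s_def)
        then have "u' \<in> Lpt ?s (Suc M) y" unfolding Lpt_iff using u0 u'(1) by blast
        then have u'w: "u' \<in> subtree \<pi> w" using sub by blast
        have "u \<in> Te" "g u \<le> s" using u0(1) le2 by (auto simp: Lam_s_def)
        \<comment> \<open>Only the last cell \<open>u\<close> of the chain may leave
          \<open>w\<close>. At scale \<open>s\<close> its ancestor \<open>p\<close> meets
          \<open>w\<close>, which contains \<open>x\<close>, so \<open>p\<close> is within one step
          of \<open>x\<close> and hence below \<open>v\<close>.\<close>
        then obtain p where p: "p \<in> Ls s" "u \<in> subtree \<pi> p" using Ls_above by blast
        have "K w \<inter> K p \<noteq> {}" using K_mono[OF u'w] K_mono[OF p(2)] \<open>K u' \<inter> K u \<noteq> {}\<close> by blast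
        then have "w = p \<or> (w, p) \<in> Es s ^^ 1" using w p by (auto simp: E_s_def)
        then have "\<exists>k\<le>1. (w, p) \<in> Es s ^^ k"
          by (metis le_refl le0 relpow_0_I)
        then have "p \<in> Lpt s 1 x" unfolding Lpt_iff using w p by blast
        then show ?thesis using x p(2) subtree_trans[of u \<pi> p v] by blast
      qed
    qed
    then show ?thesis using y(1) K_mono[OF wv] by blast
  qed
  then show ?case using a by blast
qed

text \<open>Once all cells within \<open>Ma\<close> steps of \<open>x\<close> lie below
  \<open>v\<close>, adaptedness puts a ball around \<open>x\<close> into \<open>K v\<close>. If
  there are no such cells, \<open>U_M\<close> is \<open>{x}\<close>, which also lies in
  \<open>K v\<close>.\<close>

lemma ball_in_cell:
  "\<exists>a>0. \<exists>J::nat. \<forall>v\<in>Te. h v \<le> - int J \<longrightarrow> (\<exists>x\<in>K v. ball x (a * sc (h v)) \<subseteq> K v)"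
proof -
  obtain a J where a: "a > 0"
    and aJ: "\<And>v. v \<in> Te \<Longrightarrow> h v \<le> - int J \<Longrightarrow>
               \<exists>x\<in>K v. Lpt (a * sc (h v)) (Suc Ma) x \<subseteq> subtree \<pi> v"
    using thick_chain[of Ma] by blast
  have "\<exists>x\<in>K v. ball x (a1 * a * sc (h v)) \<subseteq> K v" if v: "v \<in> Te" "h v \<le> - int J" for v
  proof -
    obtain x where x: "x \<in> K v" "Lpt (a * sc (h v)) (Suc Ma) x \<subseteq> subtree \<pi> v"
      using aJ[OF v] by blast
    have "Lpt (a * sc (h v)) Ma x \<subseteq> Lpt (a * sc (h v)) (Suc Ma) x"
      unfolding subset_iff Lpt_iff by (meson le_SucI)
    then have "K w \<subseteq> K v" if "w \<in> Lpt (a * sc (h v)) Ma x" for w using x(2) K_mono that by blast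
    then have "U_M d K \<pi> Ma x (a * sc (h v)) \<subseteq> K v" using x(1) by (auto simp: U_M_def)
    moreover have "a * sc (h v) > 0" using a by simp
    ultimately show ?thesis using adapted_inner[of "a * sc (h v)" x] x(1)
      by (intro bexI[of _ x]) (auto simp: mult.assoc)
  qed
  moreover have "a1 * a > 0" using a1 a by simp
  ultimately show ?thesis by blast
qed

subsection \<open>Chains of neighbouring cells\<close>

text \<open>Packing: all these cells lie in a ball \<open>Q\<close> of radius comparable to
  \<open>sc m\<close>, and each contains a ball of such a radius, hence a fixed fraction of the
  vertices of \<open>Q\<close>. Their total size is linear in \<open>card Q\<close> by
  \<open>cells_in_count\<close>, although they may overlap.\<close>

lemma near_cells_count:
  assumes "A > 0"
  shows "\<exists>B J::nat. \<forall>m\<le>- int J. \<forall>x.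
    finite {v \<in> cells m. K v \<inter> ball x (A * sc m) \<noteq> {}} \<and>
    card {v \<in> cells m. K v \<inter> ball x (A * sc m) \<noteq> {}} \<le> B"
proof -
  obtain a J where a: "a > 0"
    and aJ: "\<And>v. v \<in> Te \<Longrightarrow> h v \<le> - int J \<Longrightarrow> \<exists>x\<in>K v. ball x (a * sc (h v)) \<subseteq> K v"
    using ball_in_cell by blast
  define A' where "A' = A + 1 / cg"
  have A': "A' > 0" using assms cg by (simp add: A'_def add_pos_pos)
  define q where "q = dbl (2 * A' / a)"
  define B where "B = nat \<lceil>2 * real deg_bound * q\<rceil>"
  have "finite {v \<in> cells m. K v \<inter> ball x (A * sc m) \<noteq> {}} \<and>
    card {v \<in> cells m. K v \<inter> ball x (A * sc m) \<noteq> {}} \<le> B" if m: "m \<le> - int J" for m x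
  proof -
    define Q where "Q = ball x (A' * sc m)"
    define V where "V = {v \<in> cells m. K v \<subseteq> Q}"
    have sub: "{v \<in> cells m. K v \<inter> ball x (A * sc m) \<noteq> {}} \<subseteq> V"
    proof (intro subsetI, elim CollectE conjE)
      fix v assume v: "v \<in> cells m" "K v \<inter> ball x (A * sc m) \<noteq> {}"
      then obtain p where p: "p \<in> K v" "d x p < A * sc m" by (auto simp: dball_def)
      have "z \<in> Q" if z: "z \<in> K v" for z
      proof -
        have "d x z \<le> d x p + d p z" by (rule d_tri)
        also have "d p z \<le> sc m / cg" using d_le_sc[of v p z] v p z by (auto simp: cells_def)
        finally show "z \<in> Q" using p by (simp add: Q_def dball_def A'_def field_simps)
      qed
      then show "v \<in> V" using v by (auto simp: V_def)
    qed
    have fQ: "finite Q" by (simp add: Q_def finite_ball)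
    have fV: "finite V" and sumV: "(\<Sum>v\<in>V. card (K v)) \<le> 2 * deg_bound * card Q"
      unfolding V_def by (rule cells_in_count[OF fQ])+
    have each: "real (card Q) \<le> q * real (card (K v))" if v: "v \<in> V" for v
    proof -
      have vT: "v \<in> Te" "h v = m" "K v \<subseteq> Q" using v by (auto simp: V_def cells_def)
      obtain z where z: "z \<in> K v" "ball z (a * sc m) \<subseteq> K v" using aJ[OF vT(1)] vT(2) m by auto
      have "d x z \<le> A' * sc m" using z(1) vT(3) by (auto simp: Q_def dball_def)
      then have "A' * sc m + d x z \<le> 2 * A' / a * (a * sc m)" using a by (simp add: field_simps)
      then have "real (card Q) \<le> q * real (card (ball z (a * sc m)))"
        unfolding Q_def q_def using a A' by (intro ball_compare) auto
      also have "\<dots> \<le> q * real (card (K v))"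
        using z(2) finite_K dbl_ge1 by (intro mult_left_mono) (auto simp: card_mono q_def intro: order_trans[OF zero_le_one])
      finally show ?thesis .
    qed
    have q0: "q \<ge> 0" using dbl_ge1 order_trans[OF zero_le_one] by (auto simp: q_def)
    have "real (card V) * real (card Q) = (\<Sum>v\<in>V. real (card Q))" by simp
    also have "\<dots> \<le> (\<Sum>v\<in>V. q * real (card (K v)))" by (rule sum_mono[OF each])
    also have "\<dots> = q * real (\<Sum>v\<in>V. card (K v))" by (simp add: sum_distrib_left)
    also have "\<dots> \<le> q * real (2 * deg_bound * card Q)" using sumV q0 by (intro mult_left_mono of_nat_mono) auto
    finally have "real (card V) * real (card Q) \<le> (2 * real deg_bound * q) * real (card Q)" by (simp add: mult_ac)
    moreover have "card Q > 0" unfolding Q_def using A' by (intro card_ball_pos) simp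
    ultimately have "real (card V) \<le> 2 * real deg_bound * q" by simp
    then have "card V \<le> B" unfolding B_def by linarith
    then show ?thesis using sub fV by (meson card_mono finite_subset order_trans)
  qed
  then show ?thesis by blast
qed

definition JJ :: "int \<Rightarrow> ('t \<times> 't) set" where
  "JJ m = {(u, v). u \<in> cells m \<and> v \<in> cells m \<and> u \<noteq> v \<and> K u \<inter> K v \<noteq> {}}"

text \<open>Each cell is connected and consecutive cells of a chain share a vertex. The set
  \<open>U_M\<close> thus replaces the metric ball where a path in the graph is needed.\<close>

lemma U_M_connected:
  assumes "y \<in> U_M d K \<pi> M x s"
  defines "U \<equiv> U_M d K \<pi> M x s"
  shows "(\<lambda>u v. adj u v \<and> u \<in> U \<and> v \<in> U)\<^sup>*\<^sup>* x y"
proof (cases "Lpt s M x = {}")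
  case True
  then show ?thesis using assms by (simp add: U_M_def)
next
  case False
  let ?R = "\<lambda>u v. adj u v \<and> u \<in> U \<and> v \<in> U"
  have KU: "K w \<subseteq> U" if "w \<in> Lpt s M x" for w using that by (auto simp: U_def U_M_def)
  have conn: "?R\<^sup>*\<^sup>* p q" if w: "w \<in> Lpt s M x" "p \<in> K w" "q \<in> K w" for w p q
  proof -
    have "w \<in> Te" using w(1) unfolding Lpt_iff Lam_s_def by blast
    then have "(\<lambda>u v. adj u v \<and> u \<in> K w \<and> v \<in> K w)\<^sup>*\<^sup>* p q"
      using conn_cells w unfolding connected_partition_def by blast
    then show ?thesis by (rule rtranclp_mono[THEN predicate2D, rotated]) (use KU[OF w(1)] in auto)
  qed
  have chain: "?R\<^sup>*\<^sup>* x p" if "u0 \<in> Ls s" "x \<in> K u0" "(u0, u) \<in> Es s ^^ n" "n \<le> M" "p \<in> K u" for u0 u n p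
    using that(3-5)
  proof (induction n arbitrary: u p)
    case 0
    have "u0 \<in> Lpt s M x" unfolding Lpt_iff using that by (auto intro!: bexI[of _ u0] exI[of _ 0])
    then show ?case using conn 0 that by auto
  next
    case (Suc n)
    then obtain v where v: "(u0, v) \<in> Es s ^^ n" "(v, u) \<in> Es s" by auto
    then obtain z where z: "z \<in> K v" "z \<in> K u" and uL: "u \<in> Ls s" by (auto simp: E_s_def)
    have "?R\<^sup>*\<^sup>* x z" using Suc.IH[OF v(1) _ z(1)] Suc.prems by simp
    moreover have "u \<in> Lpt s M x" unfolding Lpt_iff using uL Suc.prems that(1,2) by blast
    ultimately show ?case using conn[OF _ z(2) Suc.prems(3)] by (meson rtranclp_trans)
  qed
  obtain w where "w \<in> Lpt s M x" "y \<in> K w" using assms(1) False by (auto simp: U_M_def)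
  then show ?thesis unfolding Lpt_iff using chain by blast
qed

text \<open>The scale \<open>t m\<close> is chosen so that adaptedness puts \<open>y\<close> into
  \<open>U_M\<close>. A path from \<open>x\<close> to \<open>y\<close> in this connected set stays
  in a ball of radius \<open>A' * sc m\<close>, and its edges lie in cells of level \<open>m\<close>
  meeting that ball. There are at most \<open>B\<close> of these, so a chain needs at most as many
  steps as there are pairs of them; this bound is the same for all coarse levels.\<close>

lemma cells_chain:
  assumes "A > 0"
  shows "\<exists>B J::nat. \<forall>m\<le>- int J. \<forall>v\<in>cells m. \<forall>v'\<in>cells m. \<forall>x\<in>K v. \<forall>y\<in>K v'.
    d x y < A * sc m \<longrightarrow> (\<exists>j\<le>B. (v, v') \<in> JJ m ^^ j)"
proof -
  define t where "t m = A / a1 * sc m" for m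
  define A' where "A' = a2 * (A / a1)"
  have A': "A' > 0" using assms a1 a2 by (simp add: A'_def)
  obtain B J where BJ: "\<And>m x. m \<le> - int J \<Longrightarrow> finite {v \<in> cells m. K v \<inter> ball x (A' * sc m) \<noteq> {}} \<and>
    card {v \<in> cells m. K v \<inter> ball x (A' * sc m) \<noteq> {}} \<le> B"
    using near_cells_count[OF A'] by blast
  have "\<exists>j\<le>B * B. (v, v') \<in> JJ m ^^ j"
    if m: "m \<le> - int (max J H)" and v: "v \<in> cells m" "v' \<in> cells m" "x \<in> K v" "y \<in> K v'" "d x y < A * sc m"
    for m v v' x y
  proof -
    have tp: "t m > 0" using assms a1 by (simp add: t_def)
    define U where "U = U_M d K \<pi> Ma x (t m)"
    have "a1 * t m = A * sc m" using a1 by (simp add: t_def)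
    then have yU: "y \<in> U" using adapted_inner[OF tp, of x] v(5) by (auto simp: U_def dball_def)
    have UB: "U \<subseteq> ball x (A' * sc m)"
      using adapted_outer[OF tp, of x] by (simp add: U_def A'_def t_def mult.assoc)
    define V where "V = {v \<in> cells m. K v \<inter> ball x (A' * sc m) \<noteq> {}}"
    have V: "finite V" "card V \<le> B" using BJ[of m x] m by (auto simp: V_def)
    have inV: "u \<in> V" if "u \<in> cells m" "p \<in> K u" "p \<in> U" for u p using that UB by (auto simp: V_def)
    define JV where "JV = JJ m \<inter> (V \<times> V)"
    have step: "(u, u') \<in> JV\<^sup>*" if "u \<in> cells m" "u' \<in> cells m" "p \<in> K u" "p \<in> K u'" "p \<in> U" for u u' p
    proof (cases "u = u'")
      case False
      then have "(u, u') \<in> JV" using that inV by (auto simp: JV_def JJ_def)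
      then show ?thesis by blast
    qed simp
    have xU: "x \<in> U" using adapted_inner[OF tp, of x] tp a1 by (auto simp: U_def dball_def d_zero)
    have "(\<lambda>u v. adj u v \<and> u \<in> U \<and> v \<in> U)\<^sup>*\<^sup>* x y"
      unfolding U_def by (rule U_M_connected) (use yU in \<open>simp add: U_def\<close>)
    then have "\<forall>u\<in>cells m. y \<in> K u \<longrightarrow> (v, u) \<in> JV\<^sup>*"
    proof (induction rule: rtranclp_induct)
      case base
      then show ?case using step v xU by blast
    next
      case (step p q)
      obtain e where e: "e \<in> cells m" "p \<in> K e" "q \<in> K e" using edge_in_cell[of p q m] step(2) m by force
      have "(v, e) \<in> JV\<^sup>*" using step(3) e by blast
      moreover have "(e, u) \<in> JV\<^sup>*" if "u \<in> cells m" "q \<in> K u" for u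
        using \<open>\<And>u u' p. \<lbrakk>u \<in> cells m; u' \<in> cells m; p \<in> K u; p \<in> K u'; p \<in> U\<rbrakk> \<Longrightarrow> (u, u') \<in> JV\<^sup>*\<close>
          e that step(2) by blast
      ultimately show ?case by (meson rtrancl_trans)
    qed
    then have "(v, v') \<in> JV\<^sup>*" using v by blast
    moreover have fJV: "finite JV" using V by (auto simp: JV_def)
    ultimately obtain j where j: "j \<le> card JV" "(v, v') \<in> JV ^^ j"
      using rtrancl_finite_eq_relpow[OF fJV] by auto
    have "card JV \<le> card (V \<times> V)" using V by (intro card_mono) (auto simp: JV_def)
    also have "\<dots> \<le> B * B" using V by (simp add: card_cartesian_product mult_mono)
    finally have "j \<le> B * B" using j by simp
    moreover have "(v, v') \<in> JJ m ^^ j"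
      using j(2) relpow_subset_mono[of JV "JJ m" j] by (auto simp: JV_def)
    ultimately show ?thesis by blast
  qed
  then show ?thesis by blast
qed

end

section \<open>Comparison of sums\<close>

text \<open>Double counting: the term at \<open>i\<close> is charged to the finite set
  \<open>P i\<close>, and no \<open>j\<close> is charged more than \<open>B\<close> times. Sums over
  \<open>ennreal\<close> are suprema of finite sums, so the order is exchanged for finite sums
  only.\<close>

lemma infsum_ennreal_le_multiplicity:
  fixes a :: "'j \<Rightarrow> ennreal" and b :: "'i \<Rightarrow> ennreal"
  assumes P: "\<And>i. i \<in> I \<Longrightarrow> P i \<subseteq> J" "\<And>i. i \<in> I \<Longrightarrow> finite (P i)"
    and mult: "\<And>j. j \<in> J \<Longrightarrow> finite {i \<in> I. j \<in> P i} \<and> card {i \<in> I. j \<in> P i} \<le> B"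
    and le: "\<And>i. i \<in> I \<Longrightarrow> b i \<le> c * (\<Sum>j\<in>P i. a j)"
  shows "infsum b I \<le> c * of_nat B * infsum a J"
proof -
  have "sum b F \<le> c * of_nat B * infsum a J" if F: "finite F" "F \<subseteq> I" for F
  proof -
    define U where "U = (\<Union>i\<in>F. P i)"
    have U: "finite U" "U \<subseteq> J" using F P by (auto simp: U_def)
    have inner: "sum a (P i) = (\<Sum>j\<in>U. if j \<in> P i then a j else 0)" if "i \<in> F" for i
    proof -
      have "U \<inter> P i = P i" using that by (auto simp: U_def)
      then show ?thesis using sum.inter_restrict[OF U(1), of a "P i"] by simp
    qed
    have "sum b F \<le> (\<Sum>i\<in>F. c * (\<Sum>j\<in>P i. a j))" using F le by (intro sum_mono) auto
    also have "\<dots> = c * (\<Sum>i\<in>F. sum a (P i))" by (rule sum_distrib_left[symmetric])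
    also have "(\<Sum>i\<in>F. sum a (P i)) = (\<Sum>i\<in>F. \<Sum>j\<in>U. if j \<in> P i then a j else 0)"
      by (rule sum.cong[OF refl inner])
    also have "(\<Sum>i\<in>F. \<Sum>j\<in>U. if j \<in> P i then a j else 0) = (\<Sum>j\<in>U. \<Sum>i\<in>F. if j \<in> P i then a j else 0)"
      by (rule sum.swap)
    also have "\<dots> \<le> (\<Sum>j\<in>U. of_nat B * a j)"
    proof (rule sum_mono)
      fix j assume "j \<in> U"
      then have j: "j \<in> J" using U by blast
      have "(\<Sum>i\<in>F. if j \<in> P i then a j else 0) = (\<Sum>i\<in>{i \<in> F. j \<in> P i}. a j)"
        by (rule sum.inter_filter[OF F(1), symmetric])
      also have "\<dots> = of_nat (card {i \<in> F. j \<in> P i}) * a j" by simp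
      also have "\<dots> \<le> of_nat B * a j"
      proof (intro mult_right_mono of_nat_mono)
        have "card {i \<in> F. j \<in> P i} \<le> card {i \<in> I. j \<in> P i}"
          using mult[OF j] F(2) by (intro card_mono) auto
        then show "card {i \<in> F. j \<in> P i} \<le> B" using mult[OF j] by linarith
      qed simp
      finally show "(\<Sum>i\<in>F. if j \<in> P i then a j else 0) \<le> of_nat B * a j" .
    qed
    also have "\<dots> = of_nat B * sum a U" by (simp add: sum_distrib_left)
    also have "sum a U \<le> infsum a J"
      using U by (subst nonneg_infsum_complete) (auto intro: SUP_upper)
    finally show ?thesis by (simp add: mult_left_mono mult.assoc)
  qed
  then show ?thesis
    by (subst nonneg_infsum_complete) (auto intro: SUP_least)
qed

lemma abs_powr_2: "\<bar>x :: real\<bar> powr 2 = x\<^sup>2"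
  by (cases "x = 0") simp_all

text \<open>The path can be taken with at most \<open>card R\<close>, hence at most the square of
  \<open>card Q\<close>, steps, each of increment at most the root of the sum; squaring gives the
  fourth power. This crude constant suffices because \<open>Q\<close> will be a ball of bounded
  cardinality.\<close>

lemma path_energy:
  fixes F :: "'a \<Rightarrow> real"
  assumes "finite Q" "(\<lambda>u v. adj u v \<and> u \<in> Q \<and> v \<in> Q)\<^sup>*\<^sup>* x y"
  defines "R \<equiv> {(u, v). adj u v \<and> u \<in> Q \<and> v \<in> Q}"
  shows "(F x - F y)\<^sup>2 \<le> real (card Q) ^ 4 * (\<Sum>(p, q)\<in>R. (F p - F q)\<^sup>2)"
proof -
  have RQ: "R \<subseteq> Q \<times> Q" by (auto simp: R_def)
  have fR: "finite R" using RQ assms(1) finite_subset by blast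
  define S where "S = (\<Sum>(p, q)\<in>R. (F p - F q)\<^sup>2)"
  have S0: "S \<ge> 0" unfolding S_def by (intro sum_nonneg) auto
  have each: "\<bar>F p - F q\<bar> \<le> sqrt S" if "(p, q) \<in> R" for p q
  proof -
    have "(F p - F q)\<^sup>2 \<le> S"
      unfolding S_def using member_le_sum[OF that, of "\<lambda>(p, q). (F p - F q)\<^sup>2"] fR by auto
    then show ?thesis by (metis real_sqrt_abs real_sqrt_le_mono)
  qed
  have chain: "\<bar>F x - F z\<bar> \<le> real n * sqrt S" if "(x, z) \<in> R ^^ n" for n z
    using that
  proof (induction n arbitrary: z)
    case (Suc n)
    then obtain v where v: "(x, v) \<in> R ^^ n" "(v, z) \<in> R" by auto
    have "\<bar>F x - F z\<bar> \<le> \<bar>F x - F v\<bar> + \<bar>F v - F z\<bar>" by simp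
    also have "\<dots> \<le> real n * sqrt S + sqrt S" using Suc.IH[OF v(1)] each[OF v(2)] by linarith
    finally show ?case by (simp add: algebra_simps)
  qed simp
  have "(x, y) \<in> R\<^sup>*" using assms(2) unfolding R_def rtranclp_rtrancl_eq .
  then obtain n where n: "n \<le> card R" "(x, y) \<in> R ^^ n"
    using rtrancl_finite_eq_relpow[OF fR] by auto
  have "card R \<le> card Q * card Q" using card_mono[OF _ RQ] assms(1) by (simp add: card_cartesian_product)
  then have "real n \<le> real (card Q) ^ 2"
    using n(1) by (metis of_nat_le_iff of_nat_mult order_trans power2_eq_square)
  then have "\<bar>F x - F y\<bar> \<le> real (card Q) ^ 2 * sqrt S"
    using chain[OF n(2)] S0 by (meson mult_right_mono order_trans real_sqrt_ge_zero)
  then have "\<bar>F x - F y\<bar>\<^sup>2 \<le> (real (card Q) ^ 2 * sqrt S)\<^sup>2" by (intro power_mono) auto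
  then show ?thesis using S0 unfolding S_def by (simp add: power_mult_distrib flip: power_mult)
qed

text \<open>Twice the energy for unit conductances; with conductances comparable to 1 it agrees with
  \<open>energy\<close> up to constants.\<close>

definition dirichlet_sum :: "('a \<Rightarrow> 'a \<Rightarrow> bool) \<Rightarrow> ('a \<Rightarrow> real) \<Rightarrow> ennreal" where
  "dirichlet_sum adj F = infsum (\<lambda>(x, y). ennreal ((F x - F y)\<^sup>2)) {(x, y). adj x y}"

section \<open>The refined tree\<close>

fun base :: "'t rnode \<Rightarrow> 't" where
  "base (Orig v) = v"
| "base (Sub w m k) = w"

text \<open>Sends a representative of a cable point to a vertex of its edge. A common point of two
  cables is thereby turned into a common vertex of the underlying cells.\<close>

fun endpt :: "'a cpt \<Rightarrow> 'a" where
  "endpt (CV x) = x"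
| "endpt (CE x y t) = x"

lemma endpt_cable_seg: "z \<in> cable_seg x y a b \<Longrightarrow> endpt z \<in> {x, y}"
  by (auto simp: cable_seg_def split: if_splits)

locale refined_partition = framed_partition adj K \<pi> \<phi> deg_bound d r e0 \<delta> cg tk a1 a2 Cv \<alpha> Ma
  for adj :: "'a \<Rightarrow> 'a \<Rightarrow> bool" and K :: "'t \<Rightarrow> 'a set" and \<pi> :: "'t \<Rightarrow> 't" and \<phi> :: 't
    and deg_bound :: nat and d :: "'a \<Rightarrow> 'a \<Rightarrow> real" and r e0 \<delta> cg tk a1 a2 Cv \<alpha> :: real
    and Ma :: nat +
  fixes pm :: "'t \<Rightarrow> 'a \<times> 'a"
  assumes pm: "w \<in> Lam_e K \<pi> \<Longrightarrow> K w = {fst (pm w), snd (pm w)}"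
begin

abbreviation Tr :: "'t rnode set" where "Tr \<equiv> T_r K \<pi> r"
abbreviation lev :: "int \<Rightarrow> 't rnode set" where "lev m \<equiv> level_r K \<pi> \<phi> r m"
abbreviation hr :: "'t rnode \<Rightarrow> int" where "hr u \<equiv> height_r \<pi> \<phi> u"
abbreviation pr :: "'t rnode \<Rightarrow> 't rnode" where "pr u \<equiv> pi_r \<pi> r u"
abbreviation J :: "int \<Rightarrow> ('t rnode \<times> 't rnode) set" where "J m \<equiv> Jh K \<pi> \<phi> r pm m"
abbreviation JN :: "nat \<Rightarrow> int \<Rightarrow> ('t rnode \<times> 't rnode) set" where "JN N m \<equiv> JhN K \<pi> \<phi> r pm N m"
abbreviation Gam :: "nat \<Rightarrow> 't rnode \<Rightarrow> 't rnode set" where "Gam n w \<equiv> Gamma K \<pi> \<phi> r pm n w"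

lemma base_Te: "u \<in> Tr \<Longrightarrow> base u \<in> Te"
  using Le_subset_Te by (auto simp: T_r_def)

lemma pr_pow_Orig: "(pi_r \<pi> r ^^ k) (Orig w) = Orig ((\<pi> ^^ k) w)"
  by (induction k) auto

lemma pr_pow_Sub: "m \<ge> 1 \<Longrightarrow> (pi_r \<pi> r ^^ m) (Sub w m k) = Orig w"
proof (induction m arbitrary: k)
  case (Suc m)
  show ?case
  proof (cases "m = 0")
    case False
    then have "\<exists>l. pr (Sub w (Suc m) k) = Sub w m l" by simp
    then obtain l where l: "pr (Sub w (Suc m) k) = Sub w m l" ..
    have "(pi_r \<pi> r ^^ Suc m) (Sub w (Suc m) k) = (pi_r \<pi> r ^^ m) (pr (Sub w (Suc m) k))"
      by (simp only: funpow_Suc_right comp_apply)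
    then show ?thesis using Suc.IH[of l] False unfolding l by simp
  qed simp
qed simp

lemma hr_pr_pow:
  assumes "u \<in> Tr"
  shows "hr ((pi_r \<pi> r ^^ k) u) = hr u - int k"
proof -
  \<comment> \<open>A node \<open>Sub w 0 k\<close> would be sent to \<open>Orig w\<close> without a
    drop in height. Positive depth is preserved by \<open>pi_r\<close> and excludes this.\<close>
  define good where "good u \<longleftrightarrow> (\<forall>w m i. u = Sub w m i \<longrightarrow> m \<ge> 1)" for u :: "'t rnode"
  have step: "good (pr u) \<and> hr (pr u) = hr u - 1" if "good u" for u
    using that by (cases u) (auto simp: good_def h_pi)
  have "good u" using assms by (auto simp: good_def T_r_def)
  then have "good ((pi_r \<pi> r ^^ k) u) \<and> hr ((pi_r \<pi> r ^^ k) u) = hr u - int k"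
  proof (induction k)
    case (Suc k)
    then show ?case using step[of "(pi_r \<pi> r ^^ k) u"] by simp
  qed simp
  then show ?thesis by blast
qed

text \<open>A target level up to \<open>- int H\<close> is not above the level of any edge node, so
  the ancestor of a subdivided edge is reached through its edge node and depends on
  \<open>base u\<close> alone.\<close>

lemma pr_pow:
  assumes "u \<in> Tr" "hr u - int k \<le> - int H"
  shows "(pi_r \<pi> r ^^ k) u = Orig (anc (hr u - int k) (base u))"
proof (cases u)
  case (Orig w)
  then show ?thesis by (simp add: pr_pow_Orig anc_def)
next
  case (Sub w m i)
  then have w: "w \<in> Le" "m \<ge> 1" using assms by (auto simp: T_r_def)
  have le: "m \<le> k" using H[OF w(1)] assms(2) Sub by auto
  then have "(pi_r \<pi> r ^^ k) u = (pi_r \<pi> r ^^ (k - m)) ((pi_r \<pi> r ^^ m) u)"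
    by (metis comp_apply funpow_add le_add_diff_inverse2)
  also have "\<dots> = Orig ((\<pi> ^^ (k - m)) w)" using pr_pow_Sub[OF w(2)] by (simp add: Sub pr_pow_Orig)
  also have "k - m = nat (h w - (hr u - int k))" using le Sub by simp
  finally show ?thesis by (simp add: Sub anc_def)
qed

lemma base_high:
  assumes "u \<in> Tr" "hr u - int k \<le> - int H"
  shows "hr u - int k \<le> h (base u)"
proof (cases u)
  case (Sub w m i)
  then have "w \<in> Le" using assms by (auto simp: T_r_def)
  then show ?thesis using H[of w] assms Sub by auto
qed simp

lemma level_low: "m \<le> - int H \<Longrightarrow> lev m = Orig ` cells m"
  using H by (force simp: level_r_def T_r_def cells_def)

lemma levD: "u \<in> lev m \<Longrightarrow> u \<in> Tr \<and> hr u = m \<and> base u \<in> Te"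
  using base_Te by (auto simp: level_r_def)

lemma endpt_cable: "u \<in> Tr \<Longrightarrow> z \<in> cable K \<pi> r pm u \<Longrightarrow> endpt z \<in> K (base u)"
proof (cases u)
  case (Orig v)
  assume "z \<in> cable K \<pi> r pm u"
  then obtain l where l: "l \<in> Le" "l \<in> subtree \<pi> v" "z \<in> cable_seg (fst (pm l)) (snd (pm l)) 0 1"
    using Orig by auto
  then show ?thesis using endpt_cable_seg[OF l(3)] pm[OF l(1)] K_mono[OF l(2)] Orig by auto
next
  case (Sub w m k)
  assume u: "u \<in> Tr" and z: "z \<in> cable K \<pi> r pm u"
  have w: "w \<in> Le" using u Sub by (auto simp: T_r_def)
  have "z \<in> cable_seg (fst (pm w)) (snd (pm w)) (real k / 2 ^ nr r m) (real (k + 1) / 2 ^ nr r m)"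
    using z unfolding Sub by (simp only: cable.simps)
  then show ?thesis using endpt_cable_seg pm[OF w] Sub by fastforce
qed

lemma vertex_cable: "v \<in> Te \<Longrightarrow> x \<in> K v \<Longrightarrow> CV x \<in> cable K \<pi> r pm (Orig v)"
proof -
  assume "v \<in> Te" "x \<in> K v"
  then obtain l where l: "l \<in> Le" "l \<in> subtree \<pi> v" "x \<in> K l" using Le_below by blast
  then have "CV x \<in> cable_seg (fst (pm l)) (snd (pm l)) 0 1" using pm[OF l(1)] by (auto simp: cable_seg_def)
  then show ?thesis using l by auto
qed

lemma JD:
  assumes "(u, v) \<in> J m"
  shows "u \<in> lev m" "v \<in> lev m" "K (base u) \<inter> K (base v) \<noteq> {}"
proof -
  show uv: "u \<in> lev m" "v \<in> lev m" using assms by (auto simp: Jh_def)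
  obtain z where "z \<in> cable K \<pi> r pm u" "z \<in> cable K \<pi> r pm v" using assms by (auto simp: Jh_def)
  then show "K (base u) \<inter> K (base v) \<noteq> {}"
    using endpt_cable levD[OF uv(1)] levD[OF uv(2)] by blast
qed

lemma JJ_pow_J:
  assumes "m \<le> - int H" "(u, v) \<in> JJ m ^^ j"
  shows "(Orig u, Orig v) \<in> J m ^^ j"
  using assms(2)
proof (induction j arbitrary: v)
  case (Suc j)
  then obtain v' where v': "(u, v') \<in> JJ m ^^ j" "(v', v) \<in> JJ m" by auto
  then obtain x where x: "x \<in> K v'" "x \<in> K v" "v' \<in> cells m" "v \<in> cells m" "v' \<noteq> v" by (auto simp: JJ_def)
  have "(Orig v', Orig v) \<in> J m"
    using vertex_cable[of v' x] vertex_cable[of v x] x level_low[OF assms(1)]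
    unfolding Jh_def by (auto simp: cells_def)
  then show ?case using Suc.IH[OF v'(1)] by auto
qed simp

text \<open>The second entry of the maximum is for subdivided edges, whose base cell is a whole edge
  however fine the level is.\<close>

lemma lev_diam:
  assumes "u \<in> lev m" "x \<in> K (base u)" "y \<in> K (base u)"
  shows "d x y \<le> max (sc m / cg) (1 / e0)"
proof (cases u)
  case (Orig v)
  then show ?thesis using d_le_sc[of v x y] assms levD[OF assms(1)] by auto
next
  case (Sub w i k)
  then have w: "w \<in> Le" using levD[OF assms(1)] by (auto simp: T_r_def)
  obtain a b where "K w = {a, b}" "adj a b" using Le_edge w by blast
  then have "g w \<le> 1 / e0" by (rule g_edge_le)
  then show ?thesis using d_le_g[of x w y] assms Sub by auto
qed

lemma low_diam:
  assumes "m \<le> - int H" "u \<in> lev m" "x \<in> K (base u)" "y \<in> K (base u)"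
  shows "d x y \<le> sc m / cg"
  using assms level_low[OF assms(1)] d_le_sc[of "base u" x y] by (auto simp: cells_def)

lemma J_dist:
  assumes diam: "\<And>u x y. u \<in> lev m \<Longrightarrow> x \<in> K (base u) \<Longrightarrow> y \<in> K (base u) \<Longrightarrow> d x y \<le> \<Delta>"
    and u: "u \<in> lev m" "p \<in> K (base u)"
  shows "(u, v) \<in> J m ^^ j \<Longrightarrow> q \<in> K (base v) \<Longrightarrow> d p q \<le> real (j + 1) * \<Delta>"
proof (induction j arbitrary: v q)
  case 0
  then show ?case using diam[OF u] by auto
next
  case (Suc j)
  then obtain v' where v': "(u, v') \<in> J m ^^ j" "(v', v) \<in> J m" by auto
  obtain z where z: "z \<in> K (base v')" "z \<in> K (base v)" using JD(3)[OF v'(2)] by blast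
  have "d p q \<le> d p z + d z q" by (rule d_tri)
  also have "\<dots> \<le> real (j + 1) * \<Delta> + \<Delta>"
    using Suc.IH[OF v'(1) z(1)] diam[OF JD(2)[OF v'(2)] z(2) Suc.prems(2)] by linarith
  finally show ?case by (simp add: algebra_simps)
qed

lemma node_count:
  "\<exists>C::nat. \<forall>A. finite A \<longrightarrow> finite {u \<in> lev m. K (base u) \<subseteq> A} \<and>
     card {u \<in> lev m. K (base u) \<subseteq> A} \<le> C * card A"
proof -
  define B where "B = (\<Sum>j\<le>nat (m + int H). (2::nat) ^ nr r j)"
  \<comment> \<open>Encodes every node of level \<open>m\<close> by an edge node \<open>l\<close>
    and a bounded index: 0 stands for the ancestor of \<open>l\<close> at that level,
    \<open>k + 1\<close> for the subinterval \<open>k\<close>, whose depth is forced by the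
    level.\<close>
  define f where "f = (\<lambda>(l, i). if i = 0 then Orig (anc m l) else Sub l (nat (m - h l)) (i - 1 :: nat))"
  have "finite {u \<in> lev m. K (base u) \<subseteq> A} \<and>
     card {u \<in> lev m. K (base u) \<subseteq> A} \<le> deg_bound * Suc B * card A" if A: "finite A" for A
  proof -
    have sub: "{u \<in> lev m. K (base u) \<subseteq> A} \<subseteq> f ` (Le_in A \<times> {..B})"
    proof (intro subsetI, elim CollectE conjE)
      fix u assume u: "u \<in> lev m" "K (base u) \<subseteq> A"
      show "u \<in> f ` (Le_in A \<times> {..B})"
      proof (cases u)
        case (Orig v)
        then have v: "v \<in> Te" "h v = m" using levD[OF u(1)] by auto
        then obtain l where l: "l \<in> Le" "l \<in> subtree \<pi> v" using Te_cell_has_Le by blast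
        then have "l \<in> Le_in A" using K_mono[OF l(2)] u(2) Orig by (auto simp: Le_in_def)
        moreover have "f (l, 0) = u" using anc_eq[OF l(2)] v Orig by (simp add: f_def)
        ultimately show ?thesis by force
      next
        case (Sub w i k)
        then have w: "w \<in> Le" "i \<ge> 1" "k < 2 ^ nr r i" "h w + int i = m"
          using levD[OF u(1)] by (auto simp: T_r_def)
        have "i \<le> nat (m + int H)" using w(4) H[OF w(1)] by linarith
        then have "2 ^ nr r i \<le> B" unfolding B_def by (intro member_le_sum) auto
        then have "Suc k \<le> B" using w(3) by linarith
        moreover have "f (w, Suc k) = u" using w(4) Sub by (auto simp: f_def)
        moreover have "w \<in> Le_in A" using w(1) u(2) Sub by (auto simp: Le_in_def)
        ultimately show ?thesis by force
      qed
    qed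
    have fin: "finite (Le_in A \<times> {..B})" using card_Le_in(1)[OF A] by simp
    have "card {u \<in> lev m. K (base u) \<subseteq> A} \<le> card (Le_in A \<times> {..B})" by (rule surj_card_le[OF fin sub])
    also have "\<dots> = card (Le_in A) * Suc B" by (simp add: card_cartesian_product)
    also have "\<dots> \<le> (deg_bound * card A) * Suc B" using card_Le_in(2)[OF A] by (intro mult_right_mono) auto
    finally show ?thesis using finite_subset[OF sub] fin by (simp add: algebra_simps)
  qed
  then show ?thesis by blast
qed

definition pt :: "'t \<Rightarrow> 'a" where "pt v = (SOME x. x \<in> K v)"

lemma pt: "v \<in> Te \<Longrightarrow> pt v \<in> K v"
  unfolding pt_def using cell_nonempty[of v] by (metis ex_in_conv someI_ex)

lemma nodes_near:
  "\<exists>B::nat. \<forall>x. finite {u \<in> lev m. pt (base u) \<in> ball x s} \<and> card {u \<in> lev m. pt (base u) \<in> ball x s} \<le> B"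
proof -
  obtain C where C: "\<And>A. finite A \<Longrightarrow> finite {u \<in> lev m. K (base u) \<subseteq> A} \<and>
     card {u \<in> lev m. K (base u) \<subseteq> A} \<le> C * card A" using node_count by blast
  define \<Delta> where "\<Delta> = max (sc m / cg) (1 / e0)"
  obtain B where B: "\<And>x. card (ball x (s + \<Delta>)) \<le> B" using ball_uniform by blast
  have "finite {u \<in> lev m. pt (base u) \<in> ball x s} \<and> card {u \<in> lev m. pt (base u) \<in> ball x s} \<le> C * B" for x
  proof -
    have sub: "{u \<in> lev m. pt (base u) \<in> ball x s} \<subseteq> {u \<in> lev m. K (base u) \<subseteq> ball x (s + \<Delta>)}"
    proof (intro subsetI, elim CollectE conjE)
      fix u assume u: "u \<in> lev m" "pt (base u) \<in> ball x s"
      have "z \<in> ball x (s + \<Delta>)" if z: "z \<in> K (base u)" for z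
      proof -
        have "d (pt (base u)) z \<le> \<Delta>" unfolding \<Delta>_def using lev_diam[OF u(1)] pt levD[OF u(1)] z by blast
        moreover have "d x z \<le> d x (pt (base u)) + d (pt (base u)) z" by (rule d_tri)
        ultimately show ?thesis using u(2) by (simp add: dball_def)
      qed
      then show "u \<in> {u \<in> lev m. K (base u) \<subseteq> ball x (s + \<Delta>)}" using u by blast
    qed
    have fin: "finite {u \<in> lev m. K (base u) \<subseteq> ball x (s + \<Delta>)}"
      and le: "card {u \<in> lev m. K (base u) \<subseteq> ball x (s + \<Delta>)} \<le> C * card (ball x (s + \<Delta>))"
      using C[OF finite_ball] by blast+
    have "card {u \<in> lev m. pt (base u) \<in> ball x s} \<le> C * card (ball x (s + \<Delta>))"
      using card_mono[OF fin sub] le by linarith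
    also have "\<dots> \<le> C * B" using B by simp
    finally show ?thesis using finite_subset[OF sub fin] by blast
  qed
  then show ?thesis by blast
qed

subsection \<open>Comparison of Dirichlet sums\<close>

abbreviation Dsum :: "('a \<Rightarrow> real) \<Rightarrow> ennreal" where "Dsum F \<equiv> dirichlet_sum adj F"

definition Jsum :: "nat \<Rightarrow> int \<Rightarrow> ('t rnode \<Rightarrow> real) \<Rightarrow> ennreal" where
  "Jsum N m f = infsum (\<lambda>(u, v). ennreal (\<bar>f u - f v\<bar> powr 2)) (JN N m)"

lemma J_connected:
  assumes u: "u \<in> lev m" "p \<in> K (base u)"
    and \<Delta>: "\<Delta> = max (sc m / cg) (1 / e0)" "real (N + 1) * \<Delta> < \<rho>"
  defines "Q \<equiv> ball p \<rho>"
  shows "(u, v) \<in> J m ^^ j \<Longrightarrow> j \<le> N \<Longrightarrow> q \<in> K (base v) \<Longrightarrow>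
    (\<lambda>x y. adj x y \<and> x \<in> Q \<and> y \<in> Q)\<^sup>*\<^sup>* p q"
proof (induction j arbitrary: v q)
  case 0
  have \<Delta>0: "\<Delta> > 0" using \<Delta>(1) e0 by (simp add: less_max_iff_disj)
  have KQ: "K (base v) \<subseteq> Q" if "v \<in> lev m" "(u, v) \<in> J m ^^ j" "j \<le> N" for v j
  proof
    fix z assume "z \<in> K (base v)"
    then have "d p z \<le> real (j + 1) * \<Delta>"
      using J_dist[OF _ u that(2)] lev_diam \<Delta>(1) by blast
    also have "\<dots> \<le> real (N + 1) * \<Delta>" using that(3) \<Delta>0 by (intro mult_right_mono) auto
    finally show "z \<in> Q" using \<Delta>(2) by (simp add: Q_def dball_def)
  qed
  have "v = u" using 0 by simp
  then have "(\<lambda>x y. adj x y \<and> x \<in> K (base u) \<and> y \<in> K (base u))\<^sup>*\<^sup>* p q"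
    using conn_cells levD[OF u(1)] u 0 unfolding connected_partition_def by blast
  then show ?case
    by (rule rtranclp_mono[THEN predicate2D, rotated]) (use KQ[OF u(1), of 0] in auto)
next
  case (Suc j)
  have \<Delta>0: "\<Delta> > 0" using \<Delta>(1) e0 by (simp add: less_max_iff_disj)
  obtain v' where v': "(u, v') \<in> J m ^^ j" "(v', v) \<in> J m" using Suc.prems(1) by auto
  obtain z where z: "z \<in> K (base v')" "z \<in> K (base v)" using JD(3)[OF v'(2)] by blast
  have v: "v \<in> lev m" by (rule JD(2)[OF v'(2)])
  have KQ: "K (base v) \<subseteq> Q"
  proof
    fix z assume "z \<in> K (base v)"
    then have "d p z \<le> real (Suc j + 1) * \<Delta>"
      using J_dist[OF _ u Suc.prems(1)] lev_diam \<Delta>(1) by blast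
    also have "\<dots> \<le> real (N + 1) * \<Delta>" using Suc.prems(2) \<Delta>0 by (intro mult_right_mono) auto
    finally show "z \<in> Q" using \<Delta>(2) by (simp add: Q_def dball_def)
  qed
  have "(\<lambda>x y. adj x y \<and> x \<in> K (base v) \<and> y \<in> K (base v))\<^sup>*\<^sup>* z q"
    using conn_cells levD[OF v] z Suc.prems(3) unfolding connected_partition_def by blast
  then have "(\<lambda>x y. adj x y \<and> x \<in> Q \<and> y \<in> Q)\<^sup>*\<^sup>* z q"
    by (rule rtranclp_mono[THEN predicate2D, rotated]) (use KQ in auto)
  moreover have "(\<lambda>x y. adj x y \<and> x \<in> Q \<and> y \<in> Q)\<^sup>*\<^sup>* p z"
    using Suc.IH[OF v'(1) _ z(1)] Suc.prems(2) by simp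
  ultimately show ?case by (meson rtranclp_trans)
qed

text \<open>Nodes within \<open>N\<close> horizontal steps are joined by a path in a ball of fixed
  radius \<open>\<rho>\<close> around the first one, so their difference is charged to the edges in
  that ball. An edge is charged by few pairs: the first node is within \<open>\<rho>\<close> and the
  second within \<open>2 * \<rho>\<close> of it. The constant depends on the level \<open>m\<close>,
  which stays fixed.\<close>

lemma Jsum_le_Dsum: "\<exists>C\<ge>0. \<forall>F. Jsum N m (\<lambda>u. F (pt (base u))) \<le> ennreal C * Dsum F"
proof -
  define \<Delta> where "\<Delta> = max (sc m / cg) (1 / e0)"
  define \<rho> where "\<rho> = real (N + 1) * \<Delta> + 1"
  have \<rho>: "real (N + 1) * \<Delta> < \<rho>" by (simp add: \<rho>_def)
  obtain B where B: "\<And>x. card (ball x \<rho>) \<le> B" using ball_uniform by blast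
  obtain B1 where B1: "\<And>x. finite {u \<in> lev m. pt (base u) \<in> ball x \<rho>} \<and>
    card {u \<in> lev m. pt (base u) \<in> ball x \<rho>} \<le> B1" using nodes_near by blast
  obtain B2 where B2: "\<And>x. finite {u \<in> lev m. pt (base u) \<in> ball x (2 * \<rho>)} \<and>
    card {u \<in> lev m. pt (base u) \<in> ball x (2 * \<rho>)} \<le> B2" using nodes_near by blast
  define P where "P = (\<lambda>(u, v :: 't rnode).
    {(p, q). adj p q \<and> p \<in> ball (pt (base u)) \<rho> \<and> q \<in> ball (pt (base u)) \<rho>})"
  have bound: "Jsum N m (\<lambda>u. F (pt (base u))) \<le> ennreal (real B ^ 4) * of_nat (B1 * B2) * Dsum F" for F
    unfolding Jsum_def dirichlet_sum_def
  proof (rule infsum_ennreal_le_multiplicity[where P = P])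
    fix i assume i: "i \<in> JN N m"
    obtain u v where uv: "i = (u, v)" by (cases i)
    then obtain j where j: "u \<in> lev m" "v \<in> lev m" "j \<le> N" "(u, v) \<in> J m ^^ j"
      using i by (auto simp: JhN_def)
    show "P i \<subseteq> {(x, y). adj x y}" by (auto simp: P_def uv)
    have "P i \<subseteq> ball (pt (base u)) \<rho> \<times> ball (pt (base u)) \<rho>" by (auto simp: P_def uv)
    then show fP: "finite (P i)" using finite_ball finite_subset finite_cartesian_product by metis
    have pu: "pt (base u) \<in> K (base u)" "pt (base v) \<in> K (base v)"
      using pt levD[OF j(1)] levD[OF j(2)] by blast+
    have "(\<lambda>x y. adj x y \<and> x \<in> ball (pt (base u)) \<rho> \<and> y \<in> ball (pt (base u)) \<rho>)\<^sup>*\<^sup>* (pt (base u)) (pt (base v))"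
      by (rule J_connected[OF j(1) pu(1) \<Delta>_def \<rho> j(4,3) pu(2)])
    from path_energy[OF finite_ball this, of F]
    have "(F (pt (base u)) - F (pt (base v)))\<^sup>2
        \<le> real (card (ball (pt (base u)) \<rho>)) ^ 4 * (\<Sum>(p, q)\<in>P i. (F p - F q)\<^sup>2)"
      by (simp add: P_def uv)
    also have "\<dots> \<le> real B ^ 4 * (\<Sum>(p, q)\<in>P i. (F p - F q)\<^sup>2)"
      using B by (intro mult_right_mono power_mono sum_nonneg) auto
    finally have "ennreal ((F (pt (base u)) - F (pt (base v)))\<^sup>2)
        \<le> ennreal (real B ^ 4 * (\<Sum>(p, q)\<in>P i. (F p - F q)\<^sup>2))" by (rule ennreal_leI)
    also have "\<dots> = ennreal (real B ^ 4) * (\<Sum>j\<in>P i. ennreal ((F (fst j) - F (snd j))\<^sup>2))"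
      by (subst ennreal_mult) (auto intro!: sum_nonneg simp: case_prod_beta sum_ennreal)
    finally show "(case i of (u, v) \<Rightarrow> ennreal (\<bar>F (pt (base u)) - F (pt (base v))\<bar> powr 2))
        \<le> ennreal (real B ^ 4) * (\<Sum>j\<in>P i. case j of (x, y) \<Rightarrow> ennreal ((F x - F y)\<^sup>2))"
      by (simp only: uv case_prod_conv abs_powr_2) (simp add: case_prod_beta)
  next
    fix e :: "'a \<times> 'a"
    obtain p q where e: "e = (p, q)" by (cases e)
    have sub: "{i \<in> JN N m. e \<in> P i} \<subseteq>
      {u \<in> lev m. pt (base u) \<in> ball p \<rho>} \<times> {u \<in> lev m. pt (base u) \<in> ball p (2 * \<rho>)}"
    proof (intro subsetI, elim CollectE conjE)
      fix i assume i: "i \<in> JN N m" "e \<in> P i"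
      obtain u v where uv: "i = (u, v)" by (cases i)
      then obtain j where j: "u \<in> lev m" "v \<in> lev m" "j \<le> N" "(u, v) \<in> J m ^^ j"
        using i by (auto simp: JhN_def)
      have pu: "pt (base u) \<in> K (base u)" "pt (base v) \<in> K (base v)"
        using pt levD[OF j(1)] levD[OF j(2)] by blast+
      have \<Delta>0: "\<Delta> > 0" using e0 by (simp add: \<Delta>_def less_max_iff_disj)
      have "d (pt (base u)) (pt (base v)) \<le> real (j + 1) * \<Delta>"
        using J_dist[OF _ j(1) pu(1) j(4) pu(2)] lev_diam unfolding \<Delta>_def by blast
      also have "\<dots> \<le> real (N + 1) * \<Delta>" using j(3) \<Delta>0 by (intro mult_right_mono) auto
      finally have "d (pt (base u)) (pt (base v)) < \<rho>" using \<rho> by simp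
      moreover have "d p (pt (base u)) < \<rho>" using i(2) d_sym by (auto simp: P_def uv e dball_def)
      moreover have "d p (pt (base v)) \<le> d p (pt (base u)) + d (pt (base u)) (pt (base v))" by (rule d_tri)
      ultimately show "i \<in> {u \<in> lev m. pt (base u) \<in> ball p \<rho>} \<times> {u \<in> lev m. pt (base u) \<in> ball p (2 * \<rho>)}"
        using j by (auto simp: uv dball_def)
    qed
    have fin: "finite ({u \<in> lev m. pt (base u) \<in> ball p \<rho>} \<times> {u \<in> lev m. pt (base u) \<in> ball p (2 * \<rho>)})"
      using B1[of p] B2[of p] by blast
    have "card {i \<in> JN N m. e \<in> P i} \<le> B1 * B2"
      using card_mono[OF fin sub] B1[of p] B2[of p] unfolding card_cartesian_product
      by (meson mult_le_mono order_trans)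
    then show "finite {i \<in> JN N m. e \<in> P i} \<and> card {i \<in> JN N m. e \<in> P i} \<le> B1 * B2"
      using finite_subset[OF sub fin] by blast
  qed
  have "ennreal (real B ^ 4) * of_nat (B1 * B2) = ennreal (real B ^ 4 * real (B1 * B2))"
    by (subst ennreal_mult) (auto simp: ennreal_of_nat_eq_real_of_nat)
  with bound show ?thesis by (intro exI[of _ "real B ^ 4 * real (B1 * B2)"]) simp
qed

definition cellof :: "int \<Rightarrow> 'a \<Rightarrow> 't" where
  "cellof m x = (SOME v. v \<in> cells m \<and> x \<in> K v)"

lemma cellof: "m \<le> - int H \<Longrightarrow> cellof m x \<in> cells m \<and> x \<in> K (cellof m x)"
  unfolding cellof_def using vertex_in_cell[of m x] by (metis (mono_tags, lifting) someI_ex)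

lemma card_cell_bounded: "\<exists>B::nat. \<forall>v\<in>cells m. card (K v) \<le> B"
proof -
  obtain B where B: "\<And>x. card (ball x (sc m / cg + 1)) \<le> B" using ball_uniform by blast
  have "card (K v) \<le> B" if v: "v \<in> cells m" for v
  proof -
    have vT: "v \<in> Te" "h v = m" using v by (auto simp: cells_def)
    have "K v \<subseteq> ball (pt v) (sc m / cg + 1)"
    proof
      fix z assume "z \<in> K v"
      then have "d (pt v) z \<le> sc m / cg" using d_le_sc[OF vT(1) pt[OF vT(1)]] vT(2) by blast
      then show "z \<in> ball (pt v) (sc m / cg + 1)" by (simp add: dball_def)
    qed
    then show ?thesis using B[of "pt v"] card_mono[OF finite_ball] by (meson order_trans)
  qed
  then show ?thesis by blast
qed

text \<open>The ends of an edge may have different chosen cells, but both meet the cell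
  \<open>ec x y\<close> containing the edge, so two horizontal steps suffice. A pair of nodes is
  charged only by edges with both ends in the union of their cells. The bound on \<open>m\<close>
  guarantees that \<open>ec x y\<close> exists.\<close>

lemma Dsum_le_Jsum:
  assumes m: "m \<le> - int H" and N: "N \<ge> 1"
  shows "\<exists>C\<ge>0. \<forall>f. Dsum (\<lambda>x. f (Orig (cellof m x))) \<le> ennreal C * Jsum N m f"
proof -
  obtain B where B: "\<And>v. v \<in> cells m \<Longrightarrow> card (K v) \<le> B" using card_cell_bounded by blast
  define ec where "ec x y = (SOME v. v \<in> cells m \<and> x \<in> K v \<and> y \<in> K v)" for x y
  have ec: "ec x y \<in> cells m \<and> x \<in> K (ec x y) \<and> y \<in> K (ec x y)" if "adj x y" for x y
  proof -
    have "\<exists>v. v \<in> cells m \<and> x \<in> K v \<and> y \<in> K v" using edge_in_cell[OF that m] by blast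
    from someI_ex[OF this] show ?thesis unfolding ec_def .
  qed
  \<comment> \<open>Removing the diagonal discards a step between equal cells, which is not a pair
    in \<open>JN\<close> and contributes nothing.\<close>
  define P where "P = (\<lambda>(x, y). {(Orig (cellof m x), Orig (ec x y)), (Orig (ec x y), Orig (cellof m y))} - Id)"
  have inJ: "(Orig u, Orig v) \<in> JN N m" if "u \<in> cells m" "v \<in> cells m" "z \<in> K u" "z \<in> K v" "u \<noteq> v" for u v z
  proof -
    have "(u, v) \<in> JJ m ^^ 1" using that by (auto simp: JJ_def)
    then have "(Orig u, Orig v) \<in> J m ^^ 1" by (rule JJ_pow_J[OF m])
    then show ?thesis using that N level_low[OF m] unfolding JhN_def by blast
  qed
  have bound: "Dsum (\<lambda>x. f (Orig (cellof m x))) \<le> 2 * of_nat (2 * B * (2 * B)) * Jsum N m f" for f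
    unfolding Jsum_def dirichlet_sum_def
  proof (rule infsum_ennreal_le_multiplicity[where P = P])
    fix i :: "'a \<times> 'a" assume i: "i \<in> {(x, y). adj x y}"
    obtain x y where xy: "i = (x, y)" by (cases i)
    have a: "adj x y" using i xy by simp
    note E = ec[OF a] and cx = cellof[OF m, of x] and cy = cellof[OF m, of y]
    show "P i \<subseteq> JN N m" using inJ[of "cellof m x" "ec x y" x] inJ[of "ec x y" "cellof m y" y] E cx cy
      by (auto simp: P_def xy)
    show "finite (P i)" by (simp add: P_def xy)
    define a b c where "a = f (Orig (cellof m x))" and "b = f (Orig (ec x y))" and "c = f (Orig (cellof m y))"
    have "(a - c)\<^sup>2 \<le> 2 * ((a - b)\<^sup>2 + (b - c)\<^sup>2)"
      using sum_squares_bound[of "a - b" "b - c"] by (simp add: power2_eq_square algebra_simps)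
    then have "ennreal ((a - c)\<^sup>2) \<le> ennreal (2 * ((a - b)\<^sup>2 + (b - c)\<^sup>2))" by (rule ennreal_leI)
    also have "\<dots> = 2 * (ennreal ((a - b)\<^sup>2) + ennreal ((b - c)\<^sup>2))"
      by (simp add: ennreal_mult ennreal_plus)
    also have "ennreal ((a - b)\<^sup>2) + ennreal ((b - c)\<^sup>2) =
        (\<Sum>j\<in>P i. case j of (u, v) \<Rightarrow> ennreal (\<bar>f u - f v\<bar> powr 2))"
    proof -
      consider "cellof m x = ec x y" "cellof m y = ec x y" | "cellof m x = ec x y" "cellof m y \<noteq> ec x y"
        | "cellof m x \<noteq> ec x y" "cellof m y = ec x y" | "cellof m x \<noteq> ec x y" "cellof m y \<noteq> ec x y" by blast
      then show ?thesis
      proof cases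
        case 1
        then show ?thesis by (simp add: P_def xy a_def b_def c_def)
      next
        case 2
        then have "P i = {(Orig (ec x y), Orig (cellof m y))}" by (auto simp: P_def xy)
        then show ?thesis using 2 by (simp add: a_def b_def c_def abs_powr_2)
      next
        case 3
        then have "P i = {(Orig (cellof m x), Orig (ec x y))}" by (auto simp: P_def xy)
        then show ?thesis using 3 by (simp add: a_def b_def c_def abs_powr_2)
      next
        case 4
        then have "P i = {(Orig (cellof m x), Orig (ec x y)), (Orig (ec x y), Orig (cellof m y))}"
          by (auto simp: P_def xy)
        then show ?thesis using 4 by (simp add: a_def b_def c_def abs_powr_2)
      qed
    qed
    finally show "(case i of (x, y) \<Rightarrow> ennreal ((f (Orig (cellof m x)) - f (Orig (cellof m y)))\<^sup>2))
        \<le> 2 * (\<Sum>j\<in>P i. case j of (u, v) \<Rightarrow> ennreal (\<bar>f u - f v\<bar> powr 2))"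
      by (simp add: xy a_def c_def)
  next
    fix j assume j: "j \<in> JN N m"
    obtain u v where uv: "j = (u, v)" by (cases j)
    have "u \<in> lev m" "v \<in> lev m" using j uv by (auto simp: JhN_def)
    then have bs: "base u \<in> cells m" "base v \<in> cells m" using level_low[OF m] by auto
    define S where "S = K (base u) \<union> K (base v)"
    have cS: "card S \<le> 2 * B"
      unfolding S_def using card_Un_le[of "K (base u)" "K (base v)"] B[OF bs(1)] B[OF bs(2)] by linarith
    have fS: "finite (S \<times> S)" using finite_K by (simp add: S_def)
    have sub: "{i \<in> {(x, y). adj x y}. j \<in> P i} \<subseteq> S \<times> S"
      using ec by (auto simp: P_def uv S_def)
    have "card {i \<in> {(x, y). adj x y}. j \<in> P i} \<le> card S * card S"
      using card_mono[OF fS sub] by (simp add: card_cartesian_product)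
    also have "\<dots> \<le> 2 * B * (2 * B)" using cS by (intro mult_le_mono) auto
    finally show "finite {i \<in> {(x, y). adj x y}. j \<in> P i} \<and> card {i \<in> {(x, y). adj x y}. j \<in> P i} \<le> 2 * B * (2 * B)"
      using finite_subset[OF sub fS] by blast
  qed
  have "2 * of_nat (2 * B * (2 * B)) = ennreal (2 * real (2 * B * (2 * B)))"
    by (subst ennreal_mult) (auto simp: ennreal_of_nat_eq_real_of_nat)
  with bound show ?thesis by (intro exI[of _ "2 * real (2 * B * (2 * B))"]) simp
qed

end

section \<open>Capacities and volumes along the tree\<close>

lemma ennreal_half_le: "(x::ennreal) / 2 \<le> x"
proof (cases x)
  case (real t)
  then have "x / 2 = ennreal (t / 2)" using divide_ennreal[of t 2] by simp
  then show ?thesis using real by (auto intro: ennreal_leI)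
qed simp

lemma ennreal_le_half:
  assumes "ennreal a \<le> ennreal C * x" "C > 0" "a \<ge> 0"
  shows "ennreal (a / (2 * C)) \<le> x / 2"
proof (cases x)
  case (real t)
  then have "a \<le> C * t" using assms by (simp add: ennreal_mult[symmetric] ennreal_le_iff)
  moreover have "x / 2 = ennreal (t / 2)" using divide_ennreal[of t 2] real by simp
  ultimately show ?thesis using assms(2) by (simp add: field_simps ennreal_leI)
qed (simp add: ennreal_top_divide)

text \<open>The resistance bounds in terms of test functions: a lower bound on the resistance yields
  a cutoff function of small energy (\<open>cap_le\<close>), an upper bound forces every competitor
  to have large energy (\<open>cap_ge\<close>). Radii start at \<open>s0\<close> to stay above all
  \<open>rx\<close>.\<close>

locale resistance_partition =
  refined_partition adj K \<pi> \<phi> deg_bound d r e0 \<delta> cg tk a1 a2 Cv \<alpha> Ma pm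
  for adj :: "'a \<Rightarrow> 'a \<Rightarrow> bool" and K :: "'t \<Rightarrow> 'a set" and \<pi> :: "'t \<Rightarrow> 't" and \<phi> :: 't
    and deg_bound :: nat and d :: "'a \<Rightarrow> 'a \<Rightarrow> real" and r e0 \<delta> cg tk a1 a2 Cv \<alpha> :: real
    and Ma :: nat and pm :: "'t \<Rightarrow> 'a \<times> 'a" +
  fixes \<beta> lam CL CU s0 :: real
  assumes lam: "lam > 0"
    and CL: "CL > 0"
    and CU: "CU > 0"
    and cap_le: "s \<ge> s0 \<Longrightarrow> \<exists>F. (\<forall>y\<in>dball d x (lam * s). F y = 1) \<and> (\<forall>y. y \<notin> dball d x s \<longrightarrow> F y = 0) \<and>
      dirichlet_sum adj F \<le> ennreal (CL * real (card (dball d x s)) / s powr \<beta>)"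
    and cap_ge: "s \<ge> s0 \<Longrightarrow> F x = 1 \<Longrightarrow> (\<And>y. y \<notin> dball d x s \<Longrightarrow> F y = 0) \<Longrightarrow>
      ennreal (CU * real (card (dball d x s)) / s powr \<beta>) \<le> dirichlet_sum adj F"
begin

text \<open>The energy of \<open>Ep\<close> kept in \<open>ennreal\<close>, since
  \<open>enn2real\<close> would turn an infinite value into 0.\<close>

definition cap :: "nat \<Rightarrow> 't rnode \<Rightarrow> nat \<Rightarrow> nat \<Rightarrow> nat \<Rightarrow> ennreal" where
  "cap k v N1 N2 N = (INF f \<in> {f.
      (\<forall>x\<in>lev (hr v + int k). x \<in> Sk K \<pi> r k (Gam N1 v) \<longrightarrow> f x = 1) \<and>
      (\<forall>x\<in>lev (hr v + int k). x \<notin> Sk K \<pi> r k (Gam N2 v) \<longrightarrow> f x = 0)}.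
    Jsum N (hr v + int k) f / 2)"

lemma Ep_eq: "Ep K \<pi> \<phi> r pm 2 k v N1 N2 N = enn2real (cap k v N1 N2 N)"
  by (simp add: Ep_def Let_def cap_def Jsum_def)

abbreviation vol :: "'a \<Rightarrow> nat \<Rightarrow> real" where
  "vol x k \<equiv> real (card (ball x (sc (- int k))))"

lemma sc_neg_ge1: "sc (- int k) \<ge> 1"
  using sc_antimono[of "- int k" 0] r by (simp add: sc_def)

lemma sc_diff: "sc (m - int k) = sc m * sc (- int k)"
  using sc_add[of m "- int k"] by simp

lemma sc_neg_powr: "sc (- int k) powr \<beta> = 1 / (r powr \<beta>) ^ k"
proof -
  have "sc (- int k) powr \<beta> = r powr (- (real k * \<beta>))" by (simp add: sc_def powr_powr)
  also have "\<dots> = 1 / (r powr \<beta>) ^ k" using r by (simp add: powr_minus_divide powr_power)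
  finally show ?thesis .
qed

text \<open>The scales \<open>sc (- int k)\<close> are at least 1 and absorb the fixed distance
  \<open>d x y\<close>, so changing centre and radius costs a constant that does not depend on
  \<open>k\<close>.\<close>

lemma vol_compare:
  assumes "A > 0" "B > 0"
  shows "\<exists>C>0. \<forall>k::nat. real (card (ball x (A * sc (- int k)))) \<le> C * real (card (ball y (B * sc (- int k))))"
proof -
  define q where "q = (A + d x y) / B"
  have q: "q > 0" using assms d_nonneg[of x y] by (simp add: q_def add_pos_nonneg)
  have "real (card (ball x (A * sc (- int k)))) \<le> dbl q * real (card (ball y (B * sc (- int k))))" for k
  proof (rule ball_compare[OF _ _ q])
    show "B * sc (- int k) > 0" using assms by simp
    have "d x y \<le> d x y * sc (- int k)"
      using mult_left_mono[OF sc_neg_ge1 d_nonneg[of x y], of k] by simp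
    then show "A * sc (- int k) + d x y \<le> q * (B * sc (- int k))"
      using assms by (simp add: q_def field_simps)
  qed
  then show ?thesis using dbl_ge1[of q] by (intro exI[of _ "dbl q"]) (auto intro: less_le_trans[OF zero_less_one])
qed

lemma Gam_near:
  assumes "v \<in> cells m" "m \<le> - int H" "Orig v' \<in> Gam n (Orig v)" "x \<in> K v" "y \<in> K v'"
  shows "d x y \<le> real (n + 1) * (sc m / cg)"
proof -
  have hv: "h v = m" using assms(1) by (simp add: cells_def)
  obtain j where j: "j \<le> n" "(Orig v, Orig v') \<in> J m ^^ j"
    using assms(3) hv by (auto simp: Gamma_def)
  have v: "Orig v \<in> lev m" using level_low[OF assms(2)] assms(1) by blast
  have "d x y \<le> real (j + 1) * (sc m / cg)"
    by (rule J_dist[OF low_diam[OF assms(2)] v _ j(2)]) (use assms in auto)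
  also have "\<dots> \<le> real (n + 1) * (sc m / cg)"
    using j(1) cg by (intro mult_right_mono) (auto intro: less_imp_le)
  finally show ?thesis .
qed

text \<open>The cutoff function of \<open>cap_le\<close> is evaluated at the representatives
  \<open>pt (base u)\<close>. It is 1 on the inner neighbourhood because that lies in the small
  ball, and 0 off the outer one because cells meeting the large ball are within \<open>B\<close>
  steps. The threshold \<open>M\<close> is this \<open>B\<close>, chosen before \<open>w\<close> and
  \<open>N\<close>.\<close>

lemma cap_upper:
  fixes x0 :: 'a
  shows "\<exists>M. \<forall>N2\<ge>M. \<forall>N. \<forall>w\<in>Tr. \<exists>C>0. \<exists>k0. \<forall>k\<ge>k0.
    cap k ((pi_r \<pi> r ^^ k) w) N1 N2 N \<le> ennreal (C * vol x0 k * (r powr \<beta>) ^ k)"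
proof -
  \<comment> \<open>Makes \<open>lam * s\<close> equal to \<open>(N1 + 2) * sc m / cg\<close>:
    points of the inner neighbourhood have distance at most \<open>(N1 + 1) * sc m / cg\<close>, and
    balls are open.\<close>
  define A where "A = real (N1 + 2) / (cg * lam)"
  have A: "A > 0" using cg lam by (simp add: A_def)
  obtain B Jc where chain: "\<And>m v v' x y. m \<le> - int Jc \<Longrightarrow> v \<in> cells m \<Longrightarrow> v' \<in> cells m \<Longrightarrow>
      x \<in> K v \<Longrightarrow> y \<in> K v' \<Longrightarrow> d x y < A * sc m \<Longrightarrow> \<exists>j\<le>B. (v, v') \<in> JJ m ^^ j"
    using cells_chain[OF A] by blast
  obtain Js where Js: "\<And>m. m \<le> - int Js \<Longrightarrow> s0 / A \<le> sc m" using sc_large by blast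
  have "\<exists>C>0. \<exists>k0. \<forall>k\<ge>k0. cap k ((pi_r \<pi> r ^^ k) w) N1 N2 N \<le> ennreal (C * vol x0 k * (r powr \<beta>) ^ k)"
    if N2: "N2 \<ge> B" and w: "w \<in> Tr" for N2 N w
  proof -
    define m0 where "m0 = hr w"
    define x where "x = pt (base w)"
    have x: "x \<in> K (base w)" using pt base_Te[OF w] by (simp add: x_def)
    obtain C1 where C1: "C1 \<ge> 0" "\<And>F. Jsum N m0 (\<lambda>u. F (pt (base u))) \<le> ennreal C1 * Dsum F"
      using Jsum_le_Dsum by blast
    have "A * sc m0 > 0" using A by simp
    then obtain C2 where C2: "C2 > 0"
      "\<And>k. real (card (ball x (A * sc m0 * sc (- int k)))) \<le> C2 * real (card (ball x0 (1 * sc (- int k))))"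
      using vol_compare[of "A * sc m0" 1 x x0] by auto
    define C where "C = C1 * CL * C2 / (A * sc m0) powr \<beta> + 1"
    have C: "C > 0" using C1(1) CL C2(1) by (simp add: C_def add_nonneg_pos)
    define k0 where "k0 = nat (m0 + int Jc + int Js + int H)"
    have "cap k ((pi_r \<pi> r ^^ k) w) N1 N2 N \<le> ennreal (C * vol x0 k * (r powr \<beta>) ^ k)" if k: "k \<ge> k0" for k
    proof -
      define m where "m = m0 - int k"
      have m: "m \<le> - int Jc" "m \<le> - int Js" "m \<le> - int H" using k by (auto simp: m_def k0_def)
      define v where "v = anc m (base w)"
      have prw: "(pi_r \<pi> r ^^ k) w = Orig v" using pr_pow[OF w, of k] m by (simp add: v_def m_def m0_def)
      have v: "v \<in> cells m" unfolding v_def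
        using anc_cells base_Te[OF w] base_high[OF w, of k] m by (simp add: m_def m0_def)
      have hv: "h v = m" using v by (simp add: cells_def)
      have xv: "x \<in> K v" using x K_anc by (auto simp: v_def)
      define s where "s = A * sc m"
      have s: "s \<ge> s0" using Js[OF m(2)] A by (simp add: s_def field_simps)
      obtain F where F: "\<And>y. y \<in> ball x (lam * s) \<Longrightarrow> F y = 1" "\<And>y. y \<notin> ball x s \<Longrightarrow> F y = 0"
        "Dsum F \<le> ennreal (CL * real (card (ball x s)) / s powr \<beta>)" using cap_le[OF s, of x] by blast
      let ?f = "\<lambda>u. F (pt (base u))"
      have anc_u: "(pi_r \<pi> r ^^ k) u = Orig (anc m (base u)) \<and> anc m (base u) \<in> cells m \<and>
          pt (base u) \<in> K (anc m (base u))" if u: "u \<in> lev m0" for u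
      proof -
        have uT: "u \<in> Tr" "hr u = m0" "base u \<in> Te" using levD[OF u] by auto
        then have "(pi_r \<pi> r ^^ k) u = Orig (anc m (base u))" using pr_pow[OF uT(1), of k] m by (simp add: m_def)
        moreover have "anc m (base u) \<in> cells m"
          using anc_cells[OF uT(3)] base_high[OF uT(1), of k] uT m by (simp add: m_def)
        ultimately show ?thesis using pt[OF uT(3)] K_anc[of "base u" m] by auto
      qed
      have one: "?f u = 1" if u: "u \<in> lev m0" "u \<in> Sk K \<pi> r k (Gam N1 (Orig v))" for u
      proof -
        have "Orig (anc m (base u)) \<in> Gam N1 (Orig v)" using u(2) anc_u[OF u(1)] by (simp add: Sk_def)
        then have "d x (pt (base u)) \<le> real (N1 + 1) * (sc m / cg)"
          using Gam_near[OF v m(3) _ xv] anc_u[OF u(1)] by blast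
        also have "\<dots> < real (N1 + 2) * (sc m / cg)" using cg by (intro mult_strict_right_mono) auto
        also have "\<dots> = lam * s" using lam cg by (simp add: s_def A_def field_simps)
        finally show ?thesis by (intro F(1)) (simp add: dball_def)
      qed
      have zero: "?f u = 0" if u: "u \<in> lev m0" "u \<notin> Sk K \<pi> r k (Gam N2 (Orig v))" for u
      proof (rule F(2), rule notI)
        assume "pt (base u) \<in> ball x s"
        then have "d x (pt (base u)) < A * sc m" by (simp add: dball_def s_def)
        then obtain j where j: "j \<le> B" "(v, anc m (base u)) \<in> JJ m ^^ j"
          using chain[OF m(1) v _ xv] anc_u[OF u(1)] by blast
        have "Orig (anc m (base u)) \<in> lev m" using anc_u[OF u(1)] level_low[OF m(3)] by blast
        then have "Orig (anc m (base u)) \<in> Gam N2 (Orig v)"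
          using JJ_pow_J[OF m(3) j(2)] j(1) N2 hv unfolding Gamma_def by (auto intro!: exI[of _ j])
        then show False using u anc_u[OF u(1)] levD[OF u(1)] by (simp add: Sk_def)
      qed
      have hk: "hr (Orig v) + int k = m0" using hv by (simp add: m_def)
      have "cap k (Orig v) N1 N2 N \<le> Jsum N m0 ?f / 2"
        unfolding cap_def hk using one zero by (intro INF_lower) auto
      also have "\<dots> \<le> Jsum N m0 ?f" by (rule ennreal_half_le)
      also have "\<dots> \<le> ennreal C1 * Dsum F" by (rule C1(2))
      also have "\<dots> \<le> ennreal C1 * ennreal (CL * real (card (ball x s)) / s powr \<beta>)"
        by (intro mult_left_mono F(3)) simp
      also have "\<dots> = ennreal (C1 * (CL * real (card (ball x s)) / s powr \<beta>))"
        using C1(1) CL by (subst ennreal_mult[symmetric]) auto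
      also have "\<dots> \<le> ennreal (C * vol x0 k * (r powr \<beta>) ^ k)"
      proof (rule ennreal_leI)
        have sk: "s = A * sc m0 * sc (- int k)" by (simp add: s_def m_def sc_diff)
        have sp: "s powr \<beta> = (A * sc m0) powr \<beta> / (r powr \<beta>) ^ k"
          unfolding sk using A by (subst powr_mult) (auto simp: sc_neg_powr intro: less_imp_le)
        have "C1 * (CL * real (card (ball x s)) / s powr \<beta>) \<le> C1 * (CL * (C2 * vol x0 k) / s powr \<beta>)"
          using C1(1) CL C2(2)[of k] unfolding sk by (intro mult_left_mono divide_right_mono) auto
        also have "\<dots> = (C1 * CL * C2 / (A * sc m0) powr \<beta>) * (vol x0 k * (r powr \<beta>) ^ k)"
          unfolding sp by simp
        also have "\<dots> \<le> C * (vol x0 k * (r powr \<beta>) ^ k)"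
          by (intro mult_right_mono) (auto simp: C_def)
        finally show "C1 * (CL * real (card (ball x s)) / s powr \<beta>) \<le> C * vol x0 k * (r powr \<beta>) ^ k"
          by (simp add: mult.assoc)
      qed
      finally show ?thesis unfolding prw .
    qed
    then show ?thesis using C by blast
  qed
  then show ?thesis by blast
qed

text \<open>Any admissible \<open>f\<close> is pulled back to vertices through
  \<open>cellof\<close>. The pullback is 1 at \<open>x0\<close>, as the starting node is the cell
  chosen for \<open>x0\<close>, and vanishes off a ball of radius \<open>A * sc m\<close>, so
  \<open>cap_ge\<close> applies.\<close>

lemma cap_lower:
  fixes x0 :: 'a
  assumes m0: "m0 \<le> - int H" and N: "N \<ge> 1"
  shows "\<exists>C>0. \<exists>k0. \<forall>k\<ge>k0. ennreal (C * vol x0 k * (r powr \<beta>) ^ k)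
    \<le> cap k ((pi_r \<pi> r ^^ k) (Orig (cellof m0 x0))) N1 N2 N"
proof -
  define A where "A = real (N2 + 2) / cg"
  have A: "A > 0" using cg by (simp add: A_def)
  obtain Js where Js: "\<And>m. m \<le> - int Js \<Longrightarrow> s0 / A \<le> sc m" using sc_large by blast
  obtain C1 where C1: "C1 \<ge> 0" "\<And>f. Dsum (\<lambda>x. f (Orig (cellof m0 x))) \<le> ennreal C1 * Jsum N m0 f"
    using Dsum_le_Jsum[OF m0 N] by blast
  have "A * sc m0 > 0" using A by simp
  then obtain C2 where C2: "C2 > 0"
    "\<And>k. real (card (ball x0 (1 * sc (- int k)))) \<le> C2 * real (card (ball x0 (A * sc m0 * sc (- int k))))"
    using vol_compare[of 1 "A * sc m0" x0 x0] by auto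
  \<comment> \<open>\<open>C1 + 1\<close> replaces \<open>C1\<close>, which may be zero; the factor
    2 is the one half in the energy.\<close>
  define C where "C = CU / C2 / (A * sc m0) powr \<beta> / (2 * (C1 + 1))"
  have "(A * sc m0) powr \<beta> > 0" using A sc_pos[of m0] by (simp del: sc_pos)
  then have C: "C > 0" unfolding C_def using CU C2 C1 by (intro divide_pos_pos) auto
  define w where "w = cellof m0 x0"
  have w: "w \<in> cells m0" "x0 \<in> K w" using cellof[OF m0] by (auto simp: w_def)
  have "ennreal (C * vol x0 k * (r powr \<beta>) ^ k) \<le> cap k ((pi_r \<pi> r ^^ k) (Orig w)) N1 N2 N"
    if k: "k \<ge> Js" for k
  proof -
    define m where "m = m0 - int k"
    have m: "m \<le> - int Js" "m \<le> - int H" using k m0 by (auto simp: m_def)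
    define v where "v = (\<pi> ^^ k) w"
    have v: "v \<in> cells m" using w(1) Te_funpow by (auto simp: v_def cells_def m_def h_funpow)
    have hv: "h v = m" using v by (simp add: cells_def)
    have prw: "(pi_r \<pi> r ^^ k) (Orig w) = Orig v" by (simp add: pr_pow_Orig v_def)
    have xv: "x0 \<in> K v" using w(2) K_mono_funpow by (auto simp: v_def)
    define s where "s = A * sc m"
    have s: "s \<ge> s0" using Js[OF m(1)] A by (simp add: s_def field_simps)
    have hk: "hr (Orig v) + int k = m0" using hv by (simp add: m_def)
    have lev0: "Orig u \<in> lev m0 \<and> Orig u \<in> Tr" if "u \<in> cells m0" for u
      using that level_low[OF m0] levD by blast
    have "ennreal (C * vol x0 k * (r powr \<beta>) ^ k) \<le> Jsum N m0 f / 2"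
      if f1: "\<And>u. u \<in> lev m0 \<Longrightarrow> u \<in> Sk K \<pi> r k (Gam N1 (Orig v)) \<Longrightarrow> f u = 1"
        and f0: "\<And>u. u \<in> lev m0 \<Longrightarrow> u \<notin> Sk K \<pi> r k (Gam N2 (Orig v)) \<Longrightarrow> f u = 0" for f
    proof -
      let ?F = "\<lambda>x. f (Orig (cellof m0 x))"
      have "Orig v \<in> Gam N1 (Orig v)"
        using v level_low[OF m(2)] hv unfolding Gamma_def by (auto intro!: exI[of _ 0])
      then have "Orig w \<in> Sk K \<pi> r k (Gam N1 (Orig v))" using lev0[OF w(1)] prw by (simp add: Sk_def)
      then have one: "?F x0 = 1" using f1 lev0[OF w(1)] by (simp add: w_def)
      have zero: "?F y = 0" if y: "y \<notin> ball x0 s" for y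
      proof (rule f0)
        note cy = cellof[OF m0, of y]
        show "Orig (cellof m0 y) \<in> lev m0" using lev0 cy by blast
        show "Orig (cellof m0 y) \<notin> Sk K \<pi> r k (Gam N2 (Orig v))"
        proof
          assume "Orig (cellof m0 y) \<in> Sk K \<pi> r k (Gam N2 (Orig v))"
          then have "Orig ((\<pi> ^^ k) (cellof m0 y)) \<in> Gam N2 (Orig v)" by (simp add: Sk_def pr_pow_Orig)
          then have "d x0 y \<le> real (N2 + 1) * (sc m / cg)"
            using Gam_near[OF v m(2) _ xv] cy K_mono_funpow[of "cellof m0 y" k] by blast
          also have "\<dots> < real (N2 + 2) * (sc m / cg)" using cg by (intro mult_strict_right_mono) auto
          also have "\<dots> = s" by (simp add: s_def A_def)
          finally show False using y by (simp add: dball_def)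
        qed
      qed
      have "ennreal (CU * real (card (ball x0 s)) / s powr \<beta>) \<le> Dsum ?F" by (rule cap_ge[OF s, of ?F x0]) (use one zero in auto)
      also have "\<dots> \<le> ennreal C1 * Jsum N m0 f" by (rule C1(2))
      also have "\<dots> \<le> ennreal (C1 + 1) * Jsum N m0 f" by (intro mult_right_mono ennreal_leI) auto
      finally have "ennreal (CU * real (card (ball x0 s)) / s powr \<beta> / (2 * (C1 + 1))) \<le> Jsum N m0 f / 2"
        using C1(1) CU by (intro ennreal_le_half) auto
      moreover have "C * vol x0 k * (r powr \<beta>) ^ k \<le> CU * real (card (ball x0 s)) / s powr \<beta> / (2 * (C1 + 1))"
      proof -
        have sk: "s = A * sc m0 * sc (- int k)" by (simp add: s_def m_def sc_diff)
        have sp: "s powr \<beta> = (A * sc m0) powr \<beta> / (r powr \<beta>) ^ k"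
          unfolding sk using A by (subst powr_mult) (auto simp: sc_neg_powr intro: less_imp_le)
        have "C * vol x0 k * (r powr \<beta>) ^ k = CU * (vol x0 k / C2) / s powr \<beta> / (2 * (C1 + 1))"
          unfolding sp C_def by simp
        also have "\<dots> \<le> CU * real (card (ball x0 s)) / s powr \<beta> / (2 * (C1 + 1))"
        proof (intro divide_right_mono mult_left_mono)
          show "vol x0 k / C2 \<le> real (card (ball x0 s))"
            using C2(2)[of k] C2(1) unfolding sk by (simp add: field_simps)
        qed (use CU C1 in auto)
        finally show ?thesis .
      qed
      ultimately show ?thesis using ennreal_leI order_trans by blast
    qed
    then show ?thesis unfolding prw cap_def hk by (intro INF_greatest) blast
  qed
  then show ?thesis using C unfolding w_def by blast
qed

lemma Sk_upper:
  fixes x0 :: 'a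
  assumes w: "w \<in> Tr"
  shows "\<exists>C>0. \<exists>k0. \<forall>k\<ge>k0. finite (Sk K \<pi> r k {(pi_r \<pi> r ^^ k) w}) \<and>
    real (card (Sk K \<pi> r k {(pi_r \<pi> r ^^ k) w})) \<le> C * vol x0 k"
proof -
  define m0 where "m0 = hr w"
  obtain C1 where C1: "\<And>A. finite A \<Longrightarrow> finite {u \<in> lev m0. K (base u) \<subseteq> A} \<and>
     card {u \<in> lev m0. K (base u) \<subseteq> A} \<le> C1 * card A" using node_count by blast
  define x where "x = pt (base w)"
  have x: "x \<in> K (base w)" using pt base_Te[OF w] by (simp add: x_def)
  define A where "A = (1 / cg + 1) * sc m0"
  have A: "A > 0" using cg by (simp add: A_def add_pos_pos)
  obtain C2 where C2: "C2 > 0"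
    "\<And>k. real (card (ball x (A * sc (- int k)))) \<le> C2 * real (card (ball x0 (1 * sc (- int k))))"
    using vol_compare[of A 1 x x0] A by auto
  have "finite (Sk K \<pi> r k {(pi_r \<pi> r ^^ k) w}) \<and>
    real (card (Sk K \<pi> r k {(pi_r \<pi> r ^^ k) w})) \<le> (real C1 * C2 + 1) * vol x0 k"
    if k: "k \<ge> nat (m0 + int H)" for k
  proof -
    define m where "m = m0 - int k"
    have m: "m \<le> - int H" using k by (auto simp: m_def)
    define v where "v = anc m (base w)"
    have prw: "(pi_r \<pi> r ^^ k) w = Orig v" using pr_pow[OF w, of k] m by (simp add: v_def m_def m0_def)
    have v: "v \<in> cells m" unfolding v_def
      using anc_cells base_Te[OF w] base_high[OF w, of k] m by (simp add: m_def m0_def)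
    have hv: "h v = m" "v \<in> Te" using v by (auto simp: cells_def)
    have xv: "x \<in> K v" using x K_anc by (auto simp: v_def)
    have Kv: "K v \<subseteq> ball x (A * sc (- int k))"
    proof
      fix z assume "z \<in> K v"
      then have "d x z \<le> sc m / cg" using d_le_sc[OF hv(2) xv] hv(1) by simp
      moreover have "A * sc (- int k) = sc m / cg + sc m" by (simp add: A_def m_def sc_diff field_simps)
      ultimately show "z \<in> ball x (A * sc (- int k))"
        unfolding dball_def using sc_pos[of m] by (simp del: sc_pos)
    qed
    have sub: "Sk K \<pi> r k {(pi_r \<pi> r ^^ k) w} \<subseteq> {u \<in> lev m0. K (base u) \<subseteq> K v}"
    proof
      fix u assume "u \<in> Sk K \<pi> r k {(pi_r \<pi> r ^^ k) w}"
      then have u: "u \<in> Tr" "(pi_r \<pi> r ^^ k) u = Orig v" by (auto simp: Sk_def prw)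
      then have hu: "hr u = m0" using hr_pr_pow[OF u(1), of k] hv by (simp add: m_def)
      then have "Orig (anc m (base u)) = Orig v" using pr_pow[OF u(1), of k] u(2) m by (simp add: m_def)
      then have "K (base u) \<subseteq> K v" using K_anc[of "base u" m] by simp
      then show "u \<in> {u \<in> lev m0. K (base u) \<subseteq> K v}" using u hu by (simp add: level_r_def)
    qed
    note Cv1 = C1[OF finite_K[of v]]
    have "real (card (Sk K \<pi> r k {(pi_r \<pi> r ^^ k) w})) \<le> real (C1 * card (K v))"
      using card_mono[OF conjunct1[OF Cv1] sub] Cv1 by (meson of_nat_mono order_trans)
    also have "\<dots> \<le> real C1 * real (card (ball x (A * sc (- int k))))"
      using card_mono[OF finite_ball Kv] by (simp add: mult_left_mono)
    also have "\<dots> \<le> real C1 * (C2 * vol x0 k)" using C2(2)[of k] by (intro mult_left_mono) auto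
    also have "\<dots> \<le> (real C1 * C2 + 1) * vol x0 k" by (simp add: distrib_right mult.assoc)
    finally show ?thesis using finite_subset[OF sub] Cv1 by blast
  qed
  moreover have "real C1 * C2 + 1 > 0" using C2(1) by (simp add: add_nonneg_pos)
  ultimately show ?thesis by blast
qed

text \<open>\<open>K v\<close> contains a ball of comparable size and is covered by the cells of the
  descendants at level \<open>m0\<close>: an edge node below \<open>v\<close> has height at least
  \<open>m0\<close>, so it passes through that level. Each of these cells has boundedly many
  vertices.\<close>

lemma Sk_lower:
  fixes x0 :: 'a
  assumes m0: "m0 \<le> - int H"
  shows "\<exists>C>0. \<exists>k0. \<forall>k\<ge>k0.
    C * vol x0 k \<le> real (card (Sk K \<pi> r k {(pi_r \<pi> r ^^ k) (Orig (cellof m0 x0))}))"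
proof -
  define w where "w = cellof m0 x0"
  have w: "w \<in> cells m0" "x0 \<in> K w" using cellof[OF m0] by (auto simp: w_def)
  have wT: "Orig w \<in> Tr" using w(1) level_low[OF m0] levD by blast
  \<comment> \<open>\<open>card\<close> of an infinite set is 0, so a lower bound on
    \<open>card\<close> requires finiteness first.\<close>
  obtain k1 where fin: "\<And>k. k \<ge> k1 \<Longrightarrow> finite (Sk K \<pi> r k {(pi_r \<pi> r ^^ k) (Orig w)})"
    using Sk_upper[OF wT, of x0] by blast
  obtain B where B: "\<And>v. v \<in> cells m0 \<Longrightarrow> card (K v) \<le> B" using card_cell_bounded by blast
  obtain a Jb where a: "a > 0"
    and aJ: "\<And>v. v \<in> Te \<Longrightarrow> h v \<le> - int Jb \<Longrightarrow> \<exists>x\<in>K v. ball x (a * sc (h v)) \<subseteq> K v"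
    using ball_in_cell by blast
  obtain C2 where C2: "C2 > 0"
    "\<And>k. real (card (ball x0 (1 * sc (- int k)))) \<le> C2 * real (card (ball x0 (sc m0 * sc (- int k))))"
    using vol_compare[of 1 "sc m0" x0 x0] by auto
  define q where "q = (1 + 1 / cg) / a"
  have q: "q > 0" using a cg by (simp add: q_def add_pos_pos)
  define D where "D = C2 * dbl q * (real B + 1)"
  have D: "D > 0" unfolding D_def using C2(1) dbl_ge1[of q] by (intro mult_pos_pos) auto
  have "1 / D * vol x0 k \<le> real (card (Sk K \<pi> r k {(pi_r \<pi> r ^^ k) (Orig w)}))" if k: "k \<ge> max k1 Jb" for k
  proof -
    define m where "m = m0 - int k"
    have m: "m \<le> - int Jb" "m \<le> m0" using k m0 by (auto simp: m_def)
    define v where "v = (\<pi> ^^ k) w"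
    have v: "v \<in> cells m" using w(1) Te_funpow by (auto simp: v_def cells_def m_def h_funpow)
    have hv: "h v = m" "v \<in> Te" using v by (auto simp: cells_def)
    have prw: "(pi_r \<pi> r ^^ k) (Orig w) = Orig v" by (simp add: pr_pow_Orig v_def)
    have xv: "x0 \<in> K v" using w(2) K_mono_funpow by (auto simp: v_def)
    let ?S = "Sk K \<pi> r k {(pi_r \<pi> r ^^ k) (Orig w)}"
    have fS: "finite ?S" using fin k by simp
    have S_cell: "base u \<in> cells m0" if u: "u \<in> ?S" for u
    proof -
      have u: "u \<in> Tr" "(pi_r \<pi> r ^^ k) u = Orig v" using u by (auto simp: Sk_def prw)
      then have "hr u = m0" using hr_pr_pow[OF u(1), of k] hv by (simp add: m_def)
      then have "u \<in> lev m0" using u by (simp add: level_r_def)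
      then show ?thesis using level_low[OF m0] by auto
    qed
    have cover: "K v \<subseteq> (\<Union>u\<in>?S. K (base u))"
    proof
      fix z assume z: "z \<in> K v"
      obtain l where l: "l \<in> Le" "l \<in> subtree \<pi> v" "z \<in> K l" using Le_below[OF hv(2) z] by blast
      have hl: "m0 \<le> h l" using H[OF l(1)] m0 by linarith
      define u where "u = anc m0 l"
      have u: "u \<in> cells m0" unfolding u_def using anc_cells hl l(1) Le_subset_Te by blast
      have "u \<in> subtree \<pi> v" unfolding u_def by (rule anc_subtree[OF l(2)]) (use hv m hl in auto)
      then obtain n where n: "(\<pi> ^^ n) u = v" by (auto simp: subtree_def)
      then have "n = k" using h_funpow[of n u] u hv by (simp add: cells_def m_def)
      then have "Orig u \<in> ?S" using n u level_low[OF m0] levD[of "Orig u" m0] unfolding Sk_def prw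
        by (auto simp: pr_pow_Orig)
      moreover have "z \<in> K u" using l(3) K_anc[of l m0] by (auto simp: u_def)
      ultimately show "z \<in> (\<Union>u\<in>?S. K (base u))" by force
    qed
    have "card (K v) \<le> card (\<Union>u\<in>?S. K (base u))" using fS finite_K by (intro card_mono cover) auto
    also have "\<dots> \<le> (\<Sum>u\<in>?S. card (K (base u)))" by (rule card_UN_le[OF fS])
    also have "\<dots> \<le> (\<Sum>u\<in>?S. B)" by (intro sum_mono B S_cell)
    finally have cKv: "real (card (K v)) \<le> real B * real (card ?S)"
      by (metis mult.commute of_nat_le_iff of_nat_mult sum_constant of_nat_id)
    obtain z where z: "z \<in> K v" "ball z (a * sc m) \<subseteq> K v" using aJ[OF hv(2)] hv(1) m(1) by auto
    have "d x0 z \<le> sc m / cg" using d_le_sc[OF hv(2) xv z(1)] hv(1) by simp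
    moreover have "q * (a * sc m) = sc m + sc m / cg" using a by (simp add: q_def field_simps)
    ultimately have "real (card (ball x0 (sc m))) \<le> dbl q * real (card (ball z (a * sc m)))"
      using a q by (intro ball_compare) auto
    also have "\<dots> \<le> dbl q * real (card (K v))"
      using card_mono[OF finite_K z(2)] dbl_ge1[of q] by (intro mult_left_mono) auto
    also have "\<dots> \<le> dbl q * (real B * real (card ?S))"
      using cKv dbl_ge1[of q] by (intro mult_left_mono) auto
    finally have "C2 * real (card (ball x0 (sc m))) \<le> C2 * (dbl q * (real B * real (card ?S)))"
      using C2(1) by (intro mult_left_mono) auto
    moreover have "vol x0 k \<le> C2 * real (card (ball x0 (sc m)))"
      using C2(2)[of k] by (simp add: m_def sc_diff)
    moreover have "C2 * (dbl q * (real B * real (card ?S))) \<le> C2 * (dbl q * ((real B + 1) * real (card ?S)))"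
      using C2(1) dbl_ge1[of q] by (intro mult_left_mono mult_right_mono) auto
    ultimately have "vol x0 k \<le> D * real (card ?S)" by (simp add: D_def mult_ac)
    then show ?thesis using D by (simp add: field_simps)
  qed
  moreover have "1 / D > 0" using D by simp
  ultimately show ?thesis unfolding w_def by blast
qed

end

section \<open>Limits inferior and superior of growth rates\<close>

lemma liminf_exp:
  assumes "liminf (\<lambda>k. ereal (b k)) = ereal l"
  shows "liminf (\<lambda>k. ereal (exp (b k))) = ereal (exp l)"
proof (rule antisym)
  show "ereal (exp l) \<le> liminf (\<lambda>k. ereal (exp (b k)))"
    unfolding le_Liminf_iff
  proof (intro allI impI)
    fix y :: ereal assume y: "y < ereal (exp l)"
    show "\<forall>\<^sub>F k in sequentially. y < ereal (exp (b k))"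
    proof (cases y)
      case (real t)
      show ?thesis
      proof (cases "t > 0")
        case True
        then have "ln t < l" using y real by (metis exp_less_cancel_iff exp_ln less_ereal.simps(1))
        then have "ereal (ln t) < liminf (\<lambda>k. ereal (b k))" by (simp add: assms)
        from less_LiminfD[OF this] show ?thesis
        proof (rule eventually_mono)
          fix k assume "ereal (ln t) < ereal (b k)"
          then have "exp (ln t) < exp (b k)" by simp
          then show "y < ereal (exp (b k))" using True real by simp
        qed
      next
        case False
        then have "t < exp (b k)" for k by (metis exp_gt_zero le_less_trans not_less)
        then show ?thesis using real by simp
      qed
    qed (use y in auto)
  qed
  show "liminf (\<lambda>k. ereal (exp (b k))) \<le> ereal (exp l)"
  proof (rule ccontr)
    assume "\<not> ?thesis"
    then obtain y where y: "ereal (exp l) < ereal y" "ereal y < liminf (\<lambda>k. ereal (exp (b k)))"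
      by (meson ereal_dense2 not_le)
    have y0: "y > 0" using y(1) by (metis exp_gt_zero less_ereal.simps(1) less_trans)
    have "\<forall>\<^sub>F k in sequentially. ereal (ln y) \<le> ereal (b k)"
      using less_LiminfD[OF y(2)]
    proof (rule eventually_mono)
      fix k assume "ereal y < ereal (exp (b k))"
      then have "ln y < ln (exp (b k))" using y0 by (simp only: less_ereal.simps ln_less_cancel_iff exp_gt_zero)
      then show "ereal (ln y) \<le> ereal (b k)" by simp
    qed
    then have "ereal (ln y) \<le> ereal l" unfolding assms[symmetric] by (rule Liminf_bounded)
    then have "exp (ln y) \<le> exp l" by simp
    then show False using y(1) y0 by simp
  qed
qed

lemma limsup_exp:
  assumes "limsup (\<lambda>k. ereal (b k)) = ereal l"
  shows "limsup (\<lambda>k. ereal (exp (b k))) = ereal (exp l)"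
proof (rule antisym)
  show "limsup (\<lambda>k. ereal (exp (b k))) \<le> ereal (exp l)"
    unfolding Limsup_le_iff
  proof (intro allI impI)
    fix y :: ereal assume y: "y > ereal (exp l)"
    show "\<forall>\<^sub>F k in sequentially. y > ereal (exp (b k))"
    proof (cases y)
      case (real t)
      then have t: "t > exp l" "t > 0" using y by (auto intro: less_trans[OF exp_gt_zero])
      then have "l < ln t" by (metis exp_less_cancel_iff exp_ln)
      then have "limsup (\<lambda>k. ereal (b k)) < ereal (ln t)" by (simp add: assms)
      from Limsup_lessD[OF this] show ?thesis
      proof (rule eventually_mono)
        fix k assume "ereal (b k) < ereal (ln t)"
        then have "exp (b k) < exp (ln t)" by simp
        then show "ereal (exp (b k)) < y" using t real by simp
      qed
    qed (use y in auto)
  qed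
  show "ereal (exp l) \<le> limsup (\<lambda>k. ereal (exp (b k)))"
  proof (rule ccontr)
    assume "\<not> ?thesis"
    then obtain y where y: "ereal y < ereal (exp l)" "limsup (\<lambda>k. ereal (exp (b k))) < ereal y"
      by (meson ereal_dense2 not_le)
    have y0: "y > 0"
    proof -
      obtain k where "ereal (exp (b k)) < ereal y"
        using eventually_happens[OF Limsup_lessD[OF y(2)]] by auto
      then show ?thesis by (metis exp_gt_zero less_ereal.simps(1) less_trans)
    qed
    have "\<forall>\<^sub>F k in sequentially. ereal (b k) \<le> ereal (ln y)"
      using Limsup_lessD[OF y(2)]
    proof (rule eventually_mono)
      fix k assume "ereal (exp (b k)) < ereal y"
      then have "ln (exp (b k)) < ln y" using y0 by (simp only: less_ereal.simps ln_less_cancel_iff exp_gt_zero)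
      then show "ereal (b k) \<le> ereal (ln y)" by simp
    qed
    then have "ereal l \<le> ereal (ln y)" unfolding assms[symmetric] by (rule Limsup_bounded)
    then have "exp l \<le> exp (ln y)" by simp
    then show False using y(1) y0 by simp
  qed
qed

lemma root_rate_tendsto: "(\<lambda>k. ereal (ln C / real k + c)) \<longlonglongrightarrow> ereal c"
proof -
  have "(\<lambda>k. ln C / real k + c) \<longlonglongrightarrow> 0 + c"
    by (intro tendsto_add lim_const_over_n tendsto_const)
  then show ?thesis by simp
qed

lemma liminf_root_rate:
  assumes "liminf (\<lambda>k. ereal (W k / real k)) = ereal l"
  shows "liminf (\<lambda>k. ereal (exp (ln C / real k + c + W k / real k))) = ereal (exp (l + c))"
proof (rule liminf_exp)
  have "liminf (\<lambda>k. ereal (ln C / real k + c) + ereal (W k / real k)) = ereal c + ereal l"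
    unfolding assms[symmetric] by (rule ereal_liminf_lim_add[OF root_rate_tendsto]) simp
  then show "liminf (\<lambda>k. ereal (ln C / real k + c + W k / real k)) = ereal (l + c)"
    by (simp add: add.commute)
qed

lemma limsup_root_rate:
  assumes "limsup (\<lambda>k. ereal (W k / real k)) = ereal l"
  shows "limsup (\<lambda>k. ereal (exp (ln C / real k + c + W k / real k))) = ereal (exp (l + c))"
proof (rule limsup_exp)
  have "limsup (\<lambda>k. ereal (ln C / real k + c) + ereal (W k / real k)) = ereal c + ereal l"
    unfolding assms[symmetric] by (rule ereal_limsup_lim_add[OF root_rate_tendsto]) simp
  then show "limsup (\<lambda>k. ereal (ln C / real k + c + W k / real k)) = ereal (l + c)"
    by (simp add: add.commute)
qed

lemma root_eq:
  assumes "C > 0" "k \<ge> 1"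
  shows "(C * exp (W k) * exp c ^ k) powr (1 / real k) = exp (ln C / real k + c + W k / real k)"
proof -
  have "C * exp (W k) * exp c ^ k = exp (ln C + W k + real k * c)"
    using assms by (simp add: exp_add exp_of_nat_mult)
  also have "\<dots> powr (1 / real k) = exp ((ln C + W k + real k * c) / real k)"
    by (simp add: powr_def)
  also have "(ln C + W k + real k * c) / real k = ln C / real k + c + W k / real k"
    using assms by (simp add: field_simps)
  finally show ?thesis .
qed

text \<open>The \<open>k\<close>-th root removes the factor \<open>C\<close> and turns
  \<open>exp c ^ k\<close> into a shift of the rate by \<open>c\<close>. The shift is 0 for counting
  nodes and \<open>\<beta> * ln r\<close> for energies.\<close>

lemma
  assumes "C > 0" "\<And>k. k \<ge> k0 \<Longrightarrow> 0 \<le> X k \<and> X k \<le> C * exp (W k) * exp c ^ k"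
  shows liminf_root_le: "liminf (\<lambda>k. ereal (W k / real k)) = ereal l \<Longrightarrow>
      liminf (\<lambda>k. ereal (X k powr (1 / real k))) \<le> ereal (exp (l + c))"
    and limsup_root_le: "limsup (\<lambda>k. ereal (W k / real k)) = ereal l \<Longrightarrow>
      limsup (\<lambda>k. ereal (X k powr (1 / real k))) \<le> ereal (exp (l + c))"
proof -
  have ev: "\<forall>\<^sub>F k in sequentially.
      ereal (X k powr (1 / real k)) \<le> ereal (exp (ln C / real k + c + W k / real k))"
    using eventually_ge_at_top[of "max k0 1"]
  proof (rule eventually_mono)
    fix k assume k: "max k0 1 \<le> k"
    then have "X k powr (1 / real k) \<le> (C * exp (W k) * exp c ^ k) powr (1 / real k)"
      using assms(2)[of k] by (intro powr_mono2) auto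
    then show "ereal (X k powr (1 / real k)) \<le> ereal (exp (ln C / real k + c + W k / real k))"
      using root_eq[OF assms(1), of k W c] k by simp
  qed
  show "liminf (\<lambda>k. ereal (X k powr (1 / real k))) \<le> ereal (exp (l + c))"
    if "liminf (\<lambda>k. ereal (W k / real k)) = ereal l"
    using Liminf_mono[OF ev] liminf_root_rate[OF that] by metis
  show "limsup (\<lambda>k. ereal (X k powr (1 / real k))) \<le> ereal (exp (l + c))"
    if "limsup (\<lambda>k. ereal (W k / real k)) = ereal l"
    using Limsup_mono[OF ev] limsup_root_rate[OF that] by metis
qed

lemma
  assumes "C > 0" "\<And>k. k \<ge> k0 \<Longrightarrow> C * exp (W k) * exp c ^ k \<le> X k"
  shows liminf_root_ge: "liminf (\<lambda>k. ereal (W k / real k)) = ereal l \<Longrightarrow>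
      ereal (exp (l + c)) \<le> liminf (\<lambda>k. ereal (X k powr (1 / real k)))"
    and limsup_root_ge: "limsup (\<lambda>k. ereal (W k / real k)) = ereal l \<Longrightarrow>
      ereal (exp (l + c)) \<le> limsup (\<lambda>k. ereal (X k powr (1 / real k)))"
proof -
  have ev: "\<forall>\<^sub>F k in sequentially.
      ereal (exp (ln C / real k + c + W k / real k)) \<le> ereal (X k powr (1 / real k))"
    using eventually_ge_at_top[of "max k0 1"]
  proof (rule eventually_mono)
    fix k assume k: "max k0 1 \<le> k"
    then have "(C * exp (W k) * exp c ^ k) powr (1 / real k) \<le> X k powr (1 / real k)"
      using assms(2)[of k] assms(1) by (intro powr_mono2) auto
    then show "ereal (exp (ln C / real k + c + W k / real k)) \<le> ereal (X k powr (1 / real k))"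
      using root_eq[OF assms(1), of k W c] k by simp
  qed
  show "ereal (exp (l + c)) \<le> liminf (\<lambda>k. ereal (X k powr (1 / real k)))"
    if "liminf (\<lambda>k. ereal (W k / real k)) = ereal l"
    using Liminf_mono[OF ev] liminf_root_rate[OF that] by metis
  show "ereal (exp (l + c)) \<le> limsup (\<lambda>k. ereal (X k powr (1 / real k)))"
    if "limsup (\<lambda>k. ereal (W k / real k)) = ereal l"
    using Limsup_mono[OF ev] limsup_root_rate[OF that] by metis
qed

lemma liminf_compose_le:
  fixes f :: "nat \<Rightarrow> ereal"
  assumes "filterlim g sequentially sequentially"
  shows "liminf f \<le> liminf (\<lambda>n. f (g n))"
  unfolding le_Liminf_iff using eventually_compose_filterlim[OF less_LiminfD assms] by blast

lemma limsup_compose_le: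
  fixes f :: "nat \<Rightarrow> ereal"
  assumes "filterlim g sequentially sequentially"
  shows "limsup (\<lambda>n. f (g n)) \<le> limsup f"
  unfolding Limsup_le_iff using eventually_compose_filterlim[OF Limsup_lessD assms] by blast

text \<open>\<open>g\<close> may repeat values, so \<open>f (g n)\<close> need not be a subsequence
  of \<open>f\<close>. Tending to infinity gives one inequality, and the eventual right inverse
  \<open>g'\<close> gives the other.\<close>

lemma
  fixes f :: "nat \<Rightarrow> ereal"
  assumes g: "filterlim g sequentially sequentially" "filterlim g' sequentially sequentially"
    and inv: "\<forall>\<^sub>F k in sequentially. g (g' k) = k"
  shows liminf_reindex: "liminf (\<lambda>n. f (g n)) = liminf f"
    and limsup_reindex: "limsup (\<lambda>n. f (g n)) = limsup f"
proof -
  have ev: "\<forall>\<^sub>F k in sequentially. f (g (g' k)) = f k"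
    using inv by (rule eventually_mono) simp
  show "liminf (\<lambda>n. f (g n)) = liminf f"
  proof (rule antisym)
    show "liminf (\<lambda>n. f (g n)) \<le> liminf f"
      using liminf_compose_le[OF g(2), of "\<lambda>n. f (g n)"] Liminf_eq[OF ev] by simp
  qed (rule liminf_compose_le[OF g(1)])
  show "limsup (\<lambda>n. f (g n)) = limsup f"
  proof (rule antisym)
    show "limsup f \<le> limsup (\<lambda>n. f (g n))"
      using limsup_compose_le[OF g(2), of "\<lambda>n. f (g n)"] Limsup_eq[OF ev] by simp
  qed (rule limsup_compose_le[OF g(1)])
qed

text \<open>Passing from the geometric scale \<open>k\<close> to the time \<open>n\<close> with \<open>exp (\<gamma> k) \<le> n < exp (\<gamma> (k + 1))\<close>.\<close>

lemma
  fixes W p :: "nat \<Rightarrow> real"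
  assumes \<gamma>: "\<gamma> > 0"
    and p: "\<And>n. n \<ge> 2 \<Longrightarrow> \<bar>- ln (p n) - W (nat \<lfloor>ln (real n) / \<gamma>\<rfloor>)\<bar> \<le> C"
  shows liminf_time_scale: "liminf (\<lambda>k. ereal (W k / real k)) = ereal l \<Longrightarrow>
      liminf (\<lambda>n. ereal (- ln (p n) / ln (real n))) = ereal (l / \<gamma>)"
    and limsup_time_scale: "limsup (\<lambda>k. ereal (W k / real k)) = ereal l \<Longrightarrow>
      limsup (\<lambda>n. ereal (- ln (p n) / ln (real n))) = ereal (l / \<gamma>)"
proof -
  define \<kappa> where "\<kappa> n = nat \<lfloor>ln (real n) / \<gamma>\<rfloor>" for n :: nat
  \<comment> \<open>The least integer not below \<open>exp (\<gamma> * k)\<close>. It is a right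
    inverse of \<open>\<kappa>\<close> as soon as the gap up to
    \<open>exp (\<gamma> * (k + 1))\<close> is at least 1.\<close>
  define \<nu> where "\<nu> k = nat \<lceil>exp (\<gamma> * real k)\<rceil>" for k :: nat
  have ln_top: "filterlim (\<lambda>n. ln (real n)) at_top sequentially"
    by (rule filterlim_compose[OF ln_at_top filterlim_real_sequentially])
  have quot_top: "filterlim (\<lambda>n. ln (real n) / \<gamma>) at_top sequentially"
    using filterlim_tendsto_pos_mult_at_top[OF tendsto_const _ ln_top, of "1 / \<gamma>"] \<gamma> by simp
  have \<kappa>_top: "filterlim \<kappa> sequentially sequentially"
    unfolding \<kappa>_def by (intro filterlim_compose[OF filterlim_nat_sequentially]
        filterlim_compose[OF filterlim_floor_sequentially] quot_top)
  have \<nu>_ge: "real (\<nu> k) \<ge> exp (\<gamma> * real k)" for k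
    unfolding \<nu>_def by linarith
  have \<nu>_less: "real (\<nu> k) < exp (\<gamma> * real k) + 1" for k
  proof -
    have "real (\<nu> k) = of_int \<lceil>exp (\<gamma> * real k)\<rceil>"
      unfolding \<nu>_def by (simp add: less_imp_le order_trans[OF _ less_imp_le[OF exp_gt_zero]])
    then show ?thesis by linarith
  qed
  have exp_top: "filterlim (\<lambda>k. exp (\<gamma> * real k)) at_top sequentially"
    by (intro filterlim_compose[OF exp_at_top]
        filterlim_tendsto_pos_mult_at_top[OF tendsto_const \<gamma> filterlim_real_sequentially])
  have "filterlim (\<lambda>k. real (\<nu> k)) at_top sequentially"
    by (rule filterlim_at_top_mono[OF exp_top]) (use \<nu>_ge in auto)
  then have \<nu>_top: "filterlim \<nu> sequentially sequentially"
    by (simp add: filterlim_sequentially_iff_filterlim_real)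
  have inv: "\<forall>\<^sub>F k in sequentially. \<kappa> (\<nu> k) = k"
  proof -
    have "\<forall>\<^sub>F k in sequentially. 1 / (exp \<gamma> - 1) \<le> exp (\<gamma> * real k)"
      using exp_top by (simp add: filterlim_at_top)
    then show ?thesis
    proof (rule eventually_mono)
      fix k assume k: "1 / (exp \<gamma> - 1) \<le> exp (\<gamma> * real k)"
      have "exp \<gamma> - 1 > 0" using \<gamma> by simp
      then have "exp (\<gamma> * real k) + 1 \<le> exp (\<gamma> * real k) * exp \<gamma>" using k by (simp add: field_simps)
      also have "\<dots> = exp (\<gamma> * (real k + 1))" by (simp add: exp_add[symmetric] algebra_simps)
      finally have up: "real (\<nu> k) < exp (\<gamma> * (real k + 1))" using \<nu>_less[of k] by linarith
      have pos: "real (\<nu> k) > 0" using \<nu>_ge[of k] exp_gt_zero less_le_trans by blast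
      have "\<gamma> * real k \<le> ln (real (\<nu> k))" using \<nu>_ge[of k] pos by (simp add: ln_ge_iff)
      moreover have "ln (real (\<nu> k)) < \<gamma> * (real k + 1)"
        using up pos by (metis exp_gt_zero ln_exp ln_less_cancel_iff)
      ultimately have "real k \<le> ln (real (\<nu> k)) / \<gamma>" "ln (real (\<nu> k)) / \<gamma> < real k + 1"
        using \<gamma> by (auto simp: field_simps)
      then have "\<lfloor>ln (real (\<nu> k)) / \<gamma>\<rfloor> = int k" by (intro floor_unique) auto
      then show "\<kappa> (\<nu> k) = k" by (simp add: \<kappa>_def)
    qed
  qed
  have inv_ln: "(\<lambda>n. C' / ln (real n)) \<longlonglongrightarrow> 0" for C'
    using tendsto_divide_0[OF tendsto_const filterlim_at_top_imp_at_infinity[OF ln_top]] .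
  define e where "e n = (- ln (p n) - W (\<kappa> n)) / ln (real n)" for n
  have "e \<longlonglongrightarrow> 0"
  proof (rule Lim_null_comparison[OF _ inv_ln[of C]])
    show "\<forall>\<^sub>F n in sequentially. norm (e n) \<le> C / ln (real n)"
      using eventually_ge_at_top[of 2]
    proof (rule eventually_mono)
      fix n :: nat assume n: "2 \<le> n"
      then have "ln (real n) > 0" by simp
      then show "norm (e n) \<le> C / ln (real n)"
        using p[OF n] by (simp add: e_def \<kappa>_def abs_divide divide_right_mono)
    qed
  qed
  then have e: "(\<lambda>n. ereal (e n)) \<longlonglongrightarrow> ereal 0" by simp
  define u where "u n = real (\<kappa> n) / ln (real n)" for n
  have "(\<lambda>n. u n - 1 / \<gamma>) \<longlonglongrightarrow> 0"
  proof (rule Lim_null_comparison[OF _ inv_ln[of 1]])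
    show "\<forall>\<^sub>F n in sequentially. norm (u n - 1 / \<gamma>) \<le> 1 / ln (real n)"
      using eventually_ge_at_top[of 2]
    proof (rule eventually_mono)
      fix n :: nat assume n: "2 \<le> n"
      then have l: "ln (real n) > 0" by simp
      then have "ln (real n) / \<gamma> \<ge> 0" using \<gamma> by simp
      then have "\<bar>real (\<kappa> n) - ln (real n) / \<gamma>\<bar> \<le> 1" unfolding \<kappa>_def by linarith
      then have "\<bar>real (\<kappa> n) - ln (real n) / \<gamma>\<bar> / ln (real n) \<le> 1 / ln (real n)"
        using l by (intro divide_right_mono) auto
      moreover have "u n - 1 / \<gamma> = (real (\<kappa> n) - ln (real n) / \<gamma>) / ln (real n)"
        using l by (simp add: u_def diff_divide_distrib)
      ultimately show "norm (u n - 1 / \<gamma>) \<le> 1 / ln (real n)" using l by simp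
    qed
  qed
  then have u: "(\<lambda>n. ereal (u n)) \<longlonglongrightarrow> ereal (1 / \<gamma>)" by (simp add: LIM_zero_iff)
  \<comment> \<open>The quotient is an error tending to 0 plus the rate at
    \<open>\<kappa> n\<close>, multiplied by a factor tending to
    \<open>1 / \<gamma>\<close>.\<close>
  have eq: "\<forall>\<^sub>F n in sequentially. ereal (- ln (p n) / ln (real n)) =
      ereal (e n) + ereal (u n) * ereal (W (\<kappa> n) / real (\<kappa> n))"
    using eventually_conj[OF eventually_ge_at_top[of 2] filterlim_at_top[THEN iffD1, OF \<kappa>_top, rule_format, of 1]]
  proof (rule eventually_mono)
    fix n assume n: "2 \<le> n \<and> 1 \<le> \<kappa> n"
    then have "- ln (p n) / ln (real n) = e n + u n * (W (\<kappa> n) / real (\<kappa> n))"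
      unfolding e_def u_def by (simp add: diff_divide_distrib)
    then show "ereal (- ln (p n) / ln (real n)) = ereal (e n) + ereal (u n) * ereal (W (\<kappa> n) / real (\<kappa> n))"
      by simp
  qed
  have \<gamma>': "ereal (1 / \<gamma>) > 0" using \<gamma> by simp
  show "liminf (\<lambda>n. ereal (- ln (p n) / ln (real n))) = ereal (l / \<gamma>)"
    if l: "liminf (\<lambda>k. ereal (W k / real k)) = ereal l"
  proof -
    have "liminf (\<lambda>n. ereal (- ln (p n) / ln (real n))) =
        liminf (\<lambda>n. ereal (e n) + ereal (u n) * ereal (W (\<kappa> n) / real (\<kappa> n)))" by (rule Liminf_eq[OF eq])
    also have "\<dots> = ereal 0 + liminf (\<lambda>n. ereal (u n) * ereal (W (\<kappa> n) / real (\<kappa> n)))"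
      by (rule ereal_liminf_lim_add[OF e]) simp
    also have "\<dots> = ereal 0 + ereal (1 / \<gamma>) * liminf (\<lambda>n. ereal (W (\<kappa> n) / real (\<kappa> n)))"
      by (subst ereal_liminf_lim_mult[OF u \<gamma>']) auto
    also have "liminf (\<lambda>n. ereal (W (\<kappa> n) / real (\<kappa> n))) = ereal l"
      unfolding l[symmetric] by (rule liminf_reindex[OF \<kappa>_top \<nu>_top inv])
    finally show ?thesis by simp
  qed
  show "limsup (\<lambda>n. ereal (- ln (p n) / ln (real n))) = ereal (l / \<gamma>)"
    if l: "limsup (\<lambda>k. ereal (W k / real k)) = ereal l"
  proof -
    have "limsup (\<lambda>n. ereal (- ln (p n) / ln (real n))) =
        limsup (\<lambda>n. ereal (e n) + ereal (u n) * ereal (W (\<kappa> n) / real (\<kappa> n)))" by (rule Limsup_eq[OF eq])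
    also have "\<dots> = ereal 0 + limsup (\<lambda>n. ereal (u n) * ereal (W (\<kappa> n) / real (\<kappa> n)))"
      by (rule ereal_limsup_lim_add[OF e]) simp
    also have "\<dots> = ereal 0 + ereal (1 / \<gamma>) * limsup (\<lambda>n. ereal (W (\<kappa> n) / real (\<kappa> n)))"
      by (subst ereal_limsup_lim_mult[OF u \<gamma>']) auto
    also have "limsup (\<lambda>n. ereal (W (\<kappa> n) / real (\<kappa> n))) = ereal l"
      unfolding l[symmetric] by (rule limsup_reindex[OF \<kappa>_top \<nu>_top inv])
    finally show ?thesis by simp
  qed
qed

lemma liminf_limsup_real:
  fixes f :: "nat \<Rightarrow> real"
  assumes "\<And>k. 0 \<le> f k" "\<And>k. f k \<le> B"
  shows "\<exists>l. liminf (\<lambda>k. ereal (f k)) = ereal l" "\<exists>l. limsup (\<lambda>k. ereal (f k)) = ereal l"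
proof -
  have 1: "ereal 0 \<le> liminf (\<lambda>k. ereal (f k))" by (rule Liminf_bounded) (use assms in auto)
  have 2: "limsup (\<lambda>k. ereal (f k)) \<le> ereal B" by (rule Limsup_bounded) (use assms in auto)
  have 3: "liminf (\<lambda>k. ereal (f k)) \<le> limsup (\<lambda>k. ereal (f k))" by (rule Liminf_le_Limsup) simp
  show "\<exists>l. liminf (\<lambda>k. ereal (f k)) = ereal l"
    using 1 order_trans[OF 3 2] by (cases "liminf (\<lambda>k. ereal (f k))") auto
  show "\<exists>l. limsup (\<lambda>k. ereal (f k)) = ereal l"
    using 2 order_trans[OF 1 3] by (cases "limsup (\<lambda>k. ereal (f k))") auto
qed

section \<open>Exponents of the tree and of the walk\<close>

context resistance_partition
begin

lemma exp_ln_vol: "exp (ln (vol x k)) = vol x k"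
  using card_ball_pos[OF sc_pos, of x] by simp

text \<open>Doubling against the unit ball gives polynomial growth in the scale, so the limits of
  the rate are real numbers. At \<open>k = 0\<close> the quotient is 0 by convention.\<close>

lemma vol_rate_bounded: "\<exists>B. \<forall>k. 0 \<le> ln (vol x k) / real k \<and> ln (vol x k) / real k \<le> B"
proof -
  define B0 where "B0 = (1 + Cv) * real (card (ball x 1))"
  have c1: "real (card (ball x s)) \<ge> 1" if "s > 0" for s
    using card_ball_pos[OF that, of x] by linarith
  have B0: "B0 \<ge> 1" unfolding B0_def using mult_mono[of 1 "1 + Cv" 1 "real (card (ball x 1))"] Cv c1[of 1] by simp
  have lr: "- ln r > 0" using r by simp
  have "0 \<le> ln (vol x k) / real k \<and> ln (vol x k) / real k \<le> ln B0 + \<alpha> * (- ln r)" for k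
  proof (cases "k = 0")
    case True
    have "\<alpha> * (- ln r) \<ge> 0" by (rule mult_nonneg_nonneg[OF \<alpha> less_imp_le[OF lr]])
    moreover have "ln B0 \<ge> 0" using B0 by simp
    ultimately show ?thesis using True by simp
  next
    case False
    let ?q = "sc (- int k)"
    have q: "?q powr \<alpha> \<ge> 1" using sc_neg_ge1[of k] \<alpha> by (rule ge_one_powr_ge_zero)
    have "vol x k \<le> dbl ?q * real (card (ball x 1))" by (rule ball_compare) (auto simp: d_zero)
    also have "dbl ?q \<le> (1 + Cv) * ?q powr \<alpha>" using q by (simp add: dbl_def distrib_right)
    finally have "vol x k \<le> B0 * ?q powr \<alpha>" by (simp add: B0_def mult_right_mono mult_ac)
    then have "ln (vol x k) \<le> ln (B0 * ?q powr \<alpha>)" using c1[OF sc_pos, of "- int k"] by (intro ln_mono) auto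
    also have "\<dots> = ln B0 + \<alpha> * (real k * (- ln r))"
      using B0 q r by (subst ln_mult) (auto simp: ln_powr sc_def)
    finally have "ln (vol x k) / real k \<le> ln B0 / real k + \<alpha> * (- ln r)"
      using False by (simp add: field_simps)
    also have "ln B0 / real k \<le> ln B0"
      using divide_left_mono[of 1 "real k" "ln B0"] B0 False by simp
    finally show ?thesis using c1[OF sc_pos, of "- int k"] by simp
  qed
  then show ?thesis by blast
qed

lemma low_cell_Tr: "m \<le> - int H \<Longrightarrow> Orig (cellof m x) \<in> Tr"
  using cellof[of m x] level_low[of m] levD by blast

lemma N_low_eq:
  assumes "liminf (\<lambda>k. ereal (ln (vol x k) / real k)) = ereal l"
  shows "N_low K \<pi> r = ereal (exp l)"
proof (rule antisym)
  show "N_low K \<pi> r \<le> ereal (exp l)"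
    unfolding N_low_def
  proof (rule SUP_least)
    fix w assume "w \<in> Tr"
    then obtain C k0 where "C > 0" "\<And>k. k \<ge> k0 \<Longrightarrow>
        real (card (Sk K \<pi> r k {(pi_r \<pi> r ^^ k) w})) \<le> C * vol x k" using Sk_upper[of w x] by blast
    then show "liminf (\<lambda>k. ereal (real (card (Sk K \<pi> r k {(pi_r \<pi> r ^^ k) w})) powr (1 / real k))) \<le> ereal (exp l)"
      using liminf_root_le[OF _ _ assms, of C k0 _ 0] by (simp add: exp_ln_vol)
  qed
  obtain C k0 where "C > 0" "\<And>k. k \<ge> k0 \<Longrightarrow> C * vol x k \<le>
      real (card (Sk K \<pi> r k {(pi_r \<pi> r ^^ k) (Orig (cellof (- int H) x))}))"
    using Sk_lower[of "- int H" x] by auto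
  then show "ereal (exp l) \<le> N_low K \<pi> r"
    unfolding N_low_def using liminf_root_ge[OF _ _ assms, of C k0 0]
    by (intro SUP_upper2[OF low_cell_Tr[of "- int H" x]]) (auto simp: exp_ln_vol)
qed

lemma N_up_eq:
  assumes "limsup (\<lambda>k. ereal (ln (vol x k) / real k)) = ereal l"
  shows "N_up K \<pi> r = ereal (exp l)"
proof (rule antisym)
  show "N_up K \<pi> r \<le> ereal (exp l)"
    unfolding N_up_def
  proof (rule SUP_least)
    fix w assume "w \<in> Tr"
    then obtain C k0 where "C > 0" "\<And>k. k \<ge> k0 \<Longrightarrow>
        real (card (Sk K \<pi> r k {(pi_r \<pi> r ^^ k) w})) \<le> C * vol x k" using Sk_upper[of w x] by blast
    then show "limsup (\<lambda>k. ereal (real (card (Sk K \<pi> r k {(pi_r \<pi> r ^^ k) w})) powr (1 / real k))) \<le> ereal (exp l)"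
      using limsup_root_le[OF _ _ assms, of C k0 _ 0] by (simp add: exp_ln_vol)
  qed
  obtain C k0 where "C > 0" "\<And>k. k \<ge> k0 \<Longrightarrow> C * vol x k \<le>
      real (card (Sk K \<pi> r k {(pi_r \<pi> r ^^ k) (Orig (cellof (- int H) x))}))"
    using Sk_lower[of "- int H" x] by auto
  then show "ereal (exp l) \<le> N_up K \<pi> r"
    unfolding N_up_def using limsup_root_ge[OF _ _ assms, of C k0 0]
    by (intro SUP_upper2[OF low_cell_Tr[of "- int H" x]]) (auto simp: exp_ln_vol)
qed

lemma R_low_eq:
  assumes "liminf (\<lambda>k. ereal (ln (vol x k) / real k)) = ereal l"
  shows "\<exists>M. \<forall>N2\<ge>M. \<forall>N\<ge>1. R_low K \<pi> \<phi> r pm 2 N1 N2 N = ereal (exp (l + \<beta> * ln r))"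
proof -
  have rb: "exp (\<beta> * ln r) = r powr \<beta>" using r by (simp add: powr_def)
  obtain M where up: "\<And>N2 N w. N2 \<ge> M \<Longrightarrow> w \<in> Tr \<Longrightarrow> \<exists>C>0. \<exists>k0. \<forall>k\<ge>k0.
      cap k ((pi_r \<pi> r ^^ k) w) N1 N2 N \<le> ennreal (C * vol x k * (r powr \<beta>) ^ k)"
    using cap_upper[of N1 x] by blast
  have "R_low K \<pi> \<phi> r pm 2 N1 N2 N = ereal (exp (l + \<beta> * ln r))" if N: "N2 \<ge> M" "N \<ge> 1" for N2 N
  proof (rule antisym)
    show "R_low K \<pi> \<phi> r pm 2 N1 N2 N \<le> ereal (exp (l + \<beta> * ln r))"
      unfolding R_low_def
    proof (rule SUP_least)
      fix w assume "w \<in> Tr"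
      then obtain C k0 where C: "C > 0" "\<And>k. k \<ge> k0 \<Longrightarrow>
          cap k ((pi_r \<pi> r ^^ k) w) N1 N2 N \<le> ennreal (C * vol x k * (r powr \<beta>) ^ k)"
        using up[OF N(1), of w N] by blast
      have "enn2real (cap k ((pi_r \<pi> r ^^ k) w) N1 N2 N) \<le> C * vol x k * (r powr \<beta>) ^ k" if "k \<ge> k0" for k
        using C(1) by (intro enn2real_leI C(2)[OF that]) auto
      then show "liminf (\<lambda>k. ereal (Ep K \<pi> \<phi> r pm 2 k ((pi_r \<pi> r ^^ k) w) N1 N2 N powr (1 / real k)))
          \<le> ereal (exp (l + \<beta> * ln r))"
        unfolding Ep_eq by (intro liminf_root_le[OF C(1) _ assms, of k0]) (auto simp: exp_ln_vol rb)
    qed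
    let ?w = "Orig (cellof (- int H) x)"
    obtain C k0 where C: "C > 0" "\<And>k. k \<ge> k0 \<Longrightarrow>
        ennreal (C * vol x k * (r powr \<beta>) ^ k) \<le> cap k ((pi_r \<pi> r ^^ k) ?w) N1 N2 N"
      using cap_lower[of "- int H" N x N1 N2] N(2) by auto
    \<comment> \<open>The upper estimate makes the capacity finite, without which the lower bound
      would not pass through \<open>enn2real\<close>.\<close>
    obtain C' k1 where C': "\<And>k. k \<ge> k1 \<Longrightarrow>
        cap k ((pi_r \<pi> r ^^ k) ?w) N1 N2 N \<le> ennreal (C' * vol x k * (r powr \<beta>) ^ k)"
      using up[OF N(1) low_cell_Tr[of "- int H" x], of N] by auto
    have "C * vol x k * (r powr \<beta>) ^ k \<le> enn2real (cap k ((pi_r \<pi> r ^^ k) ?w) N1 N2 N)"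
      if "k \<ge> max k0 k1" for k
    proof -
      have "cap k ((pi_r \<pi> r ^^ k) ?w) N1 N2 N < top"
        using C'[of k] that by (meson ennreal_less_top le_less_trans max.bounded_iff)
      then have "enn2real (ennreal (C * vol x k * (r powr \<beta>) ^ k)) \<le> enn2real (cap k ((pi_r \<pi> r ^^ k) ?w) N1 N2 N)"
        using C(2)[of k] that by (intro enn2real_mono) auto
      then show ?thesis using C(1) by simp
    qed
    then have "ereal (exp (l + \<beta> * ln r)) \<le>
        liminf (\<lambda>k. ereal (Ep K \<pi> \<phi> r pm 2 k ((pi_r \<pi> r ^^ k) ?w) N1 N2 N powr (1 / real k)))"
      unfolding Ep_eq by (intro liminf_root_ge[OF C(1) _ assms, of "max k0 k1"]) (auto simp: exp_ln_vol rb)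
    then show "ereal (exp (l + \<beta> * ln r)) \<le> R_low K \<pi> \<phi> r pm 2 N1 N2 N"
      unfolding R_low_def by (rule SUP_upper2[OF low_cell_Tr[of "- int H" x], rotated]) simp
  qed
  then show ?thesis by blast
qed

text \<open>The choice of \<open>k\<close> puts the radius \<open>n powr (1 / \<beta>)\<close>
  between \<open>sc (- int k)\<close> and \<open>sc (- int k) / r\<close>, so the ball in the heat
  kernel bound has volume comparable to \<open>vol y k\<close>. Allowing \<open>x\<close> and
  \<open>y\<close> to differ makes the spectral dimensions independent of the vertex.\<close>

lemma return_probability_rate:
  assumes \<beta>: "\<beta> > 0" and c: "c1 > 0"
    and p: "\<And>n::nat. n \<ge> 1 \<Longrightarrow> c1 \<le> p n * real (card (ball x (real n powr (1 / \<beta>)))) \<and>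
      p n * real (card (ball x (real n powr (1 / \<beta>)))) \<le> c2"
  shows "\<exists>C. \<forall>n\<ge>2. \<bar>- ln (p n) - ln (vol y (nat \<lfloor>ln (real n) / (- \<beta> * ln r)\<rfloor>))\<bar> \<le> C"
proof -
  define \<gamma> where "\<gamma> = - \<beta> * ln r"
  have lr: "ln r < 0" using r by simp
  have \<gamma>: "\<gamma> > 0" using \<beta> lr by (simp add: \<gamma>_def mult_pos_neg)
  obtain C2 where C2: "C2 > 0"
    "\<And>k. real (card (ball x (1 / r * sc (- int k)))) \<le> C2 * real (card (ball y (1 * sc (- int k))))"
    using vol_compare[of "1 / r" 1 x y] r by auto
  obtain C3 where C3: "C3 > 0"
    "\<And>k. real (card (ball y (1 * sc (- int k)))) \<le> C3 * real (card (ball x (1 * sc (- int k))))"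
    using vol_compare[of 1 1 y x] by auto
  have "\<bar>- ln (p n) - ln (vol y (nat \<lfloor>ln (real n) / \<gamma>\<rfloor>))\<bar> \<le> \<bar>ln c1\<bar> + \<bar>ln c2\<bar> + \<bar>ln C2\<bar> + \<bar>ln C3\<bar>"
    if n: "n \<ge> 2" for n :: nat
  proof -
    define k where "k = nat \<lfloor>ln (real n) / \<gamma>\<rfloor>"
    define s where "s = real n powr (1 / \<beta>)"
    define b where "b = real (card (ball x s))"
    have s: "s > 0" using n by (simp add: s_def)
    have b: "b > 0" unfolding b_def using card_ball_pos[OF s, of x] by simp
    have "ln (real n) / \<gamma> \<ge> 0" using n \<gamma> by simp
    then have "real k \<le> ln (real n) / \<gamma>" "ln (real n) / \<gamma> < real k + 1" unfolding k_def by linarith+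
    then have "real k * \<gamma> \<le> ln (real n)" "ln (real n) < (real k + 1) * \<gamma>"
      using \<gamma> by (auto simp: field_simps)
    then have k: "real k * (- ln r) \<le> ln (real n) / \<beta>" "ln (real n) / \<beta> < (real k + 1) * (- ln r)"
      using \<beta> by (auto simp: \<gamma>_def field_simps)
    have s_exp: "s = exp (ln (real n) / \<beta>)" using n by (simp add: s_def powr_def)
    have sc_exp: "sc (- int k) = exp (real k * (- ln r))" using r by (simp add: sc_def powr_def)
    have lo: "1 * sc (- int k) \<le> s" unfolding s_exp sc_exp using k(1) by simp
    have "s < exp ((real k + 1) * (- ln r))" unfolding s_exp using k(2) by simp
    also have "\<dots> = 1 / r * sc (- int k)"
    proof -
      have "exp (- ln r) = 1 / r" using r by (simp add: exp_minus inverse_eq_divide)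
      then show ?thesis unfolding sc_exp distrib_right exp_add by simp
    qed
    finally have hi: "s \<le> 1 / r * sc (- int k)" by simp
    have "b \<le> real (card (ball x (1 / r * sc (- int k))))"
      unfolding b_def using hi by (intro of_nat_mono card_mono finite_ball ball_subset) (simp add: d_zero)
    also have "\<dots> \<le> C2 * vol y k" using C2(2)[of k] by simp
    finally have u: "b \<le> C2 * vol y k" .
    have "vol y k \<le> C3 * real (card (ball x (1 * sc (- int k))))" using C3(2)[of k] by simp
    also have "\<dots> \<le> C3 * b"
      unfolding b_def using lo C3(1) by (intro mult_left_mono of_nat_mono card_mono finite_ball ball_subset) (auto simp: d_zero)
    finally have l: "vol y k \<le> C3 * b" .
    have v: "vol y k > 0" using card_ball_pos[OF sc_pos, of y] by simp
    have pb: "c1 \<le> p n * b" "p n * b \<le> c2" using p[of n] n by (auto simp: b_def s_def)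
    have p0: "p n > 0" using pb(1) c b by (smt (verit) mult_nonpos_nonneg)
    have "ln c1 \<le> ln (p n * b)" "ln (p n * b) \<le> ln c2" using pb c by (auto intro!: ln_mono)
    then have 1: "ln c1 \<le> ln (p n) + ln b" "ln (p n) + ln b \<le> ln c2" using p0 b by (auto simp: ln_mult)
    have "ln b \<le> ln (C2 * vol y k)" using u b by (intro ln_mono) auto
    then have 2: "ln b \<le> ln C2 + ln (vol y k)" using C2(1) v by (simp add: ln_mult)
    have "ln (vol y k) \<le> ln (C3 * b)" using l v by (intro ln_mono) auto
    then have 3: "ln (vol y k) \<le> ln C3 + ln b" using C3(1) b by (simp add: ln_mult)
    show ?thesis using 1 2 3 unfolding k_def[symmetric] by linarith
  qed
  then show ?thesis unfolding \<gamma>_def by blast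
qed

end

section \<open>From weighted volumes and resistances to cardinalities and Dirichlet sums\<close>

lemma ennreal_resistance_ge:
  assumes "ennreal a \<le> inverse I * ennreal v" "a > 0" "v \<ge> 0"
  shows "I \<le> ennreal (v / a)"
proof (cases I)
  case (real t)
  show ?thesis
  proof (cases "t = 0")
    case False
    then have t: "t > 0" using real by simp
    then have "inverse I * ennreal v = ennreal (inverse t * v)"
      using assms(3) real by (simp add: inverse_ennreal ennreal_mult)
    then have "a \<le> inverse t * v" using assms(1,3) t by (simp add: ennreal_le_iff)
    then have "t \<le> v / a" using t assms(2) by (simp add: field_simps)
    then show ?thesis using real by (simp add: ennreal_leI)
  qed (use real in simp)
next
  case top
  then show ?thesis using assms by (simp add: ennreal_eq_0_iff)
qed

text \<open>A zero infimum would mean infinite resistance; positivity of \<open>v\<close> excludes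
  it, since the product would then be infinite as well.\<close>

lemma ennreal_resistance_le:
  assumes "inverse I * ennreal v \<le> ennreal a" "a > 0" "v > 0"
  shows "ennreal (v / a) \<le> I"
proof (cases I)
  case (real t)
  have "t \<noteq> 0"
  proof
    assume "t = 0"
    then have "inverse I * ennreal v = top" using real assms(3) by (simp add: ennreal_top_mult ennreal_eq_0_iff)
    then show False using assms(1) by (simp add: top_unique)
  qed
  then have t: "t > 0" using real by simp
  then have "inverse I * ennreal v = ennreal (inverse t * v)"
    using assms(3) real by (simp add: inverse_ennreal ennreal_mult)
  then have "inverse t * v \<le> a" using assms by (simp add: ennreal_le_iff)
  then have "v / a \<le> t" using t assms(2) by (simp add: field_simps)
  then show ?thesis using real by (simp add: ennreal_leI)
qed simp

lemma infsum_ennreal_le_mult: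
  fixes a b :: "'i \<Rightarrow> ennreal"
  assumes "\<And>i. i \<in> I \<Longrightarrow> b i \<le> c * a i"
  shows "infsum b I \<le> c * infsum a I"
proof -
  have "infsum b I \<le> c * of_nat 1 * infsum a I"
  proof (rule infsum_ennreal_le_multiplicity[where P = "\<lambda>i. {i}"])
    fix j assume "j \<in> I"
    then have "{i \<in> I. j \<in> {i}} = {j}" by auto
    then show "finite {i \<in> I. j \<in> {i}} \<and> card {i \<in> I. j \<in> {i}} \<le> 1" by simp
  qed (use assms in auto)
  then show ?thesis by simp
qed

lemma
  assumes c: "c > 0" and mu: "\<And>x y. adj x y \<Longrightarrow> c \<le> mu x y \<and> mu x y \<le> 1 / c"
  shows dirichlet_le_energy: "dirichlet_sum adj F \<le> ennreal (2 / c) * energy adj mu F"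
    and energy_le_dirichlet: "energy adj mu F \<le> ennreal (1 / c) * dirichlet_sum adj F"
proof -
  define S where "S = infsum (\<lambda>(x, y). ennreal ((F x - F y)\<^sup>2 * mu x y)) {(x, y). adj x y}"
  have en: "energy adj mu F = S / 2" by (simp add: energy_def S_def)
  have "dirichlet_sum adj F \<le> ennreal (1 / c) * S"
    unfolding dirichlet_sum_def S_def
  proof (rule infsum_ennreal_le_mult, clarsimp)
    fix x y assume "adj x y"
    then have "(F x - F y)\<^sup>2 * c \<le> (F x - F y)\<^sup>2 * mu x y" using mu by (intro mult_left_mono) auto
    then have "(F x - F y)\<^sup>2 \<le> 1 / c * ((F x - F y)\<^sup>2 * mu x y)" using c by (simp add: field_simps)
    then have "ennreal ((F x - F y)\<^sup>2) \<le> ennreal (1 / c * ((F x - F y)\<^sup>2 * mu x y))" by (rule ennreal_leI)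
    also have "\<dots> = ennreal (1 / c) * ennreal ((F x - F y)\<^sup>2 * mu x y)" using c by (intro ennreal_mult') simp
    finally show "ennreal ((F x - F y)\<^sup>2) \<le> ennreal (1 / c) * ennreal ((F x - F y)\<^sup>2 * mu x y)" .
  qed
  also have "S = 2 * (S / 2)"
    by (cases S) (auto simp: divide_ennreal[of _ 2, simplified] ennreal_mult[symmetric, of 2, simplified] ennreal_top_divide ennreal_mult_top)
  also have "ennreal (1 / c) * (2 * (S / 2)) = ennreal (2 / c) * (S / 2)"
  proof -
    have "ennreal (1 / c) * 2 = ennreal (1 / c * 2)" using c by (subst ennreal_mult) auto
    then show ?thesis by (simp add: mult.assoc[symmetric])
  qed
  finally show "dirichlet_sum adj F \<le> ennreal (2 / c) * energy adj mu F" unfolding en .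
  have "S \<le> ennreal (1 / c) * dirichlet_sum adj F"
    unfolding dirichlet_sum_def S_def
  proof (rule infsum_ennreal_le_mult, clarsimp)
    fix x y assume "adj x y"
    then have "(F x - F y)\<^sup>2 * mu x y \<le> (F x - F y)\<^sup>2 * (1 / c)" using mu by (intro mult_left_mono) auto
    then have "ennreal ((F x - F y)\<^sup>2 * mu x y) \<le> ennreal (1 / c * (F x - F y)\<^sup>2)"
      by (intro ennreal_leI) (simp add: mult.commute)
    also have "\<dots> = ennreal (1 / c) * ennreal ((F x - F y)\<^sup>2)" using c by (intro ennreal_mult') simp
    finally show "ennreal ((F x - F y)\<^sup>2 * mu x y) \<le> ennreal (1 / c) * ennreal ((F x - F y)\<^sup>2)" .
  qed
  then show "energy adj mu F \<le> ennreal (1 / c) * dirichlet_sum adj F"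
    unfolding en using ennreal_half_le order_trans by blast
qed

text \<open>Vertex weights are at least \<open>c\<close>, so infinitely many vertices would have
  infinite volume.\<close>

lemma finite_ball_Vd:
  assumes "c > 0" "\<And>y. c \<le> mux adj mu y" "Vd adj mu d x s < top"
  shows "finite (dball d x s)"
proof (rule ccontr)
  assume inf: "infinite (dball d x s)"
  obtain V where V: "Vd adj mu d x s = ennreal V" "V \<ge> 0" using assms(3) by (cases "Vd adj mu d x s") auto
  obtain n :: nat where n: "V / c < real n" using reals_Archimedean2 by blast
  obtain A where A: "A \<subseteq> dball d x s" "finite A" "card A = n" using infinite_arbitrarily_large[OF inf] by blast
  have "ennreal (real n * c) = (\<Sum>y\<in>A. ennreal c)"
    using A(3) assms(1) by (simp add: ennreal_mult ennreal_of_nat_eq_real_of_nat)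
  also have "\<dots> \<le> (\<Sum>y\<in>A. ennreal (mux adj mu y))" by (intro sum_mono ennreal_leI assms(2))
  also have "\<dots> \<le> Vd adj mu d x s"
    unfolding Vd_def muset_def using A by (subst nonneg_infsum_complete) (auto intro: SUP_upper)
  finally have "real n * c \<le> V" using V by (simp add: ennreal_le_iff)
  then show False using n assms(1) by (simp add: field_simps)
qed

lemma Vd_finite_ball:
  assumes "c1 > 0" "\<And>y. c1 \<le> mux adj mu y \<and> mux adj mu y \<le> c2" "finite (dball d x s)"
  shows "\<exists>v. Vd adj mu d x s = ennreal v \<and> c1 * real (card (dball d x s)) \<le> v \<and> v \<le> c2 * real (card (dball d x s))"
proof -
  have pos: "mux adj mu y \<ge> 0" for y using assms(1,2) by (meson less_imp_le order_trans)
  define v where "v = (\<Sum>y\<in>dball d x s. mux adj mu y)"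
  have "Vd adj mu d x s = ennreal v"
    unfolding Vd_def muset_def v_def using assms(3) pos by (simp add: infsum_finite sum_ennreal)
  moreover have "real (card (dball d x s)) * c1 \<le> v"
    unfolding v_def by (rule sum_bounded_below) (use assms(2) in auto)
  moreover have "v \<le> real (card (dball d x s)) * c2"
    unfolding v_def by (rule sum_bounded_above) (use assms(2) in auto)
  ultimately show ?thesis by (auto simp: mult.commute)
qed

text \<open>The growth quantities and spectral dimensions live in \<open>ereal\<close>; exhibiting
  them as reals gives meaning to the logarithms and the quotient. The threshold \<open>M\<close>
  depends on \<open>N1\<close> but not on \<open>N\<close>, and one set of reals serves all vertices
  \<open>x\<close>.\<close>

theorem theorem4p2:
  fixes adj :: "'a \<Rightarrow> 'a \<Rightarrow> bool" and mu :: "'a \<Rightarrow> 'a \<Rightarrow> real"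
    and K :: "'t \<Rightarrow> 'a set" and \<pi> :: "'t \<Rightarrow> 't" and \<phi> :: 't
    and d :: "'a \<Rightarrow> 'a \<Rightarrow> real" and r :: real and pm :: "'t \<Rightarrow> 'a \<times> 'a"
    and \<alpha> \<beta> :: real
  assumes G: "countable (UNIV :: 'a set)" "infinite (UNIV :: 'a set)"
      "simple_graph adj" "graph_connected adj" "bounded_degree adj"
    and mu: "conductance adj mu" "\<exists>c>0. \<forall>x y. adj x y \<longrightarrow> c \<le> mu x y \<and> mu x y \<le> 1 / c"
    and T: "bi_infinite_tree \<pi>"
    and K: "is_partition adj K \<pi> \<phi>" "minimal_partition K \<pi>" "connected_partition adj K \<pi>"
    and d: "is_metric d" "infinite_diam d" "fits adj d" "basic_framework d K \<pi> \<phi> r"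
    and pm: "\<forall>w\<in>Lam_e K \<pi>. K w = {fst (pm w), snd (pm w)}"
    and ab: "1 \<le> \<alpha>" "\<alpha> < \<beta>"
    and dE: "\<exists>c>0. \<forall>x y. adj x y \<longrightarrow> c \<le> d x y \<and> d x y \<le> 1 / c"
    and HK: "\<exists>c>0. \<forall>x. \<forall>n::nat. n \<ge> 1 \<longrightarrow>
              ennreal c \<le> ennreal (hk adj mu (2 * n) x x) * Vd adj mu d x (real n powr (1 / \<beta>)) \<and>
              ennreal (hk adj mu (2 * n) x x) * Vd adj mu d x (real n powr (1 / \<beta>)) \<le> ennreal (1 / c)"
    and RL: "\<exists>lam>0. \<exists>C>0. \<forall>x s. s > rx d x \<longrightarrow>
              ennreal (C * s powr \<beta>) \<le>
                Reff adj mu (dball d x (lam * s)) (- dball d x s) * Vd adj mu d x s"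
    and RU: "\<exists>C'>0. \<forall>x s. s > rx d x \<longrightarrow>
              Reff adj mu {x} (- dball d x s) * Vd adj mu d x s \<le> ennreal (C' * s powr \<beta>)"
    and VD: "\<exists>C''>0. \<forall>x s t. 0 < t \<and> t < s \<longrightarrow>
              Vd adj mu d x s \<le> ennreal (C'' * (s / t) powr \<alpha>) * Vd adj mu d x t"
  shows "\<forall>N1::nat. \<exists>M::nat. \<forall>N2\<ge>M. \<forall>N::nat. N \<ge> 1 \<longrightarrow>
           (\<exists>nl nu rl :: real.
              N_low K \<pi> r = ereal nl \<and> N_up K \<pi> r = ereal nu \<and>
              R_low K \<pi> \<phi> r pm 2 N1 N2 N = ereal rl \<and>
              (\<forall>x. dS_low adj mu x = ereal (2 * ln nl / (ln nl - ln rl)) \<and>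
                   dS_up adj mu x = ereal (2 * ln nu / (ln nl - ln rl))))"
proof -
  obtain D where D: "\<And>x. finite {y. adj x y}" "\<And>x. card {y. adj x y} \<le> D"
    using G(5) by (auto simp: bounded_degree_def)
  obtain c0 where c0: "c0 > 0" "\<And>x y. adj x y \<Longrightarrow> c0 \<le> mu x y \<and> mu x y \<le> 1 / c0" using mu(2) by blast
  obtain e0 where e0: "e0 > 0" "\<And>x y. adj x y \<Longrightarrow> e0 \<le> d x y \<and> d x y \<le> 1 / e0" using dE by blast
  note bf = d(4)[unfolded basic_framework_def, THEN conjunct2, THEN conjunct2]
  note bf' = bf[THEN conjunct2, THEN conjunct2]
  obtain tk where tk: "tk > 0"
    "\<And>w. w \<in> T_e K \<pi> \<Longrightarrow> \<exists>x\<in>K w. Lam_sM_pt d K \<pi> (tk * gd d K (\<pi> w)) 1 x \<subseteq> subtree \<pi> w"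
    using bf[THEN conjunct1] by blast
  obtain Ma a1 a2 where ad: "a1 > 0" "a2 > 0"
    "\<And>x s. s > 0 \<Longrightarrow> dball d x (a1 * s) \<subseteq> U_M d K \<pi> Ma x s \<and> U_M d K \<pi> Ma x s \<subseteq> dball d x (a2 * s)"
    using bf[THEN conjunct2, THEN conjunct1] by blast
  have r: "0 < r" "r < 1" using bf' by blast+
  obtain cg where cg: "cg > 0" "\<And>w. w \<in> T_e K \<pi> \<Longrightarrow>
      cg * r powr (real_of_int (height \<pi> \<phi> w)) \<le> gd d K w \<and>
      gd d K w \<le> r powr (real_of_int (height \<pi> \<phi> w)) / cg"
    using bf'[THEN conjunct2, THEN conjunct2] by blast
  interpret graph_partition adj K \<pi> \<phi> D
  proof
    show "adj x y \<Longrightarrow> adj y x" "\<not> adj x x" for x y using G(3) by (auto simp: simple_graph_def)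
    show "adj\<^sup>*\<^sup>* x y" for x y using G(4) by (simp add: graph_connected_def)
    show "K w \<noteq> {}" if "w \<in> T_e K \<pi>" for w using tk(2)[OF that] by blast
  qed (use G D T K in auto)
  have metric: "d x y \<ge> 0" "d x x = 0" "d x y = d y x" "d x z \<le> d x y + d y z" for x y z
    using d(1) unfolding is_metric_def by blast+

  \<comment> \<open>Separation of vertices and bounds on vertex weights\<close>
  obtain C1 where C1: "C1 > 0" "\<And>x y z. adj x y \<Longrightarrow> x \<noteq> z \<Longrightarrow> d x y \<le> C1 * d x z"
    using d(3)[unfolded fits_def, THEN conjunct1] by blast
  define \<delta> where "\<delta> = e0 / C1"
  have \<delta>: "\<delta> > 0" using e0 C1 by (simp add: \<delta>_def)
  have sep: "\<delta> \<le> d x z" if xz: "x \<noteq> z" for x z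
  proof -
    obtain y where y: "adj x y" using neighbour_exists by blast
    have "e0 \<le> C1 * d x z" using e0(2)[OF y] C1(2)[OF y xz] by linarith
    then show ?thesis using C1(1) by (simp add: \<delta>_def field_simps)
  qed

  define m2 where "m2 = real D / c0"
  have mux: "c0 \<le> mux adj mu y \<and> mux adj mu y \<le> m2" for y
  proof
    obtain z where z: "adj y z" using neighbour_exists by blast
    have "c0 \<le> mu y z" using c0(2)[OF z] by blast
    also have "\<dots> \<le> mux adj mu y"
      unfolding mux_def using z D(1) by (intro member_le_sum) (auto dest!: c0(2) intro: order_trans[OF less_imp_le[OF c0(1)]])
    finally show "c0 \<le> mux adj mu y" .
    have "mux adj mu y \<le> real (card {z. adj y z}) * (1 / c0)"
      unfolding mux_def by (rule sum_bounded_above) (use c0(2) in auto)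
    also have "\<dots> \<le> real D * (1 / c0)" using D(2)[of y] c0(1) by (intro mult_right_mono) auto
    finally show "mux adj mu y \<le> m2" by (simp add: m2_def)
  qed
  have m2: "m2 > 0" using mux c0(1) by (meson less_le_trans order_trans)

  \<comment> \<open>Finiteness of balls and doubling for cardinalities\<close>
  obtain C2 where C2: "C2 > 0" "\<And>x s t. 0 < t \<Longrightarrow> t < s \<Longrightarrow>
      Vd adj mu d x s \<le> ennreal (C2 * (s / t) powr \<alpha>) * Vd adj mu d x t"
    using VD by blast
  \<comment> \<open>A ball of radius at most \<open>\<delta>\<close> is one vertex of finite weight;
    the volume growth hypothesis then bounds the volume of every larger ball, and the lower bound
    \<open>c0\<close> on weights its cardinality.\<close>
  have fin: "finite (dball d x s)" for x s
  proof (cases "s > 0")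
    case True
    define t where "t = min \<delta> (s / 2)"
    have t: "0 < t" "t < s" "t \<le> \<delta>" using True \<delta> by (auto simp: t_def)
    have "dball d x t = {x}"
    proof
      show "dball d x t \<subseteq> {x}" using sep[of x] t(3) by (force simp: dball_def)
      show "{x} \<subseteq> dball d x t" using t(1) metric(2) by (simp add: dball_def)
    qed
    then have "Vd adj mu d x t = ennreal (mux adj mu x)" by (simp add: Vd_def muset_def)
    then have "Vd adj mu d x s \<le> ennreal (C2 * (s / t) powr \<alpha>) * ennreal (mux adj mu x)"
      using C2(2)[OF t(1,2), of x] by simp
    also have "\<dots> < top" by (simp add: ennreal_mult_less_top)
    finally show ?thesis by (rule finite_ball_Vd[OF c0(1) conjunct1[OF mux]])
  next
    case False
    then have "\<not> d x y < s" for y using metric(1)[of x y] by linarith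
    then show ?thesis by (simp add: dball_def)
  qed
  define v where "v x s = (SOME v. Vd adj mu d x s = ennreal v \<and>
      c0 * real (card (dball d x s)) \<le> v \<and> v \<le> m2 * real (card (dball d x s)))" for x s
  have v: "Vd adj mu d x s = ennreal (v x s)" "c0 * real (card (dball d x s)) \<le> v x s"
    "v x s \<le> m2 * real (card (dball d x s))" for x s
    using someI_ex[OF Vd_finite_ball[OF c0(1) mux fin[of x s]]] unfolding v_def by blast+
  have v0: "v x s \<ge> 0" for x s using v(2)[of x s] c0(1) by (meson less_imp_le mult_nonneg_nonneg of_nat_0_le_iff order_trans)
  have card_pos: "real (card (dball d x s)) > 0" if "s > 0" for x s
  proof -
    have "x \<in> dball d x s" using that metric(2) by (simp add: dball_def)
    then have "card (dball d x s) > 0" using fin card_gt_0_iff by blast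
    then show ?thesis by simp
  qed
  have vpos: "v x s > 0" if "s > 0" for x s
    using v(2)[of x s] mult_pos_pos[OF c0(1) card_pos[OF that, of x]] by linarith
  have doubling: "real (card (dball d x s)) \<le> C2 * m2 / c0 * (s / t) powr \<alpha> * real (card (dball d x t))"
    if st: "0 < t" "t < s" for x s t
  proof -
    have "ennreal (v x s) \<le> ennreal (C2 * (s / t) powr \<alpha> * v x t)"
      using C2(2)[OF st, of x] C2(1) v0 unfolding v(1) by (subst ennreal_mult) auto
    then have "v x s \<le> C2 * (s / t) powr \<alpha> * v x t" using C2(1) v0 by (simp add: ennreal_le_iff)
    also have "\<dots> \<le> C2 * (s / t) powr \<alpha> * (m2 * real (card (dball d x t)))"
      using C2(1) v(3) by (intro mult_left_mono) auto
    finally have "c0 * real (card (dball d x s)) \<le> C2 * (s / t) powr \<alpha> * (m2 * real (card (dball d x t)))"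
      using v(2)[of x s] by linarith
    then show ?thesis using c0(1) by (simp add: field_simps)
  qed

  \<comment> \<open>Resistance estimates as bounds on Dirichlet sums\<close>
  define s0 where "s0 = 1 / e0 + 1"
  have s0: "s0 > 0" using e0(1) by (simp add: s0_def add_pos_pos)
  \<comment> \<open>A neighbour of \<open>x\<close> lies within \<open>1 / e0\<close>, so both
    resistance hypotheses apply from radius \<open>s0\<close> on, uniformly in
    \<open>x\<close>.\<close>
  have rx: "rx d x < s" if "s \<ge> s0" for x s
  proof -
    obtain y where y: "adj x y" using neighbour_exists by blast
    then have "y \<noteq> x" using adj_irrefl by blast
    then have "rx d x \<le> d x y"
      unfolding rx_def by (intro cInf_lower) (auto intro!: bdd_belowI[of _ 0] metric(1))
    then show ?thesis using e0(2)[OF y] that by (simp add: s0_def)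
  qed
  obtain lam C3 where C3: "lam > 0" "C3 > 0" "\<And>x s. s > rx d x \<Longrightarrow> ennreal (C3 * s powr \<beta>) \<le>
      Reff adj mu (dball d x (lam * s)) (- dball d x s) * Vd adj mu d x s" using RL by blast
  obtain C4 where C4: "C4 > 0" "\<And>x s. s > rx d x \<Longrightarrow>
      Reff adj mu {x} (- dball d x s) * Vd adj mu d x s \<le> ennreal (C4 * s powr \<beta>)" using RU by blast
  define CL where "CL = 4 * m2 / (c0 * C3)"
  define CU where "CU = c0 * c0 / C4"
  have CL: "CL > 0" and CU: "CU > 0" using m2 c0 C3 C4 by (auto simp: CL_def CU_def)

  have cap_le: "\<exists>F. (\<forall>y\<in>dball d x (lam * s). F y = 1) \<and> (\<forall>y. y \<notin> dball d x s \<longrightarrow> F y = 0) \<and>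
      dirichlet_sum adj F \<le> ennreal (CL * real (card (dball d x s)) / s powr \<beta>)" if s: "s \<ge> s0" for x s
  proof -
    have sp: "s > 0" using s s0 by linarith
    have a: "C3 * s powr \<beta> > 0" using C3(2) sp by simp
    define FF where "FF = {f. (\<forall>x\<in>dball d x (lam * s). f x = (1::real)) \<and> (\<forall>x\<in>- dball d x s. f x = 0)}"
    have "(INF f\<in>FF. energy adj mu f) \<le> ennreal (v x s / (C3 * s powr \<beta>))"
      using ennreal_resistance_ge[OF _ a v0] C3(3)[OF rx[OF s], of x] unfolding Reff_def v(1) FF_def by blast
    \<comment> \<open>The infimum need not be attained. Doubling the positive bound makes the
      inequality strict and yields an admissible function below it.\<close>
    also have "\<dots> < ennreal (2 * v x s / (C3 * s powr \<beta>))"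
      using vpos[OF sp, of x] a by (intro ennreal_lessI) (auto simp: field_simps)
    finally obtain F where F: "F \<in> FF" "energy adj mu F < ennreal (2 * v x s / (C3 * s powr \<beta>))"
      by (auto simp: INF_less_iff)
    have "dirichlet_sum adj F \<le> ennreal (2 / c0) * energy adj mu F" by (rule dirichlet_le_energy[OF c0])
    also have "\<dots> \<le> ennreal (2 / c0) * ennreal (2 * v x s / (C3 * s powr \<beta>))"
      using F(2) by (intro mult_left_mono) auto
    also have "\<dots> = ennreal (2 / c0 * (2 * v x s / (C3 * s powr \<beta>)))"
      using c0(1) by (intro ennreal_mult'[symmetric]) simp
    also have "\<dots> \<le> ennreal (CL * real (card (dball d x s)) / s powr \<beta>)"
    proof (rule ennreal_leI)
      have "2 / c0 * (2 * v x s / (C3 * s powr \<beta>)) = 4 / (c0 * C3 * s powr \<beta>) * v x s" by simp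
      also have "\<dots> \<le> 4 / (c0 * C3 * s powr \<beta>) * (m2 * real (card (dball d x s)))"
        using c0(1) C3(2) by (intro mult_left_mono v(3)) auto
      finally show "2 / c0 * (2 * v x s / (C3 * s powr \<beta>)) \<le> CL * real (card (dball d x s)) / s powr \<beta>"
        by (simp add: CL_def)
    qed
    finally show ?thesis using F(1) unfolding FF_def by (intro exI[of _ F]) auto
  qed
  have cap_ge: "ennreal (CU * real (card (dball d x s)) / s powr \<beta>) \<le> dirichlet_sum adj F"
    if s: "s \<ge> s0" and F: "F x = 1" "\<And>y. y \<notin> dball d x s \<Longrightarrow> F y = 0" for x s F
  proof -
    have sp: "s > 0" using s s0 by linarith
    have a: "C4 * s powr \<beta> > 0" using C4(1) sp by simp
    define I where "I = (INF f\<in>{f. (\<forall>x\<in>{x}. f x = (1::real)) \<and> (\<forall>x\<in>- dball d x s. f x = 0)}. energy adj mu f)"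
    have "ennreal (v x s / (C4 * s powr \<beta>)) \<le> I"
      using ennreal_resistance_le[OF _ a vpos[OF sp]] C4(2)[OF rx[OF s], of x] unfolding Reff_def v(1) I_def by blast
    also have "\<dots> \<le> energy adj mu F" unfolding I_def by (rule INF_lower) (use F in auto)
    also have "\<dots> \<le> ennreal (1 / c0) * dirichlet_sum adj F" by (rule energy_le_dirichlet[OF c0])
    finally have le: "ennreal (v x s / (C4 * s powr \<beta>)) \<le> ennreal (1 / c0) * dirichlet_sum adj F" .
    have "ennreal (CU * real (card (dball d x s)) / s powr \<beta>) \<le> ennreal (c0 * (v x s / (C4 * s powr \<beta>)))"
    proof (rule ennreal_leI)
      have "CU * real (card (dball d x s)) / s powr \<beta> = c0 / (C4 * s powr \<beta>) * (c0 * real (card (dball d x s)))"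
        by (simp add: CU_def)
      also have "\<dots> \<le> c0 / (C4 * s powr \<beta>) * v x s" using c0(1) C4(1) by (intro mult_left_mono v(2)) auto
      finally show "CU * real (card (dball d x s)) / s powr \<beta> \<le> c0 * (v x s / (C4 * s powr \<beta>))" by simp
    qed
    also have "\<dots> = ennreal c0 * ennreal (v x s / (C4 * s powr \<beta>))"
      using c0(1) by (intro ennreal_mult') simp
    also have "\<dots> \<le> ennreal c0 * (ennreal (1 / c0) * dirichlet_sum adj F)" by (intro mult_left_mono le) simp
    also have "\<dots> = dirichlet_sum adj F"
      using c0(1) by (simp add: mult.assoc[symmetric] ennreal_mult'[symmetric])
    finally show ?thesis .
  qed
  interpret resistance_partition adj K \<pi> \<phi> D d r e0 \<delta> cg tk a1 a2 "C2 * m2 / c0" \<alpha> Ma pm \<beta> lam CL CU s0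
  proof
    show "connected_partition adj K \<pi>" by (rule K(3))
    show "C2 * m2 / c0 > 0" using C2 m2 c0 by simp
    show "0 \<le> \<alpha>" using ab by simp
    show "d x z \<le> d x y + d y z" for x y z by (rule metric(4))
    show "\<exists>F. (\<forall>y\<in>dball d x (lam * s). F y = 1) \<and> (\<forall>y. y \<notin> dball d x s \<longrightarrow> F y = 0) \<and>
      dirichlet_sum adj F \<le> ennreal (CL * real (card (dball d x s)) / s powr \<beta>)" if "s0 \<le> s" for x s
      by (rule cap_le[OF that])
    show "ennreal (CU * real (card (dball d x s)) / s powr \<beta>) \<le> dirichlet_sum adj F"
      if "s0 \<le> s" "F x = 1" "\<And>y. y \<notin> dball d x s \<Longrightarrow> F y = 0" for s F x
      by (rule cap_ge[where x = x]) (use that in auto)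
  qed (use metric e0 \<delta> sep fin doubling r cg tk ad pm C3(1) CL CU in auto)

  \<comment> \<open>Heat kernel estimate in terms of cardinalities\<close>
  obtain c5 where c5: "c5 > 0" "\<And>x n. n \<ge> 1 \<Longrightarrow>
      ennreal c5 \<le> ennreal (hk adj mu (2 * n) x x) * Vd adj mu d x (real n powr (1 / \<beta>)) \<and>
      ennreal (hk adj mu (2 * n) x x) * Vd adj mu d x (real n powr (1 / \<beta>)) \<le> ennreal (1 / c5)"
    using HK by blast
  \<comment> \<open>The return probability is \<open>hk\<close> times a vertex weight in
    \<open>[c0, m2]\<close>, and volume over cardinality lies in the same interval, so the constants
    change by the ratio of the two bounds.\<close>
  have heat: "c5 * c0 / m2 \<le> pn adj mu (2 * n) x x * real (card (dball d x (real n powr (1 / \<beta>)))) \<and>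
      pn adj mu (2 * n) x x * real (card (dball d x (real n powr (1 / \<beta>)))) \<le> m2 / (c5 * c0)"
    if n: "n \<ge> 1" for n :: nat and x
  proof -
    define s where "s = real n powr (1 / \<beta>)"
    define hh where "hh = hk adj mu (2 * n) x x"
    define b where "b = real (card (dball d x s))"
    define mx where "mx = mux adj mu x"
    have mx: "c0 \<le> mx" "mx \<le> m2" using mux by (auto simp: mx_def)
    have mx0: "mx > 0" using mx c0(1) by linarith
    have p: "pn adj mu (2 * n) x x = hh * mx" using mx0 by (simp add: hh_def hk_def mx_def)
    have le: "ennreal c5 \<le> ennreal hh * ennreal (v x s)" "ennreal hh * ennreal (v x s) \<le> ennreal (1 / c5)"
      using c5(2)[OF n, of x] unfolding s_def hh_def v(1) by auto
    have hh0: "hh > 0"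
    proof (rule ccontr)
      assume "\<not> hh > 0"
      then have "ennreal hh = 0" by (simp add: ennreal_neg)
      then have "ennreal c5 \<le> 0" using le(1) by (metis mult_zero_left)
      then show False using c5(1) by simp
    qed
    have hv: "c5 \<le> hh * v x s" "hh * v x s \<le> 1 / c5"
      using le hh0 v0[of x s] c5(1) by (auto simp: ennreal_mult[symmetric] ennreal_le_iff)
    have vb: "c0 * b \<le> v x s" "v x s \<le> m2 * b" unfolding b_def by (rule v(2), rule v(3))
    have b0: "b \<ge> 0" by (simp add: b_def)
    have "c5 * c0 \<le> hh * v x s * c0" using hv(1) c0(1) by (intro mult_right_mono) auto
    also have "\<dots> \<le> hh * (m2 * b) * mx"
      using hh0 vb(2) v0[of x s] mx(1) c0(1) m2 b0 by (intro mult_mono) auto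
    finally have lo: "c5 * c0 / m2 \<le> hh * mx * b" using m2 by (simp add: field_simps)
    have "hh * mx * (c0 * b) \<le> hh * m2 * v x s"
      using hh0 mx(2) mx0 vb(1) c0(1) m2 b0 by (intro mult_mono) auto
    also have "\<dots> = m2 * (hh * v x s)" by simp
    also have "\<dots> \<le> m2 * (1 / c5)" using hv(2) m2 by (intro mult_left_mono) auto
    finally have hi: "hh * mx * b \<le> m2 / (c5 * c0)" using c0(1) c5(1) by (simp add: field_simps)
    show ?thesis using lo hi unfolding p b_def s_def by simp
  qed

  \<comment> \<open>Identification of the exponents\<close>
  define x0 :: 'a where "x0 = undefined"
  define W where "W k = ln (vol x0 k)" for k
  obtain B where B: "\<And>k. 0 \<le> W k / real k \<and> W k / real k \<le> B"
    using vol_rate_bounded[of x0] unfolding W_def by blast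
  obtain l u where l: "liminf (\<lambda>k. ereal (W k / real k)) = ereal l"
    and u: "limsup (\<lambda>k. ereal (W k / real k)) = ereal u"
    using liminf_limsup_real[of "\<lambda>k. W k / real k" B] B by blast
  define \<gamma> where "\<gamma> = - \<beta> * ln r"
  have \<beta>: "\<beta> > 0" using ab by simp
  have \<gamma>: "\<gamma> > 0" using \<beta> r by (simp add: \<gamma>_def mult_pos_neg)
  have dS: "dS_low adj mu x = ereal (2 * l / \<gamma>) \<and> dS_up adj mu x = ereal (2 * u / \<gamma>)" for x
  proof -
    obtain C where C: "\<And>n. n \<ge> 2 \<Longrightarrow> \<bar>- ln (pn adj mu (2 * n) x x) - W (nat \<lfloor>ln (real n) / \<gamma>\<rfloor>)\<bar> \<le> C"
      using return_probability_rate[OF \<beta>, of "c5 * c0 / m2" "\<lambda>n. pn adj mu (2 * n) x x" x "m2 / (c5 * c0)" x0]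
        heat[of _ x] c5(1) c0(1) m2 unfolding W_def \<gamma>_def by auto
    have lo: "liminf (\<lambda>n. ereal (- ln (pn adj mu (2 * n) x x) / ln (real n))) = ereal (l / \<gamma>)"
      by (rule liminf_time_scale[OF \<gamma> C l])
    have up: "limsup (\<lambda>n. ereal (- ln (pn adj mu (2 * n) x x) / ln (real n))) = ereal (u / \<gamma>)"
      by (rule limsup_time_scale[OF \<gamma> C u])
    show ?thesis unfolding dS_low_def dS_up_def lo up by simp
  qed
  show ?thesis
  proof
    fix N1 :: nat
    obtain M where M: "\<And>N2 N. N2 \<ge> M \<Longrightarrow> N \<ge> 1 \<Longrightarrow>
        R_low K \<pi> \<phi> r pm 2 N1 N2 N = ereal (exp (l + \<beta> * ln r))"
      using R_low_eq[OF l[unfolded W_def]] by blast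
    \<comment> \<open>Counts and energies differ by the exact exponential factor
      \<open>(r powr \<beta>) ^ k\<close>, so the lower growth rate \<open>l\<close> cancels. Hence
      the lower count stands in the denominator of both dimensions, even where the numerator carries
      the upper one.\<close>
    have "ln (exp l) - ln (exp (l + \<beta> * ln r)) = \<gamma>" by (simp add: \<gamma>_def)
    then show "\<exists>M. \<forall>N2\<ge>M. \<forall>N::nat. N \<ge> 1 \<longrightarrow> (\<exists>nl nu rl :: real.
        N_low K \<pi> r = ereal nl \<and> N_up K \<pi> r = ereal nu \<and> R_low K \<pi> \<phi> r pm 2 N1 N2 N = ereal rl \<and>
        (\<forall>x. dS_low adj mu x = ereal (2 * ln nl / (ln nl - ln rl)) \<and>
             dS_up adj mu x = ereal (2 * ln nu / (ln nl - ln rl))))"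
      using M N_low_eq[OF l[unfolded W_def]] N_up_eq[OF u[unfolded W_def]] dS
      by (intro exI[of _ M] allI impI exI[of _ "exp l"] exI[of _ "exp u"] exI[of _ "exp (l + \<beta> * ln r)"]) auto
  qed
qed

end
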